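(* Assume the following statement (qNCC-II): there exist $\epsilon>0$ and $C>0$ such that for every sequence $\{\lambda_g\}_{g\ge 0}$ with $\lambda_g\in\mathbb D$ and $\|\{\lambda_g\}\|_{\ell^2(\mathbb Z_+)}\le \epsilon$, one has $$\int_{\mathbb T}\log\bigl(1+O^2(\xi,\{\lambda_g\})\bigr)\,dm(\xi)\le C\,\|\{\lambda_g\}\|_{\ell^2(\mathbb Z_+)}^2 .$$ Let $\{\gamma_g\}_{g\ge0}\in\ell^2(\mathbb Z_+)$ with $\gamma_g\in\mathbb D$ for all $g$, and let $\sigma\in\mathcal M(\mathbb T)$ be the measure with Schur parameters $\{\gamma_g\}$. Then $\lim_{n\to\infty}\Pi_n(\xi,\{\gamma_g\})$ exists for a.e. $\xi\in\mathbb T$, and $$\lim_{n\to\infty}\phi_n^*(\xi,\sigma)=D_\sigma^{-1}(\xi)\quad\text{for a.e. }\xi\in\mathbb T .$$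
   Context: Notation: $\mathbb Z_+=\{0,1,2,\dots\}$, $\mathbb T=\{z\in\mathbb C:|z|=1\}$, $\mathbb D=\{z\in\mathbb C:|z|<1\}$, and $m$ is normalized Lebesgue measure on $\mathbb T$, $dm=d\theta/(2\pi)$; "a.e." refers to Lebesgue measure. $\mathcal M(\mathbb T)$ is the set of probability measures on $\mathbb T$ whose support is not a finite set. For a sequence $\{\gamma_g\}_{g\ge0}\subset\mathbb D$, put $\rho_n=(1-|\gamma_n|^2)^{1/2}$ and, for $\xi\in\mathbb T$, $$\Omega_n(\xi,\{\gamma_g\})=\rho_n^{-1}\begin{pmatrix}1&\overline{\gamma_n}\,\xi^{-n}\\ \gamma_n\xi^n&1\end{pmatrix},\qquad \Pi_n(\xi,\{\gamma_g\})=\Omega_n\Omega_{n-1}\cdots\Omega_0,$$ $$O(\xi,\{\gamma_g\})=\sup_{n\ge0}\|\Pi_n(\xi,\{\gamma_g\})-I\|_2\in[0,\infty],$$ where $I$ is the $2\times2$ identity matrix and $\|A\|_2=\sqrt{\operatorname{tr}(A^*A)}$ is the Frobenius norm. For $\sigma\in\mathcal M(\mathbb T)$, $\Phi_n(z,\sigma)$, $n\in\mathbb Z_+$, are the monic orthogonal polynomials: $\Phi_n(z,\sigma)=z^n+\dots$ has degree $n$ and $\int_{\mathbb T}\Phi_n(\xi,\sigma)\overline{\xi^j}\,d\sigma(\xi)=0$ for $0\le j\le n-1$. The orthonormal polynomials are $\phi_n=\Phi_n/\|\Phi_n\|_{L^2_\sigma}$. Put $\Phi_n^*(z,\sigma)=z^n\overline{\Phi_n(\bar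 z^{-1},\sigma)}$ and $\phi_n^*(z,\sigma)=z^n\overline{\phi_n(\bar z^{-1},\sigma)}$. The Schur (Verblunsky) parameters $\{\gamma_n\}_{n\ge0}\subset\mathbb D$ of $\sigma$ are defined by the recursion $\Phi_{n+1}=z\Phi_n-\overline{\gamma_n}\Phi_n^*$, $\Phi_{n+1}^*=\Phi_n^*-\gamma_nz\Phi_n$, $\Phi_0=\Phi_0^*=1$; the map sending $\sigma$ to its Schur parameters is a bijection between $\mathcal M(\mathbb T)$ and the set of all sequences in $\mathbb D$. Write $d\sigma=w\,dm+d\sigma_s$ with $\sigma_s$ singular. One has $\{\gamma_g\}\in\ell^2(\mathbb Z_+)$ if and only if $\int_{\mathbb T}\log w\,dm>-\infty$ (Szegő's theorem), and in this case the Szegő function is $$D_\sigma(z)=\exp\left(\frac12\int_{\mathbb T}\frac{\xi+z}{\xi-z}\log w(\xi)\,dm(\xi)\right),\qquad z\in\mathbb D,$$ an outer function in $H^2(\mathbb D)$ with $D_\sigma(0)>0$ and $|D_\sigma(\xi)|^2=w(\xi)$ for a.e. $\xi\in\mathbb T$; $D_\sigma(\xi)$ for $\xi\in\mathbb T$ denotes its nontangential boundary value, and $D_\sigma^{-1}=1/D_\sigma$. *)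

theory Defs
  imports "HOL-Probability.Probability" "HOL-Computational_Algebra.Polynomial"
begin

section \<open>The unit circle and square-summable sequences\<close>

definition circle_measure :: "complex measure" where
  "circle_measure = distr (uniform_measure lborel {0..<2 * pi}) borel cis"

definition disc_sequence :: "(nat \<Rightarrow> complex) \<Rightarrow> bool" where
  "disc_sequence g \<longleftrightarrow> (\<forall>n. cmod (g n) < 1)"

definition in_l2 :: "(nat \<Rightarrow> complex) \<Rightarrow> bool" where
  "in_l2 g \<longleftrightarrow> summable (\<lambda>n. (cmod (g n))\<^sup>2)"

text \<open>The \<open>suminf\<close> below is the norm only for sequences satisfying \<^const>\<open>in_l2\<close>.\<close>
definition l2_norm :: "(nat \<Rightarrow> complex) \<Rightarrow> real" where
  "l2_norm g = sqrt (\<Sum>n. (cmod (g n))\<^sup>2)"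


section \<open>Transfer matrices and the maximal function\<close>

definition rho :: "(nat \<Rightarrow> complex) \<Rightarrow> nat \<Rightarrow> real" where
  "rho g n = sqrt (1 - (cmod (g n))\<^sup>2)"

definition Omega :: "(nat \<Rightarrow> complex) \<Rightarrow> complex \<Rightarrow> nat \<Rightarrow> complex^2^2" where
  "Omega g \<xi> n = inverse (rho g n) *\<^sub>R
     vector [vector [1, cnj (g n) * \<xi> powi (- int n)],
             vector [g n * \<xi> ^ n, 1]]"

primrec Omega_prod :: "(nat \<Rightarrow> complex) \<Rightarrow> complex \<Rightarrow> nat \<Rightarrow> complex^2^2" where
  "Omega_prod g \<xi> 0 = Omega g \<xi> 0"
| "Omega_prod g \<xi> (Suc n) = Omega g \<xi> (Suc n) ** Omega_prod g \<xi> n"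

definition adjoint_matrix :: "complex^2^2 \<Rightarrow> complex^2^2" where
  "adjoint_matrix A = (\<chi> i j. cnj (A $ j $ i))"

definition frobenius_norm :: "complex^2^2 \<Rightarrow> real" where
  "frobenius_norm A = sqrt (Re (trace (adjoint_matrix A ** A)))"

definition maximal_O :: "(nat \<Rightarrow> complex) \<Rightarrow> complex \<Rightarrow> ennreal" where
  "maximal_O g \<xi> = (SUP n. ennreal (frobenius_norm (Omega_prod g \<xi> n - mat 1)))"

text \<open>The function \<open>t \<mapsto> log (1 + t\<^sup>2)\<close> on \<open>[0, \<infinity>]\<close>, with value \<open>\<infinity>\<close> at \<open>\<infinity>\<close>.\<close>
definition log_one_plus_sq :: "ennreal \<Rightarrow> ennreal" where
  "log_one_plus_sq t = (if t = \<infinity> then \<infinity> else ennreal (ln (1 + (enn2real t)\<^sup>2)))"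

definition qNCC_II :: bool where
  "qNCC_II \<longleftrightarrow> (\<exists>\<epsilon>>0. \<exists>C>0. \<forall>g. disc_sequence g \<and> in_l2 g \<and> l2_norm g \<le> \<epsilon> \<longrightarrow>
     (\<integral>\<^sup>+ \<xi>. log_one_plus_sq (maximal_O g \<xi>) \<partial>circle_measure) \<le> ennreal (C * (l2_norm g)\<^sup>2))"


section \<open>Orthogonal polynomials on the unit circle\<close>

definition measure_support :: "'a::topological_space measure \<Rightarrow> 'a set" where
  "measure_support M = {x. \<forall>U. open U \<and> x \<in> U \<longrightarrow> emeasure M U > 0}"

text \<open>Measures on the circle are Borel measures on \<open>\<complex>\<close> that do not charge the complement.\<close>
definition circle_prob_measures :: "complex measure set" where
  "circle_prob_measures = {\<sigma>. prob_space \<sigma> \<and> sets \<sigma> = sets borel \<and>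
     emeasure \<sigma> (- sphere 0 1) = 0 \<and> infinite (measure_support \<sigma>)}"

definition is_monic_OP :: "complex measure \<Rightarrow> nat \<Rightarrow> complex poly \<Rightarrow> bool" where
  "is_monic_OP \<sigma> n p \<longleftrightarrow> degree p = n \<and> lead_coeff p = 1 \<and>
     (\<forall>j<n. (LINT \<xi>|\<sigma>. poly p \<xi> * cnj (\<xi> ^ j)) = 0)"

definition monic_OP :: "complex measure \<Rightarrow> nat \<Rightarrow> complex poly" where
  "monic_OP \<sigma> n = (THE p. is_monic_OP \<sigma> n p)"

definition orthonormal_OP :: "complex measure \<Rightarrow> nat \<Rightarrow> complex poly" where
  "orthonormal_OP \<sigma> n =
     smult (of_real (inverse (sqrt (LINT \<xi>|\<sigma>. (cmod (poly (monic_OP \<sigma> n) \<xi>))\<^sup>2)))) (monic_OP \<sigma> n)"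

text \<open>The reversed polynomial \<open>z\<^sup>n cnj (p (1 / cnj z))\<close> with \<open>n = degree p\<close>; as a polynomial it is
  also meaningful at \<open>z = 0\<close>.\<close>
definition star :: "complex poly \<Rightarrow> complex poly" where
  "star p = map_poly cnj (reflect_poly p)"

lemma poly_star:
  assumes "z \<noteq> 0"
  shows "poly (star p) z = z ^ degree p * cnj (poly p (inverse (cnj z)))"
proof -
  have "poly (map_poly cnj q) z = cnj (poly q (cnj z))" for q
    by (induction q) (auto simp: map_poly_pCons)
  then show ?thesis
    using assms by (simp add: star_def poly_reflect_poly_nz)
qed

definition has_schur_parameters :: "complex measure \<Rightarrow> (nat \<Rightarrow> complex) \<Rightarrow> bool" where
  "has_schur_parameters \<sigma> g \<longleftrightarrow> disc_sequence g \<and>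
     monic_OP \<sigma> 0 = 1 \<and> star (monic_OP \<sigma> 0) = 1 \<and>
     (\<forall>n. monic_OP \<sigma> (Suc n) =
            [:0, 1:] * monic_OP \<sigma> n - smult (cnj (g n)) (star (monic_OP \<sigma> n))) \<and>
     (\<forall>n. star (monic_OP \<sigma> (Suc n)) =
            star (monic_OP \<sigma> n) - smult (g n) ([:0, 1:] * monic_OP \<sigma> n))"


section \<open>The Szego function\<close>

definition singular_to_circle_measure :: "complex measure \<Rightarrow> bool" where
  "singular_to_circle_measure \<mu> \<longleftrightarrow>
     (\<exists>N\<in>sets borel. emeasure circle_measure N = 0 \<and> emeasure \<mu> (- N) = 0)"

definition is_ac_density :: "complex measure \<Rightarrow> (complex \<Rightarrow> real) \<Rightarrow> bool" where
  "is_ac_density \<sigma> w \<longleftrightarrow> w \<in> borel_measurable borel \<and> (\<forall>\<xi>. 0 \<le> w \<xi>) \<and>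
     (\<exists>\<sigma>s. sets \<sigma>s = sets borel \<and> singular_to_circle_measure \<sigma>s \<and>
        (\<forall>A\<in>sets borel. emeasure \<sigma> A =
           emeasure (density circle_measure (\<lambda>\<xi>. ennreal (w \<xi>))) A + emeasure \<sigma>s A))"

text \<open>The density is determined up to null sets of \<^const>\<open>circle_measure\<close>. The library's
  \<^const>\<open>RN_deriv\<close> cannot be used, since it is \<open>0\<close> when the measure has a singular part.\<close>
definition ac_density :: "complex measure \<Rightarrow> complex \<Rightarrow> real" where
  "ac_density \<sigma> = (SOME w. is_ac_density \<sigma> w)"

text \<open>Meaningful when \<open>log w\<close> is integrable, in which case \<open>w > 0\<close> almost everywhere and the
  convention \<^prop>\<open>ln 0 = (0::real)\<close> plays no role.\<close>
definition szego_function :: "complex measure \<Rightarrow> complex \<Rightarrow> complex" where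
  "szego_function \<sigma> z = exp (1 / 2 *
     (LINT \<xi>|circle_measure. (\<xi> + z) / (\<xi> - z) * of_real (ln (ac_density \<sigma> \<xi>))))"

definition stolz_region :: "real \<Rightarrow> complex \<Rightarrow> complex set" where
  "stolz_region \<alpha> \<xi> = {z \<in> ball 0 1. dist z \<xi> < \<alpha> * (1 - cmod z)}"

definition has_nontangential_limit :: "(complex \<Rightarrow> complex) \<Rightarrow> complex \<Rightarrow> complex \<Rightarrow> bool" where
  "has_nontangential_limit f \<xi> l \<longleftrightarrow>
     (\<forall>\<alpha>>1. (f \<longlongrightarrow> l) (at \<xi> within stolz_region \<alpha> \<xi>))"

end

theory Submission
  imports Defs "HOL-Complex_Analysis.Complex_Analysis"
begin

text \<open>
  Why the theorem is true. Write \<open>f\<^sub>n = 1 / \<phi>\<^sub>n\<^sup>*\<close>, which is zero free and continuous on the closed disc and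
  holomorphic inside (\<open>inv_phi\<close> below).

  Convergence. On the circle \<open>\<Omega>\<^sub>n\<close> takes the vector \<open>(\<xi>\<^bsup>1-n\<^esup> \<phi>\<^sub>n, - \<phi>\<^sub>n\<^sup>*)\<close> to the same vector with \<open>n + 1\<close> for \<open>n\<close>,
  so \<open>\<phi>\<^sub>n\<^sub>+\<^sub>1\<^sup>*\<close> can be read off from the product \<open>\<Pi>\<^sub>n\<close>. The hypothesis \<open>qNCC_II\<close> is applied to the tails of the parameter sequence:
  their \<open>\<ell>\<^sup>2\<close> norms tend to \<open>0\<close>, and Fatou's lemma makes the maximal functions \<open>O\<close> of the tails
  arbitrarily small at almost every point. Since a product factors into a tail product and a fixed
  initial product, \<open>\<Pi>\<^sub>n(\<xi>)\<close> is a Cauchy sequence (\<open>Omega_prod_convergent\<close>). Hence \<open>f\<^sub>n\<close> converges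
  almost everywhere on the circle to a nonzero limit \<open>G\<close>. The same hypothesis for one tail
  gives an integrable majorant of all \<open>\<bar>log \<bar>f\<^sub>n\<bar>\<bar>\<close> (\<open>inv_phi_dominated\<close>).

  Identification of \<open>\<bar>G\<bar>\<^sup>2\<close>. The measures \<open>\<bar>f\<^sub>n\<bar>\<^sup>2 dm\<close> have the same moments of order at most \<open>n\<close> as \<open>\<sigma>\<close>
  (\<open>bernstein_szego\<close>), so they converge to \<open>\<sigma>\<close> weakly, and Fatou's lemma gives
  \<open>\<bar>G\<bar>\<^sup>2 dm \<le> \<sigma>\<close>, that is \<open>\<bar>G\<bar>\<^sup>2 \<le> w\<close>. On the other hand \<open>\<integral> \<bar>\<phi>\<^sub>n\<bar>\<^sup>2 w dm \<le> \<integral> \<bar>\<phi>\<^sub>n\<bar>\<^sup>2 d\<sigma> = 1\<close>, and Fatou's lemma gives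
  \<open>\<integral> w / \<bar>G\<bar>\<^sup>2 dm \<le> 1\<close>. Together these force \<open>w = \<bar>G\<bar>\<^sup>2\<close> almost everywhere (\<open>ac_density_eq_limit\<close>).

  Identification of \<open>G\<close> inside the disc. By the Schwarz formula \<open>f\<^sub>n(z)\<close> is the exponential of the
  Schwarz integral of \<open>log \<bar>f\<^sub>n\<bar>\<close>; dominated convergence and \<open>w = \<bar>G\<bar>\<^sup>2\<close> turn this into
  \<open>f\<^sub>n(z) \<longrightarrow> D\<^sub>\<sigma>(z)\<close> (\<open>inv_phi_tendsto_szego_function\<close>). The bound \<open>\<integral> \<bar>f\<^sub>n\<bar>\<^sup>2 dm = 1\<close> upgrades the
  pointwise convergence \<open>f\<^sub>n \<longrightarrow> G\<close> on the circle to convergence in \<open>L\<^sup>1\<close>, so the Poisson formula gives that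
  \<open>D\<^sub>\<sigma>\<close> is the Poisson integral of \<open>G\<close>.

  Boundary values. A Poisson integral of an \<open>L\<^sup>1\<close> limit of functions continuous on the closed disc has
  the expected nontangential limits almost everywhere. This is the usual argument with the
  Hardy--Littlewood maximal function, and it is carried out for discs centred on the circle, so
  that the Vitali covering lemma applies directly (\<open>nontangential_limit_of_L1_limit\<close>).
\<close>

section \<open>Integration over the unit circle\<close>

lemma sets_circle [measurable_cong, simp]: "sets circle_measure = sets borel"
  by (simp add: circle_measure_def)

lemma space_circle [simp]: "space circle_measure = UNIV"
  by (simp add: circle_measure_def)

lemma borel_measurable_cis [measurable]: "cis \<in> borel_measurable borel"
  by (intro borel_measurable_continuous_onI continuous_intros)

lemma prob_space_arg: "prob_space (uniform_measure lborel {0..<2 * pi})"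
  by (rule prob_space_uniform_measure) auto

lemma prob_space_circle: "prob_space circle_measure"
  unfolding circle_measure_def
  by (rule prob_space.prob_space_distr[OF prob_space_arg]) simp

interpretation circle: prob_space circle_measure
  by (rule prob_space_circle)

lemma AE_circle_norm: "AE \<xi> in circle_measure. cmod \<xi> = 1"
  unfolding circle_measure_def by (subst AE_distr_iff) auto

lemma unit_mult_cnj: "cmod \<xi> = 1 \<Longrightarrow> \<xi> * cnj \<xi> = 1"
  by (simp add: complex_norm_square[symmetric])

locale circle_finite_measure = finite_measure \<mu> for \<mu> :: "complex measure" +
  assumes sets_\<mu> [measurable_cong, simp]: "sets \<mu> = sets borel"
    and AE_unit: "AE \<xi> in \<mu>. cmod \<xi> = 1"
begin

lemma space_\<mu>: "space \<mu> = UNIV"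
  using sets_eq_imp_space_eq[OF sets_\<mu>] by simp

lemma integrable_continuous_circle:
  fixes h :: "complex \<Rightarrow> 'a :: {banach, second_countable_topology}"
  assumes [measurable]: "h \<in> borel_measurable borel" and "continuous_on (sphere 0 1) h"
  shows "integrable \<mu> h"
proof -
  have "compact (h ` sphere 0 1)" by (rule compact_continuous_image[OF assms(2)]) auto
  then obtain B where "\<And>x. x \<in> h ` sphere 0 1 \<Longrightarrow> norm x \<le> B"
    using compact_imp_bounded[of "h ` sphere 0 1"] unfolding bounded_iff by blast
  then show ?thesis
    by (intro integrable_const_bound[of _ B]) (use AE_unit in \<open>auto elim!: eventually_mono\<close>)
qed

end

lemma circle_finite_measure_circle: "circle_finite_measure circle_measure"
  by (intro circle_finite_measure.intro circle_finite_measure_axioms.intro circle.finite_measure_axioms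
      sets_circle AE_circle_norm)

lemmas integrable_circle_continuous =
  circle_finite_measure.integrable_continuous_circle[OF circle_finite_measure_circle]

lemma emeasure_circle:
  assumes [measurable]: "A \<in> sets borel"
  shows "emeasure circle_measure A = emeasure lborel ({0..<2*pi} \<inter> cis -` A) / ennreal (2 * pi)"
  unfolding circle_measure_def
  using measurable_sets_borel[OF borel_measurable_cis assms]
  by (subst emeasure_distr) (auto simp: emeasure_uniform_measure)

lemma integral_circle_eq:
  fixes f :: "complex \<Rightarrow> complex"
  assumes [measurable]: "f \<in> borel_measurable borel" and cont: "continuous_on (sphere 0 1) f"
  shows "(LINT \<xi>|circle_measure. f \<xi>) = integral {0..2*pi} (\<lambda>t. f (cis t)) / (2*pi)"
proof -
  have c: "continuous_on {0..2*pi} (\<lambda>t. f (cis t))"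
    by (rule continuous_on_compose2[OF cont]) (auto intro!: continuous_intros)
  have "(LINT \<xi>|circle_measure. f \<xi>) = (LINT t|uniform_measure lborel {0..<2 * pi}. f (cis t))"
    unfolding circle_measure_def by (rule integral_distr) auto
  also have "\<dots> = (LINT t|density lborel (\<lambda>t. ennreal (indicator {0..<2*pi} t / (2*pi))). f (cis t))"
    unfolding uniform_measure_def
    by (intro Bochner_Integration.integral_cong arg_cong2[where f=density] ext refl)
       (auto simp: indicator_def divide_ennreal simp flip: ennreal_1)
  also have "\<dots> = (LINT t|lborel. (indicator {0..<2*pi} t / (2*pi)) *\<^sub>R f (cis t))"
    by (rule integral_density) auto
  also have "\<dots> = (LINT t|lborel. (indicator {0..2*pi} t *\<^sub>R f (cis t)) / (2*pi))"
  proof (rule integral_cong_AE)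
    show "AE x in lborel. (indicator {0..<2 * pi} x / (2 * pi)) *\<^sub>R f (cis x) =
         indicat_real {0..2 * pi} x *\<^sub>R f (cis x) / complex_of_real (2 * pi)"
      using AE_lborel_singleton[of "2*pi"]
      by eventually_elim (auto simp: indicator_def scaleR_conv_of_real)
  qed auto
  also have "\<dots> = (LINT t|lborel. (indicator {0..2*pi} t *\<^sub>R f (cis t))) / (2*pi)"
    by simp
  also have "(LINT t|lborel. (indicator {0..2*pi} t *\<^sub>R f (cis t))) = integral {0..2*pi} (\<lambda>t. f (cis t))"
    using set_borel_integral_eq_integral(2)[of "{0..2*pi}" "\<lambda>t. f (cis t)"]
      borel_integrable_atLeastAtMost'[OF c]
    by (simp add: set_lebesgue_integral_def set_integrable_def)
  finally show ?thesis .
qed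

text \<open>
  Cauchy's formula on the unit circle with \<open>d\<zeta> = \<i> \<zeta> d\<theta>\<close> absorbed into the normalised measure.
\<close>

lemma cauchy_formula_circle:
  assumes [measurable]: "f \<in> borel_measurable borel"
    and "continuous_on (cball 0 1) f" "f holomorphic_on ball 0 1" and z: "cmod z < 1"
  shows "(LINT \<xi>|circle_measure. f \<xi> * \<xi> / (\<xi> - z)) = f z"
proof -
  have "((\<lambda>u. f u/(u-z)) has_contour_integral (2 * of_real pi * \<i> * f z)) (circlepath 0 1)"
    by (rule Cauchy_integral_circlepath) (use assms in auto)
  then have "((\<lambda>x. f (cis x) / (cis x - z) * 1 * \<i> * cis x) has_integral (2 * of_real pi * \<i> * f z)) {0..2*pi}"
    unfolding circlepath_def by (subst (asm) has_contour_integral_part_circlepath_iff) auto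
  then have "((\<lambda>x. (f (cis x) * cis x / (cis x - z)) * \<i>) has_integral ((2 * of_real pi * f z) * \<i>)) {0..2*pi}"
    by (simp add: mult_ac)
  then have "((\<lambda>x. (f (cis x) * cis x / (cis x - z))) has_integral (2 * of_real pi * f z)) {0..2*pi}"
    by (drule_tac has_integral_mult_left[where c="-\<i>"]) (simp add: mult.assoc)
  then have "integral {0..2*pi} (\<lambda>x. (f (cis x) * cis x / (cis x - z))) = 2 * of_real pi * f z"
    by blast
  then show ?thesis
    by (subst integral_circle_eq)
       (use z in \<open>auto intro!: continuous_intros continuous_on_subset[OF assms(2)]\<close>)
qed

lemma mean_value_circle:
  assumes [measurable]: "f \<in> borel_measurable borel"
    and "continuous_on (cball 0 1) f" "f holomorphic_on ball 0 1"
  shows "(LINT \<xi>|circle_measure. f \<xi>) = f 0"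
proof -
  have "(LINT \<xi>|circle_measure. f \<xi>) = (LINT \<xi>|circle_measure. f \<xi> * \<xi> / (\<xi> - 0))"
  proof (rule integral_cong_AE)
    show "AE \<xi> in circle_measure. f \<xi> = f \<xi> * \<xi> / (\<xi> - 0)"
      using AE_circle_norm by eventually_elim auto
  qed auto
  then show ?thesis using cauchy_formula_circle[of f 0] assms by simp
qed

section \<open>The Poisson and Schwarz formulas\<close>

lemma borel_measurable_cnj [measurable]: "cnj \<in> borel_measurable borel"
  by (intro borel_measurable_continuous_onI continuous_intros)

definition poisson_kernel :: "complex \<Rightarrow> complex \<Rightarrow> real" where
  "poisson_kernel z \<xi> = (1 - (cmod z)\<^sup>2) / (cmod (\<xi> - z))\<^sup>2"

lemma borel_measurable_poisson_kernel [measurable]: "poisson_kernel z \<in> borel_measurable borel"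
  unfolding poisson_kernel_def by measurable

lemma one_minus_cnj_mult_nonzero:
  assumes "cmod z < 1" "\<xi> \<in> cball 0 1" shows "1 - cnj z * \<xi> \<noteq> 0"
proof
  assume "1 - cnj z * \<xi> = 0"
  then have "cmod z * cmod \<xi> = 1" by (metis complex_mod_cnj eq_iff_diff_eq_0 norm_mult norm_one)
  moreover have "cmod z * cmod \<xi> \<le> cmod z * 1" using assms by (intro mult_left_mono) auto
  ultimately show False using assms by auto
qed

text \<open>
  The first summand is the Cauchy kernel. The second extends holomorphically to the disc and
  vanishes at \<open>0\<close>, so its product with a holomorphic function has mean value \<open>0\<close>. The Poisson formula follows.
\<close>

lemma poisson_kernel_split:
  assumes "cmod z < 1" "cmod \<xi> = 1"
  shows "of_real (poisson_kernel z \<xi>) = \<xi> / (\<xi> - z) + cnj z * \<xi> / (1 - cnj z * \<xi>)"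
proof -
  note x = unit_mult_cnj[OF assms(2)]
  have nz: "\<xi> - z \<noteq> 0" "1 - cnj z * \<xi> \<noteq> 0"
    using assms one_minus_cnj_mult_nonzero[of z \<xi>] by auto
  have "\<xi> \<noteq> 0" using assms by auto
  have e: "1 - cnj z * \<xi> = \<xi> * cnj (\<xi> - z)" using x by (simp add: algebra_simps)
  have "of_real (poisson_kernel z \<xi>) = (1 - z * cnj z) / ((\<xi> - z) * cnj (\<xi> - z))"
    unfolding poisson_kernel_def of_real_divide of_real_diff complex_norm_square of_real_1 ..
  also have "\<dots> = \<xi> * (1 - z * cnj z) / ((\<xi> - z) * (\<xi> * cnj (\<xi> - z)))"
    using \<open>\<xi> \<noteq> 0\<close> by simp
  also have "\<dots> = \<xi> * (1 - z * cnj z) / ((\<xi> - z) * (1 - cnj z * \<xi>))"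
    by (simp only: e)
  also have "\<dots> = \<xi> / (\<xi> - z) + cnj z * \<xi> / (1 - cnj z * \<xi>)"
    using nz by (simp add: divide_simps) (simp add: algebra_simps)
  finally show ?thesis .
qed

lemma poisson_formula:
  assumes [measurable]: "f \<in> borel_measurable borel"
    and c: "continuous_on (cball 0 1) f" and h: "f holomorphic_on ball 0 1" and z: "cmod z < 1"
  shows "(LINT \<xi>|circle_measure. of_real (poisson_kernel z \<xi>) * f \<xi>) = f z"
proof -
  let ?q = "\<lambda>\<xi>. f \<xi> * (cnj z * \<xi> / (1 - cnj z * \<xi>))"
  have nz: "\<And>\<xi>. \<xi> \<in> cball 0 1 \<Longrightarrow> 1 - cnj z * \<xi> \<noteq> 0"
    using one_minus_cnj_mult_nonzero[OF z] by blast
  have cs: "continuous_on (sphere 0 1) f" by (rule continuous_on_subset[OF c]) auto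
  have qc: "continuous_on (cball 0 1) ?q"
    by (intro continuous_intros c) (use nz in auto)
  have q: "(LINT \<xi>|circle_measure. ?q \<xi>) = ?q 0"
    by (rule mean_value_circle[OF _ qc])
       (use nz in \<open>auto intro!: holomorphic_intros h\<close>)
  have "(LINT \<xi>|circle_measure. of_real (poisson_kernel z \<xi>) * f \<xi>)
      = (LINT \<xi>|circle_measure. f \<xi> * \<xi> / (\<xi> - z) + ?q \<xi>)"
  proof (rule integral_cong_AE)
    show "AE \<xi> in circle_measure. of_real (poisson_kernel z \<xi>) * f \<xi> = f \<xi> * \<xi> / (\<xi> - z) + ?q \<xi>"
      using AE_circle_norm
      by eventually_elim (simp add: poisson_kernel_split[OF z] algebra_simps)
  qed auto
  also have "\<dots> = (LINT \<xi>|circle_measure. f \<xi> * \<xi> / (\<xi> - z)) + (LINT \<xi>|circle_measure. ?q \<xi>)"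
    by (rule Bochner_Integration.integral_add; rule integrable_circle_continuous)
       (use z nz in \<open>auto intro!: continuous_intros cs\<close>)
  finally show ?thesis using q cauchy_formula_circle[OF _ c h z] by simp
qed

text \<open>
  On the circle the Schwarz kernel is both \<open>2\<xi> / (\<xi> - z) - 1\<close> and the conjugate of a function
  holomorphic in \<open>\<xi>\<close>. Writing \<open>2 Re L = L + cnj L\<close>, the first form handles \<open>L\<close> by Cauchy's formula and the
  second handles \<open>cnj L\<close> by the mean value property.
\<close>

lemma schwarz_formula:
  assumes [measurable]: "L \<in> borel_measurable borel"
    and c: "continuous_on (cball 0 1) L" and h: "L holomorphic_on ball 0 1" and z: "cmod z < 1"
    and L0: "Im (L 0) = 0"
  shows "(LINT \<xi>|circle_measure. (\<xi> + z) / (\<xi> - z) * of_real (Re (L \<xi>))) = L z"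
proof -
  let ?q = "\<lambda>\<xi>. L \<xi> * ((1 + cnj z * \<xi>) / (1 - cnj z * \<xi>))"
  have nz: "\<And>\<xi>. \<xi> \<in> cball 0 1 \<Longrightarrow> 1 - cnj z * \<xi> \<noteq> 0"
    using one_minus_cnj_mult_nonzero[OF z] by blast
  have cs: "continuous_on (sphere 0 1) L" by (rule continuous_on_subset[OF c]) auto
  have qc: "continuous_on (cball 0 1) ?q"
    by (intro continuous_intros c) (use nz in auto)
  have q: "(LINT \<xi>|circle_measure. ?q \<xi>) = ?q 0"
    by (rule mean_value_circle[OF _ qc])
       (use nz in \<open>auto intro!: holomorphic_intros h\<close>)
  have q': "(LINT \<xi>|circle_measure. cnj (?q \<xi>)) = cnj (?q 0)"
    using q Bochner_Integration.integral_cnj[of circle_measure ?q] by metis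
  have qi: "integrable circle_measure ?q"
    by (rule integrable_circle_continuous) (use nz in \<open>auto intro!: continuous_intros cs\<close>)
  have e: "(\<xi> + z) / (\<xi> - z) * of_real (Re (L \<xi>))
      = L \<xi> * \<xi> / (\<xi> - z) - L \<xi> / 2 + cnj (?q \<xi>) / 2" if \<xi>: "cmod \<xi> = 1" for \<xi>
  proof -
    note x = unit_mult_cnj[OF \<xi>]
    have n: "\<xi> - z \<noteq> 0" "\<xi> \<noteq> 0" using \<xi> z by auto
    have a: "cnj (?q \<xi>) = cnj (L \<xi>) * ((\<xi> + z) / (\<xi> - z))"
    proof -
      have "cnj (?q \<xi>) = cnj (L \<xi>) * ((\<xi> * (1 + z * cnj \<xi>)) / (\<xi> * (1 - z * cnj \<xi>)))"
        using n by simp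
      also have "\<xi> * (1 + z * cnj \<xi>) = \<xi> + z" using x by (simp add: algebra_simps)
      also have "\<xi> * (1 - z * cnj \<xi>) = \<xi> - z" using x by (simp add: algebra_simps)
      finally show ?thesis .
    qed
    have b: "of_real (Re (L \<xi>)) = (L \<xi> + cnj (L \<xi>)) / 2"
      by (simp add: complex_add_cnj)
    \<comment> \<open>the form of the kernel that Cauchy's formula integrates\<close>
    have c: "(\<xi> + z) / (\<xi> - z) = 2 * (\<xi> / (\<xi> - z)) - 1" using n by (simp add: field_simps)
    have d: "L \<xi> * \<xi> / (\<xi> - z) = L \<xi> * (\<xi> / (\<xi> - z))" by simp
    have "(2 * q - 1) * ((l + c) / 2) = l * q - l / 2 + c * (2 * q - 1) / 2" for q l c :: complex
      by (simp add: field_simps)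
    then show ?thesis unfolding a b c d .
  qed
  have "(LINT \<xi>|circle_measure. (\<xi> + z) / (\<xi> - z) * of_real (Re (L \<xi>)))
      = (LINT \<xi>|circle_measure. L \<xi> * \<xi> / (\<xi> - z) - L \<xi> / 2 + cnj (?q \<xi>) / 2)"
  proof (rule integral_cong_AE)
    show "AE \<xi> in circle_measure. (\<xi> + z) / (\<xi> - z) * of_real (Re (L \<xi>))
      = L \<xi> * \<xi> / (\<xi> - z) - L \<xi> / 2 + cnj (?q \<xi>) / 2"
      using AE_circle_norm by eventually_elim (rule e)
  qed auto
  also have "\<dots> = (LINT \<xi>|circle_measure. L \<xi> * \<xi> / (\<xi> - z)) - (LINT \<xi>|circle_measure. L \<xi>) / 2
     + (LINT \<xi>|circle_measure. cnj (?q \<xi>)) / 2"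
  proof -
    have 1: "integrable circle_measure (\<lambda>\<xi>. L \<xi> * \<xi> / (\<xi> - z))" "integrable circle_measure L"
      by (rule integrable_circle_continuous; use z in \<open>auto intro!: continuous_intros cs\<close>)+
    have 2: "integrable circle_measure (\<lambda>\<xi>. cnj (?q \<xi>))"
      using qi integrable_cnj by blast
    have "(LINT \<xi>|circle_measure. A \<xi> - B \<xi> / 2 + C \<xi> / 2)
        = (LINT \<xi>|circle_measure. A \<xi>) - (LINT \<xi>|circle_measure. B \<xi>) / 2 + (LINT \<xi>|circle_measure. C \<xi>) / 2"
      if "integrable circle_measure A" "integrable circle_measure B" "integrable circle_measure C"
      for A B C :: "complex \<Rightarrow> complex"
      using that by simp
    from this[OF 1 2] show ?thesis .
  qed
  also have "\<dots> = L z - L 0 / 2 + cnj (L 0) / 2"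
    using q' cauchy_formula_circle[OF _ c h z] mean_value_circle[OF _ c h] by simp
  finally show ?thesis using L0 by (simp add: complex_eq_iff)
qed

section \<open>The maximal inequality and nontangential limits\<close>

text \<open>
  The factor \<open>1 / 2\<close> is \<open>2 / \<pi>\<close> rounded down, the slope of the chord that concavity of the sine provides.
\<close>

lemma half_le_sin:
  fixes u :: real assumes "0 \<le> u" "u \<le> pi / 2" shows "u / 2 \<le> sin u"
proof -
  have cv: "concave_on {0..pi} sin"
    by (rule f''_le0_imp_concave[where f'=cos and f''="\<lambda>x. - sin x"])
       (auto intro!: derivative_eq_intros sin_ge_zero)
  have "sin ((1 - 2*u/pi) *\<^sub>R 0 + (2*u/pi) *\<^sub>R (pi/2)) \<ge> (1 - 2*u/pi) * sin 0 + (2*u/pi) * sin (pi/2)"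
    by (rule concave_onD[OF cv]) (use assms in \<open>auto simp: field_simps\<close>)
  then have "2*u/pi \<le> sin u" by simp
  moreover have "u / 2 \<le> 2*u/pi" using assms pi_less_4 mult_right_mono[of pi 4 u] by (simp add: field_simps)
  ultimately show ?thesis by linarith
qed

text \<open>
  The chord has length \<open>2 sin u\<close> with \<open>u = \<bar>t - x\<bar> / 2\<close>; the lower bound for the sine applies to \<open>u\<close> or to \<open>\<pi> - u\<close>.
\<close>

lemma dist_cis_lower:
  assumes "\<bar>t - x\<bar> < 2*pi"
  shows "min \<bar>t - x\<bar> (2*pi - \<bar>t - x\<bar>) \<le> 2 * dist (cis x) (cis t)"
proof -
  define u where "u = \<bar>t - x\<bar> / 2"
  have "(dist (cis x) (cis t))\<^sup>2 = (cos x - cos t)\<^sup>2 + (sin x - sin t)\<^sup>2"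
    by (simp add: dist_norm cmod_power2)
  also have "\<dots> = 2 - 2 * cos (t - x)"
    unfolding cos_diff using sin_cos_squared_add[of x] sin_cos_squared_add[of t]
    by (simp add: power2_eq_square algebra_simps)
  also have "\<dots> = (2 * sin ((t - x) / 2))\<^sup>2"
  proof -
    have "2 * ((t - x)/2) = t - x" by simp
    then have "cos (t - x) = 1 - 2 * (sin ((t - x)/2))\<^sup>2"
      using cos_double_sin[of "(t - x)/2"] by metis
    then show ?thesis by (simp add: power2_eq_square)
  qed
  also have "\<dots> = (2 * sin u)\<^sup>2"
    by (cases "t \<ge> x") (simp_all add: u_def abs_if power2_eq_square minus_divide_left[symmetric] del: minus_diff_eq)
  finally have "(dist (cis x) (cis t))\<^sup>2 = (2 * sin u)\<^sup>2" .
  moreover have "0 \<le> sin u" using assms by (intro sin_ge_zero) (auto simp: u_def)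
  ultimately have d: "dist (cis x) (cis t) = 2 * sin u"
    by (metis power2_eq_iff_nonneg zero_le_dist mult_nonneg_nonneg zero_le_numeral)
  show ?thesis
  proof (cases "u \<le> pi / 2")
    case True
    then have "u / 2 \<le> sin u" by (intro half_le_sin) (auto simp: u_def)
    moreover have "\<bar>t - x\<bar> = 2 * u" by (simp add: u_def)
    ultimately show ?thesis using d by (intro min.coboundedI1) simp
  next
    case False
    then have "(pi - u) / 2 \<le> sin (pi - u)" using assms by (intro half_le_sin) (auto simp: u_def)
    then show ?thesis using d u_def by (intro min.coboundedI2) simp
  qed
qed

text \<open>
  Through this linear growth the radii in the covering argument below turn into measures.
\<close>

lemma emeasure_circle_ball:
  assumes \<xi>: "cmod \<xi> = 1" and r: "r > 0"
  shows "emeasure circle_measure (ball \<xi> r) \<le> ennreal (2 * r)"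
proof -
  obtain x where x: "0 \<le> x" "x < 2*pi" "\<xi> = cis x"
    using \<xi> Arg2pi[of \<xi>] unfolding is_Arg_def
    by (intro that[of "Arg2pi \<xi>"]) (auto simp: cis_conv_exp[symmetric])
  define I where "I = (\<lambda>c. {c - 2*r..c + 2*r})"
  \<comment> \<open>angles within \<open>2r\<close> of \<open>x\<close> modulo \<open>2\<pi>\<close>; both parameters lie in \<open>[0, 2\<pi>)\<close>, so three intervals suffice\<close>
  have "{0..<2*pi} \<inter> cis -` ball \<xi> r \<subseteq> I x \<union> I (x + 2*pi) \<union> I (x - 2*pi)"
  proof
    fix t assume "t \<in> {0..<2*pi} \<inter> cis -` ball \<xi> r"
    then have t: "0 \<le> t" "t < 2*pi" "dist (cis x) (cis t) < r" using x by auto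
    then have "\<bar>t - x\<bar> < 2*pi" using x by (simp add: abs_if)
    with t have "min \<bar>t - x\<bar> (2*pi - \<bar>t - x\<bar>) < 2 * r"
      by (intro le_less_trans[OF dist_cis_lower]) auto
    then show "t \<in> I x \<union> I (x + 2*pi) \<union> I (x - 2*pi)"
      using t x by (auto simp: I_def min_def abs_if split: if_splits)
  qed
  then have "emeasure lborel ({0..<2*pi} \<inter> cis -` ball \<xi> r) \<le> emeasure lborel (I x \<union> I (x + 2*pi) \<union> I (x - 2*pi))"
    by (intro emeasure_mono) (auto simp: I_def)
  also have "\<dots> \<le> emeasure lborel (I x) + emeasure lborel (I (x + 2*pi)) + emeasure lborel (I (x - 2*pi))"
    by (intro order.trans[OF emeasure_subadditive] add_mono order.refl) (auto simp: I_def)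
  also have "\<dots> = ennreal (12 * r)"
    using r by (simp add: I_def flip: ennreal_plus)
  finally have "emeasure circle_measure (ball \<xi> r) \<le> ennreal (12 * r) / ennreal (2*pi)"
    by (subst emeasure_circle) (auto intro: divide_right_mono_ennreal)
  also have "\<dots> = ennreal (12 * r / (2*pi))" using r by (intro divide_ennreal) auto
  also have "\<dots> \<le> ennreal (2 * r)" using r pi_gt3 by (intro ennreal_leI) (simp add: field_simps)
  finally show ?thesis .
qed

text \<open>
  The weak type inequality for the Hardy--Littlewood maximal function, with the discs taken in the
  plane. The exceptional set is an explicit Borel superset of the set where the maximal
  function exceeds \<open>\<eta>\<close>, which avoids any discussion of the measurability of the maximal function.
\<close>

lemma maximal_inequality_circle:
  fixes g :: "complex \<Rightarrow> ennreal"
  assumes [measurable]: "g \<in> borel_measurable borel" and \<eta>: "\<eta> > 0"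
  obtains U where "U \<in> sets borel"
    "emeasure circle_measure U \<le> ennreal (10 / \<eta>) * (\<integral>\<^sup>+ \<xi>. g \<xi> \<partial>circle_measure)"
    "\<And>\<xi> r. \<xi> \<notin> U \<Longrightarrow> cmod \<xi> = 1 \<Longrightarrow> r > 0 \<Longrightarrow>
       (\<integral>\<^sup>+ \<zeta>. g \<zeta> * indicator (ball \<xi> r) \<zeta> \<partial>circle_measure) \<le> ennreal (\<eta> * r)"
proof (cases "(\<integral>\<^sup>+ \<xi>. g \<xi> \<partial>circle_measure) = \<infinity>")
  case True
  show ?thesis
    by (rule that[of UNIV]) (use True \<eta> in \<open>auto simp: ennreal_mult_eq_top_iff ennreal_mult_top\<close>)
next
  case False
  define \<nu> where "\<nu> = density circle_measure g"
  have \<nu>: "emeasure \<nu> A = (\<integral>\<^sup>+ \<zeta>. g \<zeta> * indicator A \<zeta> \<partial>circle_measure)" if "A \<in> sets borel" for A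
    using that by (simp add: \<nu>_def emeasure_density)
  have s\<nu> [simp]: "sets \<nu> = sets borel" by (simp add: \<nu>_def)
  define T where "T = (\<integral>\<^sup>+ \<xi>. g \<xi> \<partial>circle_measure)"
  have T: "T = ennreal (enn2real T)" using False by (simp add: T_def less_top)
  have \<nu>T: "emeasure \<nu> A \<le> T" for A
    using emeasure_space[of \<nu> A] \<nu>[of UNIV] by (simp add: T_def \<nu>_def)
  define S where "S = {\<xi>. cmod \<xi> = 1 \<and> (\<exists>r>0. emeasure \<nu> (ball \<xi> r) > ennreal (\<eta> * r))}"
  have "\<forall>\<xi>\<in>S. \<exists>r. r > 0 \<and> emeasure \<nu> (ball \<xi> r) > ennreal (\<eta> * r)" by (auto simp: S_def)
  then obtain r where r: "\<And>\<xi>. \<xi> \<in> S \<Longrightarrow> r \<xi> > 0 \<and> emeasure \<nu> (ball \<xi> (r \<xi>)) > ennreal (\<eta> * r \<xi>)"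
    by metis
  \<comment> \<open>the covering lemma needs bounded radii; finiteness of the total integral provides the bound\<close>
  have rB: "r \<xi> \<le> enn2real T / \<eta>" if "\<xi> \<in> S" for \<xi>
  proof -
    have "ennreal (\<eta> * r \<xi>) \<le> ennreal (enn2real T)"
      using r[OF that] \<nu>T[of "ball \<xi> (r \<xi>)"] T by auto
    then show ?thesis using \<eta> by (simp add: field_simps)
  qed
  \<comment> \<open>the constant \<open>10\<close> is the enlargement factor \<open>5\<close> of the covering lemma times the growth constant \<open>2\<close>\<close>
  obtain C where C: "countable C" "C \<subseteq> S"
     "pairwise (\<lambda>i j. disjnt (ball i (r i)) (ball j (r j))) C"
     "S \<subseteq> (\<Union>i\<in>C. ball i (5 * r i))"
    by (rule Vitali_covering_lemma_balls[where S=S and K=S and a="\<lambda>x. x" and r=r and B="enn2real T / \<eta>"])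
       (use r rB in \<open>auto intro!: centre_in_ball[THEN iffD2]\<close>)
  define U where "U = (\<Union>i\<in>C. ball i (5 * r i))"
  have "emeasure circle_measure U \<le> (\<integral>\<^sup>+ i. emeasure circle_measure (ball i (5 * r i)) \<partial>count_space C)"
  proof -
    have "emeasure circle_measure U = (\<integral>\<^sup>+ x. indicator U x \<partial>circle_measure)"
      unfolding U_def by (subst nn_integral_indicator) (auto intro!: borel_open)
    also have "\<dots> \<le> (\<integral>\<^sup>+ x. \<integral>\<^sup>+ i. indicator (ball i (5 * r i)) x \<partial>count_space C \<partial>circle_measure)"
    proof (rule nn_integral_mono)
      fix x
      show "indicator U x \<le> (\<integral>\<^sup>+ i. indicator (ball i (5 * r i)) x \<partial>count_space C :: ennreal)"
      proof (cases "x \<in> U")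
        case True
        then obtain i where "i \<in> C" "x \<in> ball i (5 * r i)" by (auto simp: U_def)
        then show ?thesis
          using nn_integral_ge_point[of i C "\<lambda>i. indicator (ball i (5 * r i)) x"] True by auto
      qed simp
    qed
    also have "\<dots> = (\<integral>\<^sup>+ i. emeasure circle_measure (ball i (5 * r i)) \<partial>count_space C)"
      using C by (subst nn_integral_count_space_nn_integral)
        (auto intro!: borel_measurable_indicator)
    finally show ?thesis .
  qed
  also have "\<dots> \<le> (\<integral>\<^sup>+ i. ennreal (10 / \<eta>) * emeasure \<nu> (ball i (r i)) \<partial>count_space C)"
  proof (rule nn_integral_mono)
    fix i assume "i \<in> space (count_space C)"
    then have i: "i \<in> S" using C by auto
    then have "emeasure circle_measure (ball i (5 * r i)) \<le> ennreal (2 * (5 * r i))"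
      using r by (intro emeasure_circle_ball) (auto simp: S_def)
    also have "\<dots> = ennreal (10 / \<eta>) * ennreal (\<eta> * r i)"
      using \<eta> by (simp add: ennreal_mult[symmetric] r[OF i] less_imp_le)
    also have "\<dots> \<le> ennreal (10 / \<eta>) * emeasure \<nu> (ball i (r i))"
      using r[OF i] by (intro mult_left_mono) auto
    finally show "emeasure circle_measure (ball i (5 * r i)) \<le> ennreal (10 / \<eta>) * emeasure \<nu> (ball i (r i))" .
  qed
  also have "\<dots> = ennreal (10 / \<eta>) * (\<integral>\<^sup>+ i. emeasure \<nu> (ball i (r i)) \<partial>count_space C)"
    by (rule nn_integral_cmult) auto
  also have "(\<integral>\<^sup>+ i. emeasure \<nu> (ball i (r i)) \<partial>count_space C) = emeasure \<nu> (\<Union>i\<in>C. ball i (r i))"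
    by (rule emeasure_UN_countable[symmetric])
       (use C in \<open>auto simp: disjoint_family_on_def pairwise_def disjnt_def\<close>)
  also have "ennreal (10 / \<eta>) * \<dots> \<le> ennreal (10 / \<eta>) * T"
    by (intro mult_left_mono \<nu>T) auto
  finally have m: "emeasure circle_measure U \<le> ennreal (10 / \<eta>) * T" .
  show ?thesis
  proof (rule that[of U])
    show "U \<in> sets borel" unfolding U_def by (intro borel_open) auto
    fix \<xi> \<rho> assume "\<xi> \<notin> U" "cmod \<xi> = 1" "(\<rho>::real) > 0"
    then have "\<xi> \<notin> S" using C by (auto simp: U_def)
    then have "emeasure \<nu> (ball \<xi> \<rho>) \<le> ennreal (\<eta> * \<rho>)"
      using \<open>cmod \<xi> = 1\<close> \<open>\<rho> > 0\<close> by (auto simp: S_def not_less dest!: spec[of _ \<rho>])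
    then show "(\<integral>\<^sup>+ \<zeta>. g \<zeta> * indicator (ball \<xi> \<rho>) \<zeta> \<partial>circle_measure) \<le> ennreal (\<eta> * \<rho>)"
      by (simp add: \<nu>)
  qed (use m in \<open>simp add: T_def\<close>)
qed

text \<open>
  In a Stolz region with vertex \<open>\<xi>\<close> the Poisson kernel at \<open>\<zeta>\<close> is of size at most
  \<open>\<delta> / (max \<delta> \<bar>\<zeta> - \<xi>\<bar>)\<^sup>2\<close> with \<open>\<delta> = 1 - \<bar>z\<bar>\<close>, up to a factor depending on \<open>\<alpha>\<close>. The smallest dyadic disc around \<open>\<xi>\<close> that contains \<open>\<zeta>\<close>
  contributes a term that already dominates this.
\<close>

lemma poisson_kernel_dyadic:
  assumes \<xi>: "cmod \<xi> = 1" and \<zeta>: "cmod \<zeta> = 1" and z: "z \<in> stolz_region \<alpha> \<xi>" and \<alpha>: "\<alpha> > 1"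
  defines "\<delta> \<equiv> 1 - cmod z"
  shows "ennreal (poisson_kernel z \<zeta>) \<le>
    (\<Sum>j. ennreal (8 * (1 + \<alpha>)\<^sup>2 / (4 ^ j * \<delta>)) * indicator (ball \<xi> (2 ^ j * \<delta>)) \<zeta>)"
proof -
  have \<delta>: "0 < \<delta>" "\<delta> \<le> 1" and d: "dist z \<xi> < \<alpha> * \<delta>"
    using z by (auto simp: stolz_region_def \<delta>_def)
  define D where "D = cmod (\<zeta> - z)"
  have D\<delta>: "\<delta> \<le> D" using norm_triangle_ineq2[of \<zeta> z] \<zeta> by (simp add: D_def \<delta>_def)
  have "dist \<xi> \<zeta> \<le> dist z \<xi> + D" unfolding D_def
    using dist_triangle[of \<xi> \<zeta> z] by (simp add: dist_norm norm_minus_commute)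
  also have "\<dots> \<le> \<alpha> * D + D" using d mult_left_mono[OF D\<delta>, of \<alpha>] \<alpha> by linarith
  finally have s: "dist \<xi> \<zeta> \<le> (1 + \<alpha>) * D" by (simp add: algebra_simps)
  have "1 - (cmod z)\<^sup>2 = \<delta> * (1 + cmod z)" by (simp add: \<delta>_def power2_eq_square algebra_simps)
  also have "\<dots> \<le> \<delta> * 2" using \<delta> by (intro mult_left_mono) (auto simp: \<delta>_def)
  finally have P: "poisson_kernel z \<zeta> \<le> 2 * \<delta> / D\<^sup>2"
    by (auto simp: poisson_kernel_def D_def intro!: divide_right_mono)
  have ex: "\<exists>j. dist \<xi> \<zeta> < 2 ^ j * \<delta>"
    using real_arch_pow[of 2 "dist \<xi> \<zeta> / \<delta>"] \<delta> by (auto simp: field_simps)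
  define j where "j = (LEAST j. dist \<xi> \<zeta> < 2 ^ j * \<delta>)"
  have j: "dist \<xi> \<zeta> < 2 ^ j * \<delta>" unfolding j_def by (rule LeastI_ex[OF ex])
  have "2 * \<delta> / D\<^sup>2 \<le> 8 * (1 + \<alpha>)\<^sup>2 / (4 ^ j * \<delta>)"
  proof -
    have "2 ^ j * \<delta> \<le> 2 * ((1 + \<alpha>) * D)"
    proof (cases j)
      case 0
      have "1 * D \<le> (1 + \<alpha>) * D" using \<alpha> D\<delta> \<delta> by (intro mult_right_mono) auto
      then have "\<delta> \<le> 2 * ((1 + \<alpha>) * D)" using D\<delta> \<delta> by linarith
      then show ?thesis using 0 by (simp only: power_0 mult_1_left)
    next
      case (Suc i)
      have "\<not> dist \<xi> \<zeta> < 2 ^ i * \<delta>" using not_less_Least[of i "\<lambda>j. dist \<xi> \<zeta> < 2 ^ j * \<delta>"] Suc unfolding j_def by auto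
      then show ?thesis using s Suc by simp
    qed
    then have "(2 ^ j * \<delta>)\<^sup>2 \<le> (2 * ((1 + \<alpha>) * D))\<^sup>2"
      using \<delta> by (intro power_mono) auto
    moreover have "(2 ^ j * \<delta>)\<^sup>2 = 4 ^ j * \<delta>\<^sup>2"
    proof -
      have "(2::real) ^ j * 2 ^ j = 4 ^ j" unfolding power_mult_distrib[symmetric] by simp
      moreover have "(2 ^ j * \<delta>)\<^sup>2 = (2 ^ j * 2 ^ j) * \<delta>\<^sup>2"
        by (simp only: power2_eq_square ac_simps)
      ultimately show ?thesis by simp
    qed
    moreover have "(2 * ((1 + \<alpha>) * D))\<^sup>2 = 4 * (1 + \<alpha>)\<^sup>2 * D\<^sup>2" by (simp add: power_mult_distrib)
    ultimately have "4 ^ j * \<delta>\<^sup>2 \<le> 4 * (1 + \<alpha>)\<^sup>2 * D\<^sup>2" by simp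
    moreover have "0 < D" using D\<delta> \<delta> by simp
    ultimately show ?thesis using \<delta> by (simp add: field_simps power2_eq_square)
  qed
  with P have "ennreal (poisson_kernel z \<zeta>) \<le> ennreal (8 * (1 + \<alpha>)\<^sup>2 / (4 ^ j * \<delta>)) * indicator (ball \<xi> (2 ^ j * \<delta>)) \<zeta>"
    using j by (auto intro!: ennreal_leI)
  also have "\<dots> \<le> (\<Sum>j. ennreal (8 * (1 + \<alpha>)\<^sup>2 / (4 ^ j * \<delta>)) * indicator (ball \<xi> (2 ^ j * \<delta>)) \<zeta>)"
  proof -
    have "F j \<le> (\<Sum>j. F j)" for F :: "nat \<Rightarrow> ennreal"
      using sum_le_suminf[of F "{j}"] by simp
    then show ?thesis .
  qed
  finally show ?thesis .
qed

text \<open>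
  Integrating the dyadic majorant, the disc of radius \<open>2\<^sup>j \<delta>\<close> contributes a multiple of \<open>2\<^bsup>-j\<^esup> \<eta>\<close>.
\<close>

lemma poisson_integral_le_maximal:
  assumes [measurable]: "g \<in> borel_measurable borel"
    and \<xi>: "cmod \<xi> = 1" and z: "z \<in> stolz_region \<alpha> \<xi>" and \<alpha>: "\<alpha> > 1" and \<eta>: "\<eta> > 0"
    and max: "\<And>r. r > 0 \<Longrightarrow> (\<integral>\<^sup>+ \<zeta>. g \<zeta> * indicator (ball \<xi> r) \<zeta> \<partial>circle_measure) \<le> ennreal (\<eta> * r)"
  shows "(\<integral>\<^sup>+ \<zeta>. ennreal (poisson_kernel z \<zeta>) * g \<zeta> \<partial>circle_measure) \<le> ennreal (16 * (1 + \<alpha>)\<^sup>2 * \<eta>)"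
proof -
  define \<delta> where "\<delta> = 1 - cmod z"
  define c where "c = (\<lambda>j. 8 * (1 + \<alpha>)\<^sup>2 / (4 ^ j * \<delta>))"
  have \<delta>: "0 < \<delta>" using z by (auto simp: stolz_region_def \<delta>_def)
  have c0: "c j \<ge> 0" for j using \<delta> by (simp add: c_def)
  have [measurable]: "(\<lambda>\<zeta>. indicator (ball \<xi> r) \<zeta> :: ennreal) \<in> borel_measurable borel" for r
    by (intro borel_measurable_indicator borel_open) auto
  have "(\<integral>\<^sup>+ \<zeta>. ennreal (poisson_kernel z \<zeta>) * g \<zeta> \<partial>circle_measure)
     \<le> (\<integral>\<^sup>+ \<zeta>. (\<Sum>j. ennreal (c j) * indicator (ball \<xi> (2 ^ j * \<delta>)) \<zeta>) * g \<zeta> \<partial>circle_measure)"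
  proof (rule nn_integral_mono_AE)
    show "AE \<zeta> in circle_measure. ennreal (poisson_kernel z \<zeta>) * g \<zeta> \<le>
        (\<Sum>j. ennreal (c j) * indicator (ball \<xi> (2 ^ j * \<delta>)) \<zeta>) * g \<zeta>"
      using AE_circle_norm
      by eventually_elim
         (unfold c_def \<delta>_def, intro mult_right_mono poisson_kernel_dyadic \<xi> z \<alpha>, auto)
  qed
  also have "\<dots> = (\<integral>\<^sup>+ \<zeta>. (\<Sum>j. ennreal (c j) * (g \<zeta> * indicator (ball \<xi> (2 ^ j * \<delta>)) \<zeta>)) \<partial>circle_measure)"
    by (subst ennreal_suminf_multc[symmetric]) (simp add: mult_ac)
  also have "\<dots> = (\<Sum>j. \<integral>\<^sup>+ \<zeta>. ennreal (c j) * (g \<zeta> * indicator (ball \<xi> (2 ^ j * \<delta>)) \<zeta>) \<partial>circle_measure)"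
    by (rule nn_integral_suminf) measurable
  also have "\<dots> = (\<Sum>j. ennreal (c j) * (\<integral>\<^sup>+ \<zeta>. g \<zeta> * indicator (ball \<xi> (2 ^ j * \<delta>)) \<zeta> \<partial>circle_measure))"
    by (subst nn_integral_cmult) auto
  also have "\<dots> \<le> (\<Sum>j. ennreal (c j) * ennreal (\<eta> * (2 ^ j * \<delta>)))"
    by (intro suminf_le mult_left_mono max) (use \<delta> in auto)
  also have "\<dots> = (\<Sum>j. ennreal (8 * (1 + \<alpha>)\<^sup>2 * \<eta> * (1 / 2) ^ j))"
  proof -
    have "c j * (\<eta> * (2 ^ j * \<delta>)) = 8 * (1 + \<alpha>)\<^sup>2 * \<eta> * (1 / 2) ^ j" for j
    proof -
      have "(4::real) ^ j = 2 ^ j * 2 ^ j" by (simp add: power_mult_distrib[symmetric])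
      then show ?thesis using \<delta> by (simp add: c_def field_simps)
    qed
    moreover have "ennreal (c j) * ennreal (\<eta> * (2 ^ j * \<delta>)) = ennreal (8 * (1 + \<alpha>)\<^sup>2 * \<eta> * (1 / 2) ^ j)"
      if "c j * (\<eta> * (2 ^ j * \<delta>)) = 8 * (1 + \<alpha>)\<^sup>2 * \<eta> * (1 / 2) ^ j" for j
      unfolding that[symmetric] using \<eta> \<delta> c0[of j] by (intro ennreal_mult[symmetric]) auto
    ultimately show ?thesis by presburger
  qed
  also have "\<dots> = ennreal (\<Sum>j. 8 * (1 + \<alpha>)\<^sup>2 * \<eta> * (1 / 2) ^ j)"
    using \<eta> by (intro suminf_ennreal2 summable_mult summable_geometric) auto
  also have "(\<Sum>j. 8 * (1 + \<alpha>)\<^sup>2 * \<eta> * (1 / 2) ^ j) = 16 * (1 + \<alpha>)\<^sup>2 * \<eta>"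
    by (subst suminf_mult) (auto simp: suminf_geometric summable_geometric)
  finally show ?thesis .
qed

lemma poisson_kernel_bounds:
  assumes z1: "cmod z < 1" and "cmod \<zeta> = 1"
  shows "0 \<le> poisson_kernel z \<zeta> \<and> poisson_kernel z \<zeta> \<le> 1 / (1 - cmod z)\<^sup>2"
proof -
  have "1 - cmod z \<le> cmod (\<zeta> - z)" using norm_triangle_ineq2[of \<zeta> z] assms by simp
  then have "(1 - cmod z)\<^sup>2 \<le> (cmod (\<zeta> - z))\<^sup>2" using z1 by (intro power_mono) auto
  moreover have "0 \<le> 1 - (cmod z)\<^sup>2" using z1 by (simp add: power_le_one)
  ultimately show ?thesis unfolding poisson_kernel_def using z1
    by (auto intro!: frac_le)
qed

lemma integrable_poisson_kernel_mult:
  fixes g :: "complex \<Rightarrow> complex"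
  assumes z1: "cmod z < 1" and g: "integrable circle_measure g"
  shows "integrable circle_measure (\<lambda>\<zeta>. of_real (poisson_kernel z \<zeta>) * g \<zeta>)"
proof (rule Bochner_Integration.integrable_bound)
  show "integrable circle_measure (\<lambda>\<zeta>. of_real (1 / (1 - cmod z)\<^sup>2) * g \<zeta>)" using g by simp
  have [measurable]: "g \<in> borel_measurable borel"
    using borel_measurable_integrable[OF g] by simp
  show "(\<lambda>\<zeta>. of_real (poisson_kernel z \<zeta>) * g \<zeta>) \<in> borel_measurable circle_measure" by simp
  show "AE \<zeta> in circle_measure. cmod (of_real (poisson_kernel z \<zeta>) * g \<zeta>) \<le> cmod (of_real (1 / (1 - cmod z)\<^sup>2) * g \<zeta>)"
    using AE_circle_norm
  proof eventually_elim
    fix \<zeta> :: complex assume "cmod \<zeta> = 1"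
    then have "\<bar>poisson_kernel z \<zeta>\<bar> \<le> \<bar>1 / (1 - cmod z)\<^sup>2\<bar>" using poisson_kernel_bounds[OF z1, of \<zeta>] by simp
    then show "cmod (of_real (poisson_kernel z \<zeta>) * g \<zeta>) \<le> cmod (of_real (1 / (1 - cmod z)\<^sup>2) * g \<zeta>)"
      unfolding norm_mult norm_of_real by (rule mult_right_mono) simp
  qed
qed

lemma poisson_formula_diff:
  assumes f[measurable]: "f \<in> borel_measurable borel" "continuous_on (cball 0 1) f" "f holomorphic_on ball 0 1"
    and G: "integrable circle_measure G" and z: "cmod z < 1"
  shows "f z - (LINT \<zeta>|circle_measure. of_real (poisson_kernel z \<zeta>) * G \<zeta>) =
     (LINT \<zeta>|circle_measure. of_real (poisson_kernel z \<zeta>) * (f \<zeta> - G \<zeta>))"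
proof -
  note Pi = integrable_poisson_kernel_mult[OF z]
  have fi: "integrable circle_measure f"
    by (rule integrable_circle_continuous) (auto intro: continuous_on_subset[OF f(2)])
  have "f z - (LINT \<zeta>|circle_measure. of_real (poisson_kernel z \<zeta>) * G \<zeta>)
      = (LINT \<zeta>|circle_measure. of_real (poisson_kernel z \<zeta>) * f \<zeta>) - (LINT \<zeta>|circle_measure. of_real (poisson_kernel z \<zeta>) * G \<zeta>)"
    by (subst poisson_formula[OF f z]) simp
  also have "\<dots> = (LINT \<zeta>|circle_measure. of_real (poisson_kernel z \<zeta>) * (f \<zeta> - G \<zeta>))"
    by (simp add: right_diff_distrib Bochner_Integration.integral_diff[OF Pi[OF fi] Pi[OF G]])
  finally show ?thesis .
qed

lemma poisson_integral_diff_le: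
  assumes f[measurable]: "f \<in> borel_measurable borel" "continuous_on (cball 0 1) f" "f holomorphic_on ball 0 1"
    and G: "integrable circle_measure G" and \<xi>: "cmod \<xi> = 1" and z: "z \<in> stolz_region \<alpha> \<xi>" and \<alpha>: "\<alpha> > 1" and \<eta>: "\<eta> > 0"
    and max: "\<And>r. r > 0 \<Longrightarrow>
      (\<integral>\<^sup>+ \<zeta>. ennreal (cmod (f \<zeta> - G \<zeta>)) * indicator (ball \<xi> r) \<zeta> \<partial>circle_measure) \<le> ennreal (\<eta> * r)"
  shows "cmod (f z - (LINT \<zeta>|circle_measure. of_real (poisson_kernel z \<zeta>) * G \<zeta>)) \<le> 16 * (1 + \<alpha>)\<^sup>2 * \<eta>"
proof -
  have [measurable]: "G \<in> borel_measurable borel"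
    using borel_measurable_integrable[OF G] by simp
  have z1: "cmod z < 1" using z by (auto simp: stolz_region_def)
  note Pb = poisson_kernel_bounds[OF z1] and Pi = integrable_poisson_kernel_mult[OF z1]
  have fi: "integrable circle_measure f"
    by (rule integrable_circle_continuous) (auto intro: continuous_on_subset[OF f(2)])
  note e = poisson_formula_diff[OF f G z1]
  have "ennreal (cmod (LINT \<zeta>|circle_measure. of_real (poisson_kernel z \<zeta>) * (f \<zeta> - G \<zeta>)))
     \<le> (\<integral>\<^sup>+ \<zeta>. ennreal (cmod (of_real (poisson_kernel z \<zeta>) * (f \<zeta> - G \<zeta>))) \<partial>circle_measure)"
    by (rule integral_norm_bound_ennreal[OF Pi[OF Bochner_Integration.integrable_diff[OF fi G]]])
  also have "\<dots> = (\<integral>\<^sup>+ \<zeta>. ennreal (poisson_kernel z \<zeta>) * ennreal (cmod (f \<zeta> - G \<zeta>)) \<partial>circle_measure)"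
    by (rule nn_integral_cong_AE)
       (use AE_circle_norm in eventually_elim, use Pb in \<open>auto simp: norm_mult ennreal_mult\<close>)
  also have "\<dots> \<le> ennreal (16 * (1 + \<alpha>)\<^sup>2 * \<eta>)"
    by (rule poisson_integral_le_maximal[OF _ \<xi> z \<alpha> \<eta> max]) auto
  finally show ?thesis using \<eta> by (simp add: e)
qed

lemma geom_tendsto_0: "(\<lambda>k. 10 * (1/2)^k :: real) \<longlonglongrightarrow> 0"
  by (rule tendsto_mult_right_zero, rule LIMSEQ_realpow_zero) auto

text \<open>
  A point lying in all but finitely many \<open>U\<^sub>k\<close> lies in a tail intersection, which is null because the
  measures of the \<open>U\<^sub>k\<close> tend to \<open>0\<close>.
\<close>

lemma AE_avoid_infinitely_often:
  assumes [measurable]: "\<And>k. U k \<in> sets M" and le: "\<And>k. emeasure M (U k) \<le> ennreal (c k)"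
    and c: "c \<longlonglongrightarrow> 0"
  shows "AE x in M. \<forall>K::nat. \<exists>k\<ge>K. x \<notin> U k"
  unfolding AE_all_countable
proof
  fix K :: nat
  define V where "V = (\<Inter>k\<in>{K..}. U k)"
  have V: "V \<in> sets M" unfolding V_def by (rule sets.countable_INT') auto
  have "emeasure M V \<le> ennreal (c k)" if "k \<ge> K" for k
  proof -
    have "V \<subseteq> U k" unfolding V_def using that by (intro INF_lower) simp
    then show ?thesis using emeasure_mono[of V "U k" M] le[of k] by (meson assms(1) order_trans)
  qed
  moreover have "(\<lambda>k. ennreal (c k)) \<longlonglongrightarrow> ennreal 0" by (rule tendsto_ennrealI[OF c])
  ultimately have "emeasure M V \<le> ennreal 0" by (intro LIMSEQ_le_const) blast+
  then have "V \<in> null_sets M" using V by (auto simp: null_sets_def)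
  then show "AE x in M. \<exists>k\<ge>K. x \<notin> U k"
    by (rule AE_I') (auto simp: V_def)
qed

text \<open>
  Along a subsequence the maximal function of \<open>f\<^sub>n - G\<close> is small off sets of small measure. At a
  point that avoids infinitely many of these sets, the Poisson integral of \<open>G\<close> is uniformly close,
  on the Stolz region, to some \<open>f\<^sub>n\<close> that is continuous up to the boundary and close to \<open>G\<close> at the
  vertex.
\<close>

theorem nontangential_limit_of_L1_limit:
  assumes f[measurable]: "\<And>n. f n \<in> borel_measurable borel"
    and fc: "\<And>n. continuous_on (cball 0 1) (f n)" and fh: "\<And>n. f n holomorphic_on ball 0 1"
    and G: "integrable circle_measure G"
    and ae: "AE \<xi> in circle_measure. (\<lambda>n. f n \<xi>) \<longlonglongrightarrow> G \<xi>"
    and L1: "(\<lambda>n. LINT \<xi>|circle_measure. cmod (f n \<xi> - G \<xi>)) \<longlonglongrightarrow> 0"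
    and H: "\<And>z. cmod z < 1 \<Longrightarrow> H z = (LINT \<zeta>|circle_measure. of_real (poisson_kernel z \<zeta>) * G \<zeta>)"
  shows "AE \<xi> in circle_measure. has_nontangential_limit H \<xi> (G \<xi>)"
proof -
  have [measurable]: "G \<in> borel_measurable borel"
    using borel_measurable_integrable[OF G] by simp
  \<comment> \<open>error \<open>4\<^bsup>-k\<^esup>\<close> at level \<open>2\<^bsup>-k\<^esup>\<close> leaves an exceptional set of measure of order \<open>2\<^bsup>-k\<^esup>\<close>\<close>
  have "\<exists>n\<ge>k. (LINT \<xi>|circle_measure. cmod (f n \<xi> - G \<xi>)) < (1/4) ^ k" for k
  proof -
    have "\<forall>\<^sub>F n in sequentially. (LINT \<xi>|circle_measure. cmod (f n \<xi> - G \<xi>)) < (1/4) ^ k \<and> n \<ge> k"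
      by (intro eventually_conj order_tendstoD(2)[OF L1] eventually_ge_at_top) simp
    then show ?thesis using eventually_happens'[of sequentially] by (auto simp: conj_commute)
  qed
  then obtain N where N: "\<And>k. N k \<ge> k" "\<And>k. (LINT \<xi>|circle_measure. cmod (f (N k) \<xi> - G \<xi>)) < (1/4) ^ k"
    by metis
  have "\<exists>U. U \<in> sets borel \<and> emeasure circle_measure U \<le> ennreal (10 * (1/2)^k) \<and>
     (\<forall>\<xi> r. \<xi> \<notin> U \<longrightarrow> cmod \<xi> = 1 \<longrightarrow> r > 0 \<longrightarrow>
       (\<integral>\<^sup>+ \<zeta>. ennreal (cmod (f (N k) \<zeta> - G \<zeta>)) * indicator (ball \<xi> r) \<zeta> \<partial>circle_measure) \<le> ennreal ((1/2)^k * r))" for k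
  proof -
    have fi: "integrable circle_measure (f (N k))"
      by (rule integrable_circle_continuous) (auto intro: continuous_on_subset[OF fc])
    have "(\<integral>\<^sup>+ \<zeta>. ennreal (cmod (f (N k) \<zeta> - G \<zeta>)) \<partial>circle_measure) = ennreal (LINT \<xi>|circle_measure. cmod (f (N k) \<xi> - G \<xi>))"
      by (rule nn_integral_eq_integral) (use fi G in auto)
    also have "\<dots> \<le> ennreal ((1/4) ^ k)" using N(2)[of k] by (intro ennreal_leI) simp
    finally have b: "(\<integral>\<^sup>+ \<zeta>. ennreal (cmod (f (N k) \<zeta> - G \<zeta>)) \<partial>circle_measure) \<le> ennreal ((1/4) ^ k)" .
    have e: "ennreal (10 / (1/2)^k) * ennreal ((1/4) ^ k) = ennreal (10 * (1/2)^k)"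
    proof -
      have q: "(1/4::real) ^ k = (1/2) ^ k * (1/2) ^ k"
        unfolding power_mult_distrib[symmetric] by simp
      have "10 / (1/2)^k * (1/4)^k = (10 * (1/2)^k :: real)" unfolding q by simp
      then show ?thesis by (subst ennreal_mult[symmetric]) auto
    qed
    have pm: "(\<lambda>\<zeta>. ennreal (cmod (f (N k) \<zeta> - G \<zeta>))) \<in> borel_measurable borel" by measurable
    obtain U where U: "U \<in> sets borel"
      "emeasure circle_measure U \<le> ennreal (10 / (1/2)^k) * (\<integral>\<^sup>+ \<zeta>. ennreal (cmod (f (N k) \<zeta> - G \<zeta>)) \<partial>circle_measure)"
      "\<And>\<xi> r. \<xi> \<notin> U \<Longrightarrow> cmod \<xi> = 1 \<Longrightarrow> r > 0 \<Longrightarrow>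
       (\<integral>\<^sup>+ \<zeta>. ennreal (cmod (f (N k) \<zeta> - G \<zeta>)) * indicator (ball \<xi> r) \<zeta> \<partial>circle_measure) \<le> ennreal ((1/2)^k * r)"
      using maximal_inequality_circle[OF pm, of "(1/2)^k"] by auto
    have "emeasure circle_measure U \<le> ennreal (10 * (1/2)^k)"
      using order.trans[OF U(2) mult_left_mono[OF b]] e by simp
    then show ?thesis using U by blast
  qed
  then have "\<forall>k. \<exists>U. U \<in> sets borel \<and> emeasure circle_measure U \<le> ennreal (10 * (1/2)^k) \<and>
     (\<forall>\<xi> r. \<xi> \<notin> U \<longrightarrow> cmod \<xi> = 1 \<longrightarrow> r > 0 \<longrightarrow>
       (\<integral>\<^sup>+ \<zeta>. ennreal (cmod (f (N k) \<zeta> - G \<zeta>)) * indicator (ball \<xi> r) \<zeta> \<partial>circle_measure) \<le> ennreal ((1/2)^k * r))"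
    by (rule allI)
  from choice[OF this] obtain U where "\<forall>k. U k \<in> sets borel \<and> emeasure circle_measure (U k) \<le> ennreal (10 * (1/2)^k) \<and>
     (\<forall>\<xi> r. \<xi> \<notin> U k \<longrightarrow> cmod \<xi> = 1 \<longrightarrow> r > 0 \<longrightarrow>
       (\<integral>\<^sup>+ \<zeta>. ennreal (cmod (f (N k) \<zeta> - G \<zeta>)) * indicator (ball \<xi> r) \<zeta> \<partial>circle_measure) \<le> ennreal ((1/2)^k * r))" ..
  then have U: "\<And>k. U k \<in> sets borel" "\<And>k. emeasure circle_measure (U k) \<le> ennreal (10 * (1/2)^k)"
     "\<And>k \<xi> r. \<xi> \<notin> U k \<Longrightarrow> cmod \<xi> = 1 \<Longrightarrow> r > 0 \<Longrightarrow>
       (\<integral>\<^sup>+ \<zeta>. ennreal (cmod (f (N k) \<zeta> - G \<zeta>)) * indicator (ball \<xi> r) \<zeta> \<partial>circle_measure) \<le> ennreal ((1/2)^k * r)"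
    by blast+
  have "AE \<xi> in circle_measure. \<forall>K. \<exists>k\<ge>K. \<xi> \<notin> U k"
    by (rule AE_avoid_infinitely_often[OF U(1)[folded sets_circle] U(2)])
       (rule geom_tendsto_0)
  with ae AE_circle_norm show ?thesis
  proof eventually_elim
    fix \<xi> assume lim: "(\<lambda>n. f n \<xi>) \<longlonglongrightarrow> G \<xi>" and \<xi>: "cmod \<xi> = 1" and good: "\<forall>K. \<exists>k\<ge>K. \<xi> \<notin> U k"
    show "has_nontangential_limit H \<xi> (G \<xi>)"
      unfolding has_nontangential_limit_def
    proof (intro allI impI)
      fix \<alpha> :: real assume \<alpha>: "\<alpha> > 1"
      show "(H \<longlongrightarrow> G \<xi>) (at \<xi> within stolz_region \<alpha> \<xi>)"
      proof (rule tendstoI)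
        fix e :: real assume e: "e > 0"
        have "\<forall>\<^sub>F n in sequentially. dist (f n \<xi>) (G \<xi>) < e / 3" using e lim by (intro tendstoD) auto
        then obtain K1 where K1: "\<And>n. n \<ge> K1 \<Longrightarrow> dist (f n \<xi>) (G \<xi>) < e / 3"
          by (auto simp: eventually_sequentially)
        have "(\<lambda>k. 16 * (1 + \<alpha>)\<^sup>2 * (1/2) ^ k) \<longlonglongrightarrow> 16 * (1 + \<alpha>)\<^sup>2 * 0"
          by (intro tendsto_mult tendsto_const LIMSEQ_realpow_zero) auto
        then have "\<forall>\<^sub>F k in sequentially. 16 * (1 + \<alpha>)\<^sup>2 * (1/2) ^ k < e / 3"
          using e by (intro order_tendstoD) auto
        then obtain K2 where K2: "\<And>n. n \<ge> K2 \<Longrightarrow> 16 * (1 + \<alpha>)\<^sup>2 * (1/2) ^ n < e / 3"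
          by (auto simp: eventually_sequentially)
        obtain k where k: "k \<ge> max K1 K2" "\<xi> \<notin> U k" using good by blast
        let ?f = "f (N k)"
        have a: "cmod (?f z - H z) \<le> 16 * (1 + \<alpha>)\<^sup>2 * (1/2)^k" if z: "z \<in> stolz_region \<alpha> \<xi>" for z
          using poisson_integral_diff_le[OF f fc fh G \<xi> z \<alpha>, of "(1/2)^k" "N k"] U(3)[OF k(2) \<xi>] H[of z] z
          by (auto simp: stolz_region_def)
        have "(?f \<longlongrightarrow> ?f \<xi>) (at \<xi> within cball 0 1)"
          using fc[of "N k"] \<xi> by (auto simp: continuous_on_def)
        then have "(?f \<longlongrightarrow> ?f \<xi>) (at \<xi> within stolz_region \<alpha> \<xi>)"
          by (rule tendsto_within_subset) (auto simp: stolz_region_def)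
        then have "\<forall>\<^sub>F z in at \<xi> within stolz_region \<alpha> \<xi>. dist (?f z) (?f \<xi>) < e / 3"
          using e by (intro tendstoD) auto
        moreover have "\<forall>\<^sub>F z in at \<xi> within stolz_region \<alpha> \<xi>. z \<in> stolz_region \<alpha> \<xi>"
          by (simp add: eventually_at_filter)
        ultimately show "\<forall>\<^sub>F z in at \<xi> within stolz_region \<alpha> \<xi>. dist (H z) (G \<xi>) < e"
        proof eventually_elim
          fix z assume 1: "dist (?f z) (?f \<xi>) < e / 3" and z: "z \<in> stolz_region \<alpha> \<xi>"
          have 2: "dist (H z) (?f z) < e / 3"
            using a[OF z] K2[of k] k by (auto simp: dist_norm norm_minus_commute)
          have 3: "dist (?f \<xi>) (G \<xi>) < e / 3" using K1[of "N k"] N(1)[of k] k by auto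
          show "dist (H z) (G \<xi>) < e"
            using 1 2 3 dist_triangle[of "H z" "G \<xi>" "?f z"] dist_triangle[of "?f z" "G \<xi>" "?f \<xi>"] by linarith
        qed
      qed
    qed
  qed
qed

section \<open>The Szego recursion\<close>

lemma rho_positive: "cmod (g n) < 1 \<Longrightarrow> rho g n > 0"
  by (simp add: rho_def power_less_one_iff abs_square_less_1)

lemma rho_squared: "cmod (g n) < 1 \<Longrightarrow> (rho g n)\<^sup>2 = 1 - (cmod (g n))\<^sup>2"
  by (simp add: rho_def power_le_one)

lemma rho_le_1: "rho g n \<le> 1"
  by (simp add: rho_def)

text \<open>
  The sequence \<open>\<Psi>\<close> stands for the reversed polynomials. It is kept as a second sequence, tied to \<open>\<Phi>\<close>
  only through the recursion, so that reversal of a polynomial, which depends on its degree, does not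
  enter.
\<close>

locale szego_recursion =
  fixes g :: "nat \<Rightarrow> complex" and \<Phi> \<Psi> :: "nat \<Rightarrow> complex poly"
  assumes disc: "\<And>n. cmod (g n) < 1"
    and \<Phi>_0: "\<Phi> 0 = 1" and \<Psi>_0: "\<Psi> 0 = 1"
    and \<Phi>_Suc: "\<And>n. \<Phi> (Suc n) = [:0, 1:] * \<Phi> n - smult (cnj (g n)) (\<Psi> n)"
    and \<Psi>_Suc: "\<And>n. \<Psi> (Suc n) = \<Psi> n - smult (g n) ([:0, 1:] * \<Phi> n)"
begin

lemma poly_\<Phi>_Suc: "poly (\<Phi> (Suc n)) z = z * poly (\<Phi> n) z - cnj (g n) * poly (\<Psi> n) z"
  by (simp add: \<Phi>_Suc)

lemma poly_\<Psi>_Suc: "poly (\<Psi> (Suc n)) z = poly (\<Psi> n) z - g n * (z * poly (\<Phi> n) z)"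
  by (simp add: \<Psi>_Suc)

lemma degree_bounds: "degree (\<Phi> n) = n \<and> lead_coeff (\<Phi> n) = 1 \<and> degree (\<Psi> n) \<le> n"
proof (induction n)
  case 0
  then show ?case by (simp add: \<Phi>_0 \<Psi>_0)
next
  case (Suc n)
  have nz: "\<Phi> n \<noteq> 0" using Suc by auto
  have d: "degree ([:0, 1:] * \<Phi> n) = Suc n" using Suc nz by (simp add: degree_mult_eq)
  have l: "lead_coeff ([:0, 1:] * \<Phi> n) = 1" 
  proof -
    have lc: "lead_coeff (\<Phi> n) = 1" using Suc by blast
    show ?thesis unfolding lead_coeff_mult lc by simp
  qed
  have s: "degree (- smult (cnj (g n)) (\<Psi> n)) < degree ([:0, 1:] * \<Phi> n)"
    using Suc d by (metis degree_minus degree_smult_le le_trans less_Suc_eq_le)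
  have "\<Phi> (Suc n) = - smult (cnj (g n)) (\<Psi> n) + [:0, 1:] * \<Phi> n" by (simp add: \<Phi>_Suc)
  then have "degree (\<Phi> (Suc n)) = Suc n" "lead_coeff (\<Phi> (Suc n)) = 1"
    using degree_add_eq_right[OF s] lead_coeff_add_le[OF s] d l by (simp_all only:)
  moreover have "degree (\<Psi> (Suc n)) \<le> Suc n"
    unfolding \<Psi>_Suc using Suc d by (intro degree_diff_le) (auto intro: order.trans[OF degree_smult_le])
  ultimately show ?case by simp
qed

lemma \<Psi>_circle: "cmod \<xi> = 1 \<Longrightarrow> poly (\<Psi> n) \<xi> = \<xi> ^ n * cnj (poly (\<Phi> n) \<xi>)"
proof (induction n)
  case 0
  then show ?case by (simp add: \<Phi>_0 \<Psi>_0)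
next
  case (Suc n)
  note x = unit_mult_cnj[OF Suc.prems]
  have "\<xi> ^ n * cnj \<xi> ^ n = 1" using x by (simp flip: power_mult_distrib)
  then have y: "poly (\<Phi> n) \<xi> = \<xi> ^ n * (cnj \<xi> ^ n * poly (\<Phi> n) \<xi>)" by (simp flip: mult.assoc)
  have "\<xi> ^ Suc n * cnj (poly (\<Phi> (Suc n)) \<xi>)
     = (\<xi> * cnj \<xi>) * (\<xi> ^ n * cnj (poly (\<Phi> n) \<xi>)) - g n * (\<xi> * (\<xi> ^ n * (cnj \<xi> ^ n * poly (\<Phi> n) \<xi>)))"
    using Suc by (simp add: poly_\<Phi>_Suc algebra_simps)
  also have "\<dots> = poly (\<Psi> (Suc n)) \<xi>"
    unfolding y[symmetric] x using Suc by (simp add: poly_\<Psi>_Suc)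
  finally show ?case ..
qed

lemma norm_\<Psi>_circle: "cmod \<xi> = 1 \<Longrightarrow> cmod (poly (\<Psi> n) \<xi>) = cmod (poly (\<Phi> n) \<xi>)"
  by (simp add: \<Psi>_circle norm_mult norm_power)

text \<open>
  With \<open>a = z \<Phi>\<^sub>n(z)\<close> and \<open>b = \<Psi>\<^sub>n(z)\<close> the step of the recursion is a hyperbolic rotation:
  \<open>\<bar>b - \<gamma> a\<bar>\<^sup>2 - \<bar>a - cnj \<gamma> b\<bar>\<^sup>2 = (1 - \<bar>\<gamma>\<bar>\<^sup>2) (\<bar>b\<bar>\<^sup>2 - \<bar>a\<bar>\<^sup>2)\<close>. This replaces the maximum principle in the
  proof that the reversed polynomials have no zeros in the closed disc.
\<close>

lemma \<Phi>_le_\<Psi>: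
  assumes "cmod z \<le> 1"
  shows "poly (\<Psi> n) z \<noteq> 0 \<and> cmod (z * poly (\<Phi> n) z) \<le> cmod (poly (\<Psi> n) z)"
proof (induction n)
  case 0
  then show ?case using assms by (simp add: \<Phi>_0 \<Psi>_0)
next
  case (Suc n)
  define a b where "a = z * poly (\<Phi> n) z" and "b = poly (\<Psi> n) z"
  have ab: "b \<noteq> 0" "cmod a \<le> cmod b" using Suc by (auto simp: a_def b_def)
  have "cmod (g n * a) < cmod b"
    using disc[of n] ab mult_strict_mono'[of "cmod (g n)" 1 "cmod a" "cmod b"]
    by (cases "cmod a < cmod b") (auto simp: norm_mult)
  then have nz: "b - g n * a \<noteq> 0" by auto
  have "(cmod (b - g n * a))\<^sup>2 - (cmod (a - cnj (g n) * b))\<^sup>2 = (1 - (cmod (g n))\<^sup>2) * ((cmod b)\<^sup>2 - (cmod a)\<^sup>2)"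
    unfolding cmod_power2 by (simp add: power2_eq_square algebra_simps)
  moreover have "0 \<le> (1 - (cmod (g n))\<^sup>2) * ((cmod b)\<^sup>2 - (cmod a)\<^sup>2)"
    using disc[of n] ab by (intro mult_nonneg_nonneg) (auto simp: power_le_one abs_le_square_iff[symmetric])
  ultimately have "(cmod (a - cnj (g n) * b))\<^sup>2 \<le> (cmod (b - g n * a))\<^sup>2" by linarith
  then have "cmod (a - cnj (g n) * b) \<le> cmod (b - g n * a)"
    by (rule power2_le_imp_le) simp
  then have "cmod z * cmod (a - cnj (g n) * b) \<le> 1 * cmod (b - g n * a)"
    using assms by (intro mult_mono) auto
  then show ?case using nz by (simp add: poly_\<Phi>_Suc poly_\<Psi>_Suc a_def b_def norm_mult)
qed

lemma \<Psi>_nonzero: "cmod z \<le> 1 \<Longrightarrow> poly (\<Psi> n) z \<noteq> 0"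
  using \<Phi>_le_\<Psi> by blast

lemmas rho_pos = rho_positive[of g, OF disc] and rho_sq = rho_squared[of g, OF disc]

text \<open>
  For the orthogonal polynomials of a probability measure this is the norm of \<open>\<Phi>\<^sub>n\<close> in \<open>L\<^sup>2\<close>.
\<close>

definition Phi_norm :: "nat \<Rightarrow> real" where "Phi_norm n = (\<Prod>k<n. rho g k)"

lemma Phi_norm_pos: "Phi_norm n > 0" unfolding Phi_norm_def by (intro prod_pos) (auto simp: rho_pos)

lemma Phi_norm_Suc: "Phi_norm (Suc n) = rho g n * Phi_norm n" by (simp add: Phi_norm_def mult.commute)

text \<open>
  The function \<open>1 / \<phi>\<^sub>n\<^sup>*\<close>.
\<close>

definition inv_phi :: "nat \<Rightarrow> complex \<Rightarrow> complex" where "inv_phi n z = of_real (Phi_norm n) / poly (\<Psi> n) z"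

text \<open>
  The quotient \<open>\<Psi>\<^sub>n\<^sub>+\<^sub>1 / \<Psi>\<^sub>n\<close>.
\<close>

definition step_factor :: "nat \<Rightarrow> complex \<Rightarrow> complex" where
  "step_factor n z = 1 - g n * (z * poly (\<Phi> n) z / poly (\<Psi> n) z)"

text \<open>
  Each factor \<open>\<Psi>\<^sub>k\<^sub>+\<^sub>1 / \<Psi>\<^sub>k\<close> has positive real part on the closed disc. Summing their
  principal logarithms gives a holomorphic logarithm of \<open>1 / \<phi>\<^sub>n\<^sup>*\<close> that is continuous on the closed disc
  and real at \<open>0\<close>.
\<close>

definition log_inv_phi :: "nat \<Rightarrow> complex \<Rightarrow> complex" where
  "log_inv_phi n z = of_real (ln (Phi_norm n)) - (\<Sum>k<n. Ln (step_factor k z))"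

lemma borel_measurable_poly_complex [measurable]: "(\<lambda>z. poly p z) \<in> borel_measurable (borel :: complex measure)"
  by (intro borel_measurable_continuous_onI continuous_intros)

lemma borel_measurable_inv_phi [measurable]: "inv_phi n \<in> borel_measurable borel"
  unfolding inv_phi_def by measurable

lemma borel_measurable_log_inv_phi [measurable]: "log_inv_phi n \<in> borel_measurable borel"
  unfolding log_inv_phi_def step_factor_def by measurable

lemma continuous_inv_phi: "continuous_on (cball 0 1) (inv_phi n)"
  unfolding inv_phi_def by (intro continuous_intros) (auto simp: \<Psi>_nonzero)

lemma holomorphic_inv_phi: "inv_phi n holomorphic_on ball 0 1"
  unfolding inv_phi_def by (intro holomorphic_intros) (auto simp: \<Psi>_nonzero)

lemma Re_step_factor: assumes "cmod z \<le> 1" shows "Re (step_factor n z) > 0"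
proof -
  define q where "q = z * poly (\<Phi> n) z / poly (\<Psi> n) z"
  have "cmod q \<le> 1" using \<Phi>_le_\<Psi>[OF assms, of n] by (simp add: q_def norm_divide)
  then have "cmod (g n * q) < 1"
    using disc[of n] mult_left_mono[of "cmod q" 1 "cmod (g n)"] by (simp add: norm_mult)
  then have "Re (g n * q) < 1" using complex_Re_le_cmod[of "g n * q"] by linarith
  then show ?thesis by (simp add: step_factor_def q_def)
qed

lemma step_factor_notin: "cmod z \<le> 1 \<Longrightarrow> step_factor n z \<notin> \<real>\<^sub>\<le>\<^sub>0"
  using Re_step_factor[of z n] by (auto simp: complex_nonpos_Reals_iff)

lemma continuous_log_inv_phi: "continuous_on (cball 0 1) (log_inv_phi n)"
proof -
  have "continuous_on (cball 0 1) (step_factor k)" for k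
    unfolding step_factor_def by (intro continuous_intros) (auto simp: \<Psi>_nonzero)
  then show ?thesis
    unfolding log_inv_phi_def by (intro continuous_intros) (auto simp: step_factor_notin)
qed

lemma holomorphic_log_inv_phi: "log_inv_phi n holomorphic_on ball 0 1"
proof -
  have "step_factor k holomorphic_on ball 0 1" for k
    unfolding step_factor_def by (intro holomorphic_intros) (auto simp: \<Psi>_nonzero)
  then show ?thesis
    unfolding log_inv_phi_def by (intro holomorphic_intros) (auto simp: step_factor_notin)
qed

lemma exp_log_inv_phi: assumes "cmod z \<le> 1" shows "exp (log_inv_phi n z) = inv_phi n z"
proof (induction n)
  case 0
  then show ?case by (simp add: log_inv_phi_def inv_phi_def Phi_norm_def \<Psi>_0)
next
  case (Suc n)
  have nz: "step_factor n z \<noteq> 0" using step_factor_notin[OF assms, of n] by auto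
  have "log_inv_phi (Suc n) z = log_inv_phi n z + of_real (ln (rho g n)) - Ln (step_factor n z)"
    using Phi_norm_pos[of n] rho_pos[of n] by (simp add: log_inv_phi_def Phi_norm_Suc ln_mult)
  then have "exp (log_inv_phi (Suc n) z) = inv_phi n z * of_real (rho g n) / step_factor n z"
    using Suc nz rho_pos[of n] by (simp add: exp_add exp_diff exp_of_real)
  also have "poly (\<Psi> (Suc n)) z = poly (\<Psi> n) z * step_factor n z"
    using \<Psi>_nonzero[OF assms, of n] by (simp add: poly_\<Psi>_Suc step_factor_def field_simps)
  then have "inv_phi n z * of_real (rho g n) / step_factor n z = inv_phi (Suc n) z"
    by (simp add: inv_phi_def Phi_norm_Suc mult_ac)
  finally show ?case .
qed

lemma Im_log_inv_phi_0: "Im (log_inv_phi n 0) = 0"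
  by (simp add: log_inv_phi_def step_factor_def)

lemma inv_phi_nonzero: "cmod z \<le> 1 \<Longrightarrow> inv_phi n z \<noteq> 0"
  using Phi_norm_pos[of n] \<Psi>_nonzero by (simp add: inv_phi_def)

lemma Re_log_inv_phi: assumes "cmod z \<le> 1" shows "Re (log_inv_phi n z) = ln (cmod (inv_phi n z))"
  using exp_log_inv_phi[OF assms, of n] by (metis norm_exp_eq_Re ln_exp)

text \<open>
  The Schwarz formula applied to the logarithm shows that \<open>1 / \<phi>\<^sub>n\<^sup>*\<close> is outer: its boundary modulus determines it.
\<close>

lemma inv_phi_schwarz:
  assumes "cmod z < 1"
  shows "inv_phi n z = exp (LINT \<xi>|circle_measure. (\<xi> + z) / (\<xi> - z) * of_real (ln (cmod (inv_phi n \<xi>))))"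
proof -
  have "(LINT \<xi>|circle_measure. (\<xi> + z) / (\<xi> - z) * of_real (ln (cmod (inv_phi n \<xi>))))
     = (LINT \<xi>|circle_measure. (\<xi> + z) / (\<xi> - z) * of_real (Re (log_inv_phi n \<xi>)))"
  proof (rule integral_cong_AE)
    show "AE \<xi> in circle_measure. (\<xi> + z) / (\<xi> - z) * complex_of_real (ln (cmod (inv_phi n \<xi>))) =
         (\<xi> + z) / (\<xi> - z) * of_real (Re (log_inv_phi n \<xi>))"
      using AE_circle_norm by eventually_elim (simp add: Re_log_inv_phi)
  qed auto
  also have "\<dots> = log_inv_phi n z"
    by (rule schwarz_formula[OF _ continuous_log_inv_phi holomorphic_log_inv_phi assms Im_log_inv_phi_0]) simp
  finally show ?thesis using exp_log_inv_phi[of z n] assms by simp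
qed

end

section \<open>Products of transfer matrices\<close>

lemma frobenius_norm_eq_norm: "frobenius_norm A = norm A"
proof -
  have "Re (trace (adjoint_matrix A ** A)) = (\<Sum>i\<in>UNIV. \<Sum>k\<in>UNIV. (cmod (A $ k $ i))\<^sup>2)"
    unfolding cmod_power2
    by (simp add: trace_def matrix_matrix_mult_def adjoint_matrix_def power2_eq_square)
  also have "\<dots> = (\<Sum>k\<in>UNIV. \<Sum>i\<in>UNIV. (cmod (A $ k $ i))\<^sup>2)" by (rule sum.swap)
  finally show ?thesis
    by (simp add: frobenius_norm_def norm_vec_def L2_set_def sum_nonneg)
qed

lemma norm_mat2: "(norm (A :: complex^2^2))\<^sup>2 =
   (cmod (A$1$1))\<^sup>2 + (cmod (A$1$2))\<^sup>2 + (cmod (A$2$1))\<^sup>2 + (cmod (A$2$2))\<^sup>2"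
  by (simp add: norm_vec_def L2_set_def sum_2)

lemma cauchy_schwarz2: "(cmod (a * b + c * d))\<^sup>2 \<le> ((cmod a)\<^sup>2 + (cmod c)\<^sup>2) * ((cmod b)\<^sup>2 + (cmod d)\<^sup>2)"
proof -
  have "cmod (a * b + c * d) \<le> cmod a * cmod b + cmod c * cmod d"
    using norm_triangle_ineq[of "a*b" "c*d"] by (simp add: norm_mult)
  then have "(cmod (a * b + c * d))\<^sup>2 \<le> (cmod a * cmod b + cmod c * cmod d)\<^sup>2"
    by (intro power_mono) auto
  also have "\<dots> \<le> ((cmod a)\<^sup>2 + (cmod c)\<^sup>2) * ((cmod b)\<^sup>2 + (cmod d)\<^sup>2)"
    using zero_le_power2[of "cmod a * cmod d - cmod c * cmod b"]
    by (simp add: power2_eq_square algebra_simps)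
  finally show ?thesis .
qed

text \<open>
  Each entry of the product is estimated by the Cauchy--Schwarz inequality.
\<close>

lemma norm_mat2_mult: "norm ((A :: complex^2^2) ** (B :: complex^2^2)) \<le> norm A * norm B"
proof (rule power2_le_imp_le)
  have e: "(A ** B) $ i $ j = A$i$1 * B$1$j + A$i$2 * B$2$j" for i j
    by (simp add: matrix_matrix_mult_def sum_2)
  show "(norm (A ** B))\<^sup>2 \<le> (norm A * norm B)\<^sup>2"
    unfolding power_mult_distrib norm_mat2 e
    using cauchy_schwarz2[of "A$1$1" "B$1$1" "A$1$2" "B$2$1"] cauchy_schwarz2[of "A$1$1" "B$1$2" "A$1$2" "B$2$2"]
      cauchy_schwarz2[of "A$2$1" "B$1$1" "A$2$2" "B$2$1"] cauchy_schwarz2[of "A$2$1" "B$1$2" "A$2$2" "B$2$2"]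
    by (simp add: algebra_simps)
qed simp

lemma norm_mat_1: "norm (mat 1 :: complex^2^2) = sqrt 2"
proof -
  have "(norm (mat 1 :: complex^2^2))\<^sup>2 = 2" by (simp add: norm_mat2 mat_def)
  then show ?thesis by (metis norm_ge_zero real_sqrt_abs abs_of_nonneg)
qed

lemma Omega_entries:
  "Omega g \<xi> n $ 1 $ 1 = of_real (inverse (rho g n))"
  "Omega g \<xi> n $ 1 $ 2 = of_real (inverse (rho g n)) * (cnj (g n) * inverse (\<xi> ^ n))"
  "Omega g \<xi> n $ 2 $ 1 = of_real (inverse (rho g n)) * (g n * \<xi> ^ n)"
  "Omega g \<xi> n $ 2 $ 2 = of_real (inverse (rho g n))"
  by (simp_all add: Omega_def power_int_minus scaleR_conv_of_real[where 'a=complex])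

lemma mult_entries: "((A :: complex^2^2) ** (B :: complex^2^2)) $ i $ j = A$i$1 * B$1$j + A$i$2 * B$2$j"
  by (simp add: matrix_matrix_mult_def sum_2)

lemma borel_measurable_Omega [measurable]: "(\<lambda>\<xi>. Omega g \<xi> n $ i $ j) \<in> borel_measurable borel"
  using exhaust_2[of i] exhaust_2[of j] by (auto simp: Omega_entries)

lemma borel_measurable_Omega_prod [measurable]: "(\<lambda>\<xi>. Omega_prod g \<xi> n $ i $ j) \<in> borel_measurable borel"
  by (induction n arbitrary: i j) (auto simp: mult_entries)

lemma borel_measurable_norm_Omega_prod [measurable]:
  "(\<lambda>\<xi>. norm (Omega_prod g \<xi> n - mat 1)) \<in> borel_measurable borel"
proof -
  have "norm (A :: complex^2^2) = sqrt ((cmod (A$1$1))\<^sup>2 + (cmod (A$1$2))\<^sup>2 + (cmod (A$2$1))\<^sup>2 + (cmod (A$2$2))\<^sup>2)" for A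
    by (metis norm_mat2 norm_ge_zero real_sqrt_abs abs_of_nonneg)
  then show ?thesis by simp
qed

lemma borel_measurable_maximal_O [measurable]: "maximal_O g \<in> borel_measurable borel"
  unfolding maximal_O_def frobenius_norm_eq_norm by measurable

lemma borel_measurable_log_one_plus_sq [measurable]:
  assumes [measurable]: "h \<in> borel_measurable M" shows "(\<lambda>x. log_one_plus_sq (h x)) \<in> borel_measurable M"
  unfolding log_one_plus_sq_def by measurable

lemma norm_le_maximal_O: "ennreal (norm (Omega_prod g \<xi> n - mat 1)) \<le> maximal_O g \<xi>"
  unfolding maximal_O_def frobenius_norm_eq_norm by (rule SUP_upper) simp

lemma det_Omega:
  assumes "cmod (g n) < 1" "cmod \<xi> = 1" shows "det (Omega g \<xi> n) = 1"
proof -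
  have "rho g n > 0" by (rule rho_positive[of g, OF assms(1)])
  moreover have "(rho g n)\<^sup>2 = 1 - (cmod (g n))\<^sup>2" by (rule rho_squared[of g, OF assms(1)])
  then have "(of_real (rho g n))\<^sup>2 = (1 - g n * cnj (g n) :: complex)"
    unfolding of_real_power[symmetric] by (simp add: complex_norm_square del: of_real_power)
  moreover have "\<xi> \<noteq> 0" using assms by auto
  ultimately show ?thesis
    unfolding det_2 Omega_entries by (simp add: field_simps power2_eq_square)
qed

lemma det_Omega_prod:
  assumes "disc_sequence g" "cmod \<xi> = 1" shows "det (Omega_prod g \<xi> n) = 1"
  by (induction n) (use assms in \<open>auto simp: det_mul det_Omega disc_sequence_def\<close>)

lemma norm_Omega:
  assumes "cmod (g n) < 1" "cmod \<xi> = 1" shows "norm (Omega g \<xi> n) \<le> 2 / rho g n"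
proof -
  have r: "rho g n > 0" by (rule rho_positive[of g, OF assms(1)])
  have "(cmod (g n))\<^sup>2 \<le> 1" using assms by (simp add: power_le_one)
  then have "(norm (Omega g \<xi> n))\<^sup>2 \<le> (2 / rho g n)\<^sup>2"
  proof -
    have "(norm (Omega g \<xi> n))\<^sup>2 = (2 + 2 * (cmod (g n))\<^sup>2) / (rho g n)\<^sup>2"
      unfolding norm_mat2 Omega_entries norm_mult norm_of_real complex_mod_cnj norm_inverse norm_power assms(2)
      using r by (simp add: power_mult_distrib power_divide field_simps)
    also have "\<dots> \<le> 4 / (rho g n)\<^sup>2"
      using \<open>(cmod (g n))\<^sup>2 \<le> 1\<close> by (intro divide_right_mono) auto
    finally show ?thesis by (simp add: power_divide)
  qed
  then show ?thesis by (rule power2_le_imp_le) (use r in auto)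
qed

text \<open>
  The leading parameters are replaced by \<open>0\<close> and not shifted away, since \<open>\<Omega>\<^sub>n\<close> depends on the index \<open>n\<close>
  through \<open>\<xi>\<^sup>n\<close>; a zero parameter contributes the identity matrix.
\<close>

definition tail :: "nat \<Rightarrow> (nat \<Rightarrow> complex) \<Rightarrow> nat \<Rightarrow> complex" where
  "tail N g n = (if n \<le> N then 0 else g n)"

lemma Omega_zero: "g n = 0 \<Longrightarrow> Omega g \<xi> n = mat 1"
  by (simp add: vec_eq_iff forall_2 Omega_entries mat_def rho_def)

lemma Omega_prod_tail_initial: "n \<le> N \<Longrightarrow> Omega_prod (tail N g) \<xi> n = mat 1"
  by (induction n) (auto simp: Omega_zero tail_def)

lemma Omega_prod_tail: "n \<ge> N \<Longrightarrow> Omega_prod g \<xi> n = Omega_prod (tail N g) \<xi> n ** Omega_prod g \<xi> N"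
proof (induction n rule: dec_induct)
  case base
  then show ?case by (simp add: Omega_prod_tail_initial)
next
  case (step n)
  have "Omega (tail N g) \<xi> (Suc n) = Omega g \<xi> (Suc n)"
    using step by (simp add: Omega_def rho_def tail_def)
  then show ?case using step by (simp add: matrix_mul_assoc)
qed

lemma disc_tail: "disc_sequence g \<Longrightarrow> disc_sequence (tail N g)"
  by (simp add: disc_sequence_def tail_def)

lemma tail_sums:
  assumes "in_l2 g"
  shows "(\<lambda>n. (cmod (tail N g n))\<^sup>2) sums ((\<Sum>n. (cmod (g n))\<^sup>2) - (\<Sum>n\<le>N. (cmod (g n))\<^sup>2))"
proof -
  have "(\<lambda>n. (cmod (g n))\<^sup>2 - (if n \<in> {..N} then (cmod (g n))\<^sup>2 else 0)) sums
     ((\<Sum>n. (cmod (g n))\<^sup>2) - (\<Sum>n\<le>N. (cmod (g n))\<^sup>2))"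
    by (intro sums_diff summable_sums sums_If_finite_set) (use assms in \<open>auto simp: in_l2_def\<close>)
  moreover have "(cmod (g n))\<^sup>2 - (if n \<in> {..N} then (cmod (g n))\<^sup>2 else 0) = (cmod (tail N g n))\<^sup>2" for n
    by (simp add: tail_def)
  ultimately show ?thesis by simp
qed

lemma in_l2_tail: "in_l2 g \<Longrightarrow> in_l2 (tail N g)"
  using tail_sums sums_summable unfolding in_l2_def by blast

lemma l2_norm_tail_tendsto:
  assumes "in_l2 g" shows "(\<lambda>N. l2_norm (tail N g)) \<longlonglongrightarrow> 0"
proof -
  have "(\<lambda>N. (\<Sum>n. (cmod (g n))\<^sup>2) - (\<Sum>n\<le>N. (cmod (g n))\<^sup>2)) \<longlonglongrightarrow> (\<Sum>n. (cmod (g n))\<^sup>2) - (\<Sum>n. (cmod (g n))\<^sup>2)"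
    using assms unfolding in_l2_def by (intro tendsto_diff tendsto_const summable_LIMSEQ')
  then have "(\<lambda>N. sqrt ((\<Sum>n. (cmod (g n))\<^sup>2) - (\<Sum>n\<le>N. (cmod (g n))\<^sup>2))) \<longlonglongrightarrow> sqrt 0"
    by (intro tendsto_real_sqrt) simp
  then show ?thesis
    unfolding l2_norm_def using sums_unique[OF tail_sums[OF assms]] by simp
qed

text \<open>
  The tails eventually have norm at most the \<open>\<epsilon>\<close> of \<open>qNCC_II\<close>, whose bound then tends to \<open>0\<close>.
\<close>

lemma tail_log_integral_tendsto:
  assumes "qNCC_II" "disc_sequence g" "in_l2 g"
  shows "(\<lambda>N. \<integral>\<^sup>+ \<xi>. log_one_plus_sq (maximal_O (tail N g) \<xi>) \<partial>circle_measure) \<longlonglongrightarrow> 0"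
proof -
  obtain e C where e: "e > 0" "C > 0" and q: "\<And>g. disc_sequence g \<Longrightarrow> in_l2 g \<Longrightarrow> l2_norm g \<le> e \<Longrightarrow>
     (\<integral>\<^sup>+ \<xi>. log_one_plus_sq (maximal_O g \<xi>) \<partial>circle_measure) \<le> ennreal (C * (l2_norm g)\<^sup>2)"
    using assms(1) unfolding qNCC_II_def by blast
  have lim: "(\<lambda>N. ennreal (C * (l2_norm (tail N g))\<^sup>2)) \<longlonglongrightarrow> ennreal (C * 0\<^sup>2)"
    by (intro tendsto_ennrealI tendsto_mult tendsto_power tendsto_const l2_norm_tail_tendsto assms)
  have ev: "\<forall>\<^sub>F N in sequentially. l2_norm (tail N g) < e"
    using l2_norm_tail_tendsto[OF assms(3)] e(1) by (intro order_tendstoD) auto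
  show ?thesis
  proof (rule tendsto_sandwich[of "\<lambda>_. 0"])
    show "\<forall>\<^sub>F N in sequentially. (\<integral>\<^sup>+ \<xi>. log_one_plus_sq (maximal_O (tail N g) \<xi>) \<partial>circle_measure) \<le> ennreal (C * (l2_norm (tail N g))\<^sup>2)"
      using ev by eventually_elim (auto intro!: q disc_tail in_l2_tail assms)
  qed (use lim in auto)
qed

lemma log_one_plus_sq_le:
  assumes "log_one_plus_sq t < ennreal (ln (1 + \<delta>\<^sup>2))" "\<delta> > 0" shows "t < ennreal \<delta>"
proof -
  have t: "t \<noteq> \<infinity>" using assms by (auto simp: log_one_plus_sq_def)
  then have "ln (1 + (enn2real t)\<^sup>2) < ln (1 + \<delta>\<^sup>2)"
    using assms by (auto simp: log_one_plus_sq_def ennreal_less_iff)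
  then have "(enn2real t)\<^sup>2 < \<delta>\<^sup>2"
    by (subst (asm) ln_less_cancel_iff) (auto intro: add_pos_nonneg)
  then have "enn2real t < \<delta>" using assms by (simp add: power2_less_imp_less)
  then show ?thesis using t by (metis ennreal_enn2real ennreal_lessI assms(2) infinity_ennreal_def less_top)
qed

text \<open>
  By Fatou's lemma the lower limit of \<open>log (1 + O\<^sup>2)\<close> over the tails has integral \<open>0\<close>.
\<close>

lemma AE_tail_small:
  assumes "qNCC_II" "disc_sequence g" "in_l2 g"
  shows "AE \<xi> in circle_measure. \<forall>\<delta>>0. \<exists>N. maximal_O (tail N g) \<xi> < ennreal \<delta>"
proof -
  let ?h = "\<lambda>N \<xi>. log_one_plus_sq (maximal_O (tail N g) \<xi>)"
  have "(\<integral>\<^sup>+ \<xi>. liminf (\<lambda>N. ?h N \<xi>) \<partial>circle_measure) \<le> liminf (\<lambda>N. \<integral>\<^sup>+ \<xi>. ?h N \<xi> \<partial>circle_measure)"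
    by (rule nn_integral_liminf) simp
  also have "\<dots> = 0"
    by (rule lim_imp_Liminf[OF _ tail_log_integral_tendsto[OF assms]]) simp
  finally have "(\<integral>\<^sup>+ \<xi>. liminf (\<lambda>N. ?h N \<xi>) \<partial>circle_measure) = 0" by simp
  then have "AE \<xi> in circle_measure. liminf (\<lambda>N. ?h N \<xi>) = 0"
    by (subst (asm) nn_integral_0_iff_AE) auto
  then show ?thesis
  proof eventually_elim
    fix \<xi> assume l: "liminf (\<lambda>N. ?h N \<xi>) = 0"
    show "\<forall>\<delta>>0. \<exists>N. maximal_O (tail N g) \<xi> < ennreal \<delta>"
    proof (intro allI impI)
      fix \<delta> :: real assume \<delta>: "\<delta> > 0"
      have "\<exists>N. ?h N \<xi> < ennreal (ln (1 + \<delta>\<^sup>2))"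
      proof (rule ccontr)
        assume "\<nexists>N. ?h N \<xi> < ennreal (ln (1 + \<delta>\<^sup>2))"
        then have "ennreal (ln (1 + \<delta>\<^sup>2)) \<le> liminf (\<lambda>N. ?h N \<xi>)"
          by (intro Liminf_bounded) (auto simp: not_less)
        moreover have "0 < ln (1 + \<delta>\<^sup>2)" using \<delta> by (intro ln_gt_zero) simp
        ultimately show False using l by simp
      qed
      then show "\<exists>N. maximal_O (tail N g) \<xi> < ennreal \<delta>" using log_one_plus_sq_le \<delta> by blast
    qed
  qed
qed

lemma norm_tail_prod_le:
  assumes "maximal_O (tail N g) \<xi> < \<infinity>"
  shows "norm (Omega_prod (tail N g) \<xi> n) \<le> sqrt 2 + enn2real (maximal_O (tail N g) \<xi>)"
proof -
  have "ennreal (norm (Omega_prod (tail N g) \<xi> n - mat 1)) \<le> ennreal (enn2real (maximal_O (tail N g) \<xi>))"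
    using norm_le_maximal_O[of "tail N g" \<xi> n] assms by simp
  then have "norm (Omega_prod (tail N g) \<xi> n - mat 1) \<le> enn2real (maximal_O (tail N g) \<xi>)"
    by (simp add: ennreal_le_iff)
  then show ?thesis
    using norm_triangle_ineq[of "mat 1 :: complex^2^2" "Omega_prod (tail N g) \<xi> n - mat 1"]
    by (simp add: norm_mat_1)
qed

text \<open>
  If \<open>m, n \<ge> N\<close> then \<open>\<Pi>\<^sub>m - \<Pi>\<^sub>n = (T\<^sub>m - T\<^sub>n) \<Pi>\<^sub>N\<close>, where \<open>T\<close> denotes the products of the tail after \<open>N\<close>.
  One tail with finite maximal function bounds all \<open>\<Pi>\<^sub>N\<close>, and a tail with small maximal function
  makes the first factor small.
\<close>

lemma Omega_prod_convergent:
  assumes "\<forall>\<delta>>0. \<exists>N. maximal_O (tail N g) \<xi> < ennreal \<delta>"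
  shows "convergent (Omega_prod g \<xi>)"
proof -
  obtain N0 where N0: "maximal_O (tail N0 g) \<xi> < ennreal 1" using assms zero_less_one by blast
  then have fin: "maximal_O (tail N0 g) \<xi> < \<infinity>" by (metis ennreal_less_top infinity_ennreal_def less_trans)
  \<comment> \<open>a bound for all products, so that it may be used below with an index \<open>N\<close> chosen later\<close>
  define B0 where "B0 = (sqrt 2 + enn2real (maximal_O (tail N0 g) \<xi>)) * norm (Omega_prod g \<xi> N0)"
  define B where "B = 1 + B0 + (\<Sum>k<N0. norm (Omega_prod g \<xi> k))"
  have "B0 \<ge> 0" unfolding B0_def by (intro mult_nonneg_nonneg) auto
  then have B: "B > 0" unfolding B_def by (intro add_pos_nonneg sum_nonneg) auto
  have bd: "norm (Omega_prod g \<xi> n) \<le> B" for n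
  proof (cases "n \<ge> N0")
    case True
    have "norm (Omega_prod g \<xi> n) \<le> norm (Omega_prod (tail N0 g) \<xi> n) * norm (Omega_prod g \<xi> N0)"
      by (subst Omega_prod_tail[OF True]) (rule norm_mat2_mult)
    also have "\<dots> \<le> B0" unfolding B0_def
      by (intro mult_right_mono norm_tail_prod_le[OF fin]) simp
    also have "\<dots> \<le> B" unfolding B_def
      using sum_nonneg[of "{..<N0}" "\<lambda>k. norm (Omega_prod g \<xi> k)"] by simp
    finally show ?thesis .
  next
    case False
    then have "norm (Omega_prod g \<xi> n) \<le> (\<Sum>k<N0. norm (Omega_prod g \<xi> k))"
      by (intro member_le_sum) auto
    then show ?thesis using \<open>B0 \<ge> 0\<close> by (simp add: B_def)
  qed
  have "Cauchy (Omega_prod g \<xi>)"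
  proof (rule CauchyI)
    fix e :: real assume e: "e > 0"
    define \<delta> where "\<delta> = e / (4 * B)"
    have \<delta>: "\<delta> > 0" using e B by (simp add: \<delta>_def)
    then obtain N where N: "maximal_O (tail N g) \<xi> < ennreal \<delta>" using assms by blast
    let ?T = "Omega_prod (tail N g) \<xi>"
    have t: "norm (?T n - mat 1) < \<delta>" for n
      using le_less_trans[OF norm_le_maximal_O N, of n] by (simp add: ennreal_less_iff)
    have dT: "norm (?T n - ?T m) < 2 * \<delta>" for n m
      using t[of n] t[of m] norm_triangle_ineq4[of "?T n - mat 1" "?T m - mat 1"] by simp
    show "\<exists>M. \<forall>m\<ge>M. \<forall>n\<ge>M. norm (Omega_prod g \<xi> m - Omega_prod g \<xi> n) < e"
    proof (intro exI allI impI)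
      fix m n assume mn: "N \<le> m" "N \<le> n"
      have "Omega_prod g \<xi> m - Omega_prod g \<xi> n = (?T m - ?T n) ** Omega_prod g \<xi> N"
        using Omega_prod_tail[OF mn(1), of g \<xi>] Omega_prod_tail[OF mn(2), of g \<xi>]
        by (simp add: vec_eq_iff mult_entries algebra_simps)
      then have "norm (Omega_prod g \<xi> m - Omega_prod g \<xi> n) \<le> norm (?T m - ?T n) * norm (Omega_prod g \<xi> N)"
        by (simp add: norm_mat2_mult)
      also have "\<dots> \<le> (2 * \<delta>) * B"
        using dT[of m n] bd[of N] \<delta> by (intro mult_mono) auto
      also have "\<dots> < e" using e B by (simp add: \<delta>_def)
      finally show "norm (Omega_prod g \<xi> m - Omega_prod g \<xi> n) < e" .
    qed
  qed
  then show ?thesis by (rule Cauchy_convergent)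
qed


lemma Omega_prod_initial_bound:
  assumes "disc_sequence g"
  shows "\<exists>M\<ge>1. \<forall>\<xi> n. n \<le> N \<longrightarrow> cmod \<xi> = 1 \<longrightarrow> norm (Omega_prod g \<xi> n) \<le> M"
proof (induction N)
  case 0
  have "rho g 0 \<le> 1" "rho g 0 > 0"
    using assms by (auto simp: rho_le_1 rho_positive disc_sequence_def)
  then have "2 / rho g 0 \<ge> 1" by (simp add: field_simps)
  then show ?case using norm_Omega[of g 0] assms by (intro exI[of _ "2 / rho g 0"]) (auto simp: disc_sequence_def)
next
  case (Suc N)
  then obtain M where M: "M \<ge> 1" "\<And>\<xi> n. n \<le> N \<Longrightarrow> cmod \<xi> = 1 \<Longrightarrow> norm (Omega_prod g \<xi> n) \<le> M" by blast
  have "rho g (Suc N) \<le> 1" "rho g (Suc N) > 0"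
    using assms by (auto simp: rho_le_1 rho_positive disc_sequence_def)
  then have r: "2 / rho g (Suc N) \<ge> 1" by (simp add: field_simps)
  have le: "M \<le> 2 / rho g (Suc N) * M" using mult_right_mono[OF r, of M] M by simp
  show ?case
  proof (intro exI[of _ "2 / rho g (Suc N) * M"] conjI allI impI)
    show "1 \<le> 2 / rho g (Suc N) * M" using le M by linarith
    fix \<xi> n assume n: "n \<le> Suc N" and \<xi>: "cmod \<xi> = 1"
    show "norm (Omega_prod g \<xi> n) \<le> 2 / rho g (Suc N) * M"
    proof (cases "n = Suc N")
      case True
      have "norm (Omega_prod g \<xi> n) \<le> norm (Omega g \<xi> (Suc N)) * norm (Omega_prod g \<xi> N)"
        unfolding True by (simp add: norm_mat2_mult)
      also have "\<dots> \<le> 2 / rho g (Suc N) * M"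
        using assms r M \<xi> \<open>rho g (Suc N) > 0\<close> by (intro mult_mono norm_Omega) (auto simp: disc_sequence_def)
      finally show ?thesis .
    next
      case False
      then show ?thesis using M(2)[of n \<xi>] n \<xi> le by auto
    qed
  qed
qed

text \<open>
  A tail \<open>T\<^sub>n\<close> with integrable \<open>log (1 + O\<^sup>2)\<close> satisfies
  \<open>log \<parallel>T\<^sub>n\<parallel> \<le> log (\<surd>2 + O) \<le> log 2 + \<onehalf> log (1 + O\<^sup>2)\<close>, and the initial product is bounded on the circle.
\<close>

lemma Omega_prod_dominated:
  assumes "qNCC_II" and g: "disc_sequence g" and "in_l2 g"
  obtains W where "integrable circle_measure W"
    "AE \<xi> in circle_measure. \<forall>n. sqrt 2 * norm (Omega_prod g \<xi> n) \<le> exp (W \<xi>)"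
proof -
  have "\<forall>\<^sub>F N in sequentially. (\<integral>\<^sup>+ \<xi>. log_one_plus_sq (maximal_O (tail N g) \<xi>) \<partial>circle_measure) < 1"
    using tail_log_integral_tendsto[OF assms] by (rule order_tendstoD) simp
  then obtain N where "(\<integral>\<^sup>+ \<xi>. log_one_plus_sq (maximal_O (tail N g) \<xi>) \<partial>circle_measure) < 1"
    using eventually_happens'[of sequentially] by auto
  then have fin: "(\<integral>\<^sup>+ \<xi>. log_one_plus_sq (maximal_O (tail N g) \<xi>) \<partial>circle_measure) < \<infinity>"
    by (rule less_trans) simp
  obtain M where M: "M \<ge> 1" "\<And>\<xi> n. n \<le> N \<Longrightarrow> cmod \<xi> = 1 \<Longrightarrow> norm (Omega_prod g \<xi> n) \<le> M"
    using Omega_prod_initial_bound[OF g, of N] by blast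
  define h where "h = (\<lambda>\<xi>. enn2real (log_one_plus_sq (maximal_O (tail N g) \<xi>)))"
  have [measurable]: "h \<in> borel_measurable borel" unfolding h_def by measurable
  have ae: "AE \<xi> in circle_measure. log_one_plus_sq (maximal_O (tail N g) \<xi>) \<noteq> \<infinity>"
    by (rule nn_integral_PInf_AE) (use fin in auto)
  have "(\<integral>\<^sup>+ \<xi>. ennreal (h \<xi>) \<partial>circle_measure) < \<infinity>"
    by (rule le_less_trans[OF nn_integral_mono fin]) (simp add: h_def ennreal_enn2real_if)
  then have hi: "integrable circle_measure h"
    by (intro integrableI_nonneg) (auto simp: h_def)
  show ?thesis
  proof (rule that[of "\<lambda>\<xi>. ln (4 * M) + 1 / 2 * h \<xi>"])
    show "integrable circle_measure (\<lambda>\<xi>. ln (4 * M) + 1 / 2 * h \<xi>)" using hi by simp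
    show "AE \<xi> in circle_measure. \<forall>n. sqrt 2 * norm (Omega_prod g \<xi> n) \<le> exp (ln (4 * M) + 1 / 2 * h \<xi>)"
      using ae AE_circle_norm
    proof eventually_elim
      fix \<xi> assume nf: "log_one_plus_sq (maximal_O (tail N g) \<xi>) \<noteq> \<infinity>" and \<xi>: "cmod \<xi> = 1"
      define t where "t = enn2real (maximal_O (tail N g) \<xi>)"
      have t0: "t \<ge> 0" by (simp add: t_def)
      have mf: "maximal_O (tail N g) \<xi> < \<infinity>" using nf by (auto simp: log_one_plus_sq_def less_top[symmetric])
      have h: "h \<xi> = ln (1 + t\<^sup>2)" using mf by (simp add: h_def t_def log_one_plus_sq_def)
      have "exp (1 / 2 * h \<xi>) = sqrt (1 + t\<^sup>2)"
        unfolding h by (simp add: ln_sqrt[symmetric] add_pos_nonneg)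
      then have ex: "exp (ln (4 * M) + 1 / 2 * h \<xi>) = 4 * M * sqrt (1 + t\<^sup>2)"
        using M by (simp add: exp_add)
      have s: "1 \<le> sqrt (1 + t\<^sup>2)" "t \<le> sqrt (1 + t\<^sup>2)"
        by (auto intro: real_le_rsqrt)
      have s2: "sqrt 2 \<le> 2" by (simp add: real_le_lsqrt)
      show "\<forall>n. sqrt 2 * norm (Omega_prod g \<xi> n) \<le> exp (ln (4 * M) + 1 / 2 * h \<xi>)"
      proof
        fix n
        have "norm (Omega_prod g \<xi> n) \<le> (sqrt 2 + t) * M"
        proof (cases "n \<le> N")
          case True
          have "1 * M \<le> (sqrt 2 + t) * M" using M t0 by (intro mult_right_mono add_increasing2) auto
          then show ?thesis using M(2)[OF True \<xi>] by linarith
        next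
          case False
          then have "norm (Omega_prod g \<xi> n) \<le> norm (Omega_prod (tail N g) \<xi> n) * norm (Omega_prod g \<xi> N)"
            by (subst Omega_prod_tail[of N n]) (auto intro: norm_mat2_mult)
          also have "\<dots> \<le> (sqrt 2 + t) * M"
            unfolding t_def by (intro mult_mono norm_tail_prod_le[OF mf] M(2) \<xi> add_nonneg_nonneg) auto
          finally show ?thesis .
        qed
        then have "sqrt 2 * norm (Omega_prod g \<xi> n) \<le> sqrt 2 * ((sqrt 2 + t) * M)"
          by (intro mult_left_mono) auto
        also have "\<dots> = (2 + sqrt 2 * t) * M" by (simp add: algebra_simps flip: mult.assoc)
        also have "\<dots> \<le> (4 * sqrt (1 + t\<^sup>2)) * M"
        proof (rule mult_right_mono)
          have "sqrt 2 * t \<le> 2 * t" using s2 t0 by (intro mult_right_mono) auto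
          then show "2 + sqrt 2 * t \<le> 4 * sqrt (1 + t\<^sup>2)" using s by linarith
        qed (use M in simp)
        finally show "sqrt 2 * norm (Omega_prod g \<xi> n) \<le> exp (ln (4 * M) + 1 / 2 * h \<xi>)"
          unfolding ex by (simp add: mult_ac)
      qed
    qed
  qed
qed

context szego_recursion begin

lemma disc_g: "disc_sequence g" by (simp add: disc_sequence_def disc)

text \<open>
  Each step is the recursion conjugated by a diagonal matrix: the product maps \<open>(\<xi>, -1)\<close> to \<open>(\<xi>\<^bsup>-n\<^esup> \<phi>\<^sub>n\<^sub>+\<^sub>1, - \<phi>\<^sub>n\<^sub>+\<^sub>1\<^sup>*)\<close>.
\<close>

lemma Omega_prod_vec:
  assumes \<xi>: "cmod \<xi> = 1"
  shows "Omega_prod g \<xi> n $ 1 $ 1 * \<xi> - Omega_prod g \<xi> n $ 1 $ 2 = inverse (\<xi> ^ n) * poly (\<Phi> (Suc n)) \<xi> / of_real (Phi_norm (Suc n))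
     \<and> Omega_prod g \<xi> n $ 2 $ 1 * \<xi> - Omega_prod g \<xi> n $ 2 $ 2 = - (poly (\<Psi> (Suc n)) \<xi> / of_real (Phi_norm (Suc n)))"
proof (induction n)
  case 0
  show ?case using rho_pos[of 0]
    by (simp add: Omega_entries Phi_norm_def \<Phi>_Suc \<Psi>_Suc \<Phi>_0 \<Psi>_0 field_simps)
next
  case (Suc n)
  let ?A = "Omega_prod g \<xi> n" and ?r = "complex_of_real (inverse (rho g (Suc n)))"
  have nz: "\<xi> \<noteq> 0" "Phi_norm (Suc n) \<noteq> 0" "rho g (Suc n) \<noteq> 0" using \<xi> Phi_norm_pos[of "Suc n"] rho_pos[of "Suc n"] by auto
  define u v where "u = ?A $ 1 $ 1 * \<xi> - ?A $ 1 $ 2" and "v = ?A $ 2 $ 1 * \<xi> - ?A $ 2 $ 2"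
  have uv: "u = inverse (\<xi> ^ n) * poly (\<Phi> (Suc n)) \<xi> / of_real (Phi_norm (Suc n))"
    "v = - (poly (\<Psi> (Suc n)) \<xi> / of_real (Phi_norm (Suc n)))" using Suc by (auto simp: u_def v_def)
  have "Omega_prod g \<xi> (Suc n) $ 1 $ 1 * \<xi> - Omega_prod g \<xi> (Suc n) $ 1 $ 2
     = ?r * (u + cnj (g (Suc n)) * inverse (\<xi> ^ Suc n) * v)"
    by (simp add: mult_entries Omega_entries u_def v_def algebra_simps)
  moreover have "\<dots> = inverse (\<xi> ^ Suc n) * poly (\<Phi> (Suc (Suc n))) \<xi> / of_real (Phi_norm (Suc (Suc n)))"
    unfolding uv poly_\<Phi>_Suc[of "Suc n"] Phi_norm_Suc[of "Suc n"] using nz by (simp add: field_simps)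
  moreover have "Omega_prod g \<xi> (Suc n) $ 2 $ 1 * \<xi> - Omega_prod g \<xi> (Suc n) $ 2 $ 2
     = ?r * (g (Suc n) * \<xi> ^ Suc n * u + v)"
    by (simp add: mult_entries Omega_entries u_def v_def algebra_simps)
  moreover have "\<dots> = - (poly (\<Psi> (Suc (Suc n))) \<xi> / of_real (Phi_norm (Suc (Suc n))))"
    unfolding uv poly_\<Psi>_Suc[of "Suc n"] Phi_norm_Suc[of "Suc n"] using nz by (simp add: field_simps)
  ultimately show ?case by simp
qed

lemma inv_phi_Suc_eq: "cmod \<xi> = 1 \<Longrightarrow> inv_phi (Suc n) \<xi> = inverse (Omega_prod g \<xi> n $ 2 $ 2 - Omega_prod g \<xi> n $ 2 $ 1 * \<xi>)"
proof -
  assume "cmod \<xi> = 1"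
  from Omega_prod_vec[OF this, of n]
  have e: "Omega_prod g \<xi> n $ 2 $ 2 - Omega_prod g \<xi> n $ 2 $ 1 * \<xi> = poly (\<Psi> (Suc n)) \<xi> / of_real (Phi_norm (Suc n))"
    by (metis minus_diff_eq minus_minus)
  show ?thesis unfolding e inv_phi_def by simp
qed

text \<open>
  Both components of the image of \<open>(\<xi>, -1)\<close> have modulus \<open>\<bar>\<phi>\<^sub>n\<^sub>+\<^sub>1\<^sup>*\<bar>\<close>. Since the determinant is \<open>1\<close>, the inverse
  matrix has the same norm as the matrix, so this modulus is bounded from above and from below.
\<close>

lemma inv_phi_bounds:
  assumes \<xi>: "cmod \<xi> = 1"
  shows "cmod (inv_phi (Suc n) \<xi>) \<le> sqrt 2 * norm (Omega_prod g \<xi> n)"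
    and "1 / cmod (inv_phi (Suc n) \<xi>) \<le> sqrt 2 * norm (Omega_prod g \<xi> n)"
proof -
  let ?A = "Omega_prod g \<xi> n"
  define u v where "u = ?A $ 1 $ 1 * \<xi> - ?A $ 1 $ 2" and "v = ?A $ 2 $ 1 * \<xi> - ?A $ 2 $ 2"
  define F where "F = cmod (inv_phi (Suc n) \<xi>)"
  have F: "F > 0" using inv_phi_nonzero[of \<xi>] \<xi> by (simp add: F_def)
  have uF: "cmod u = 1 / F" and vF: "cmod v = 1 / F"
    using Omega_prod_vec[OF \<xi>, of n] Phi_norm_pos[of "Suc n"] \<xi> norm_\<Psi>_circle[OF \<xi>, of "Suc n"]
    by (auto simp: u_def v_def F_def inv_phi_def norm_mult norm_divide norm_inverse norm_power)
  have two: "a + b \<le> sqrt 2 * norm ?A" if "a\<^sup>2 + b\<^sup>2 \<le> (norm ?A)\<^sup>2" for a b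
  proof (rule power2_le_imp_le)
    have "(a + b)\<^sup>2 \<le> 2 * (a\<^sup>2 + b\<^sup>2)" using zero_le_power2[of "a - b"] by (simp add: power2_eq_square algebra_simps)
    also have "\<dots> \<le> (sqrt 2 * norm ?A)\<^sup>2" using that by (simp add: power_mult_distrib)
    finally show "(a + b)\<^sup>2 \<le> (sqrt 2 * norm ?A)\<^sup>2" .
  qed simp
  have "det ?A = 1" by (rule det_Omega_prod[OF disc_g \<xi>])
  then have d: "?A $ 1 $ 1 * ?A $ 2 $ 2 - ?A $ 1 $ 2 * ?A $ 2 $ 1 = 1" by (simp add: det_2)
  \<comment> \<open>the second row of the inverse matrix applied to the image vector returns \<open>-1\<close>\<close>
  have "?A $ 2 $ 1 * u - ?A $ 1 $ 1 * v = 1" using d by (simp add: u_def v_def algebra_simps)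
  then have "1 = cmod (?A $ 2 $ 1 * u - ?A $ 1 $ 1 * v)" by simp
  also have "\<dots> \<le> cmod (?A $ 2 $ 1) * cmod u + cmod (?A $ 1 $ 1) * cmod v"
    by (metis norm_triangle_ineq4 norm_mult)
  also have "\<dots> = (cmod (?A $ 2 $ 1) + cmod (?A $ 1 $ 1)) / F" unfolding uF vF by (simp add: add_divide_distrib)
  finally have "F \<le> cmod (?A $ 2 $ 1) + cmod (?A $ 1 $ 1)" using F by (simp add: field_simps)
  also have "\<dots> \<le> sqrt 2 * norm ?A" by (rule two) (simp add: norm_mat2)
  finally show "cmod (inv_phi (Suc n) \<xi>) \<le> sqrt 2 * norm (Omega_prod g \<xi> n)" by (simp add: F_def)
  have "1 / F \<le> cmod (?A $ 2 $ 1) + cmod (?A $ 2 $ 2)"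
    using norm_triangle_ineq4[of "?A $ 2 $ 1 * \<xi>" "?A $ 2 $ 2"] \<xi> by (simp add: vF[symmetric] v_def norm_mult)
  also have "\<dots> \<le> sqrt 2 * norm ?A" by (rule two) (simp add: norm_mat2)
  finally show "1 / cmod (inv_phi (Suc n) \<xi>) \<le> sqrt 2 * norm (Omega_prod g \<xi> n)" by (simp add: F_def)
qed

lemma inv_phi_dominated:
  assumes "qNCC_II" "in_l2 g"
  obtains W where "integrable circle_measure W"
    "AE \<xi> in circle_measure. \<forall>n. \<bar>ln (cmod (inv_phi n \<xi>))\<bar> \<le> W \<xi>"
proof -
  obtain W where W: "integrable circle_measure W"
    "AE \<xi> in circle_measure. \<forall>n. sqrt 2 * norm (Omega_prod g \<xi> n) \<le> exp (W \<xi>)"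
    using Omega_prod_dominated[OF assms(1) disc_g assms(2)] by blast
  have "AE \<xi> in circle_measure. \<forall>n. \<bar>ln (cmod (inv_phi n \<xi>))\<bar> \<le> W \<xi>"
    using W(2) AE_circle_norm
  proof eventually_elim
    fix \<xi> assume le: "\<forall>n. sqrt 2 * norm (Omega_prod g \<xi> n) \<le> exp (W \<xi>)" and \<xi>: "cmod \<xi> = 1"
    have S: "\<bar>ln (cmod (inv_phi (Suc n) \<xi>))\<bar> \<le> W \<xi>" for n
    proof -
      define F where "F = cmod (inv_phi (Suc n) \<xi>)"
      have F: "F > 0" using inv_phi_nonzero[of \<xi>] \<xi> by (simp add: F_def)
      have "F \<le> exp (W \<xi>)" "1 / F \<le> exp (W \<xi>)"
        using inv_phi_bounds[OF \<xi>, of n] le unfolding F_def by (meson order_trans)+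
      then have "ln F \<le> W \<xi>" "ln (1 / F) \<le> W \<xi>" 
        using F ln_le_cancel_iff[of F "exp (W \<xi>)"] ln_le_cancel_iff[of "1 / F" "exp (W \<xi>)"] by auto
      then show ?thesis using F by (simp add: F_def[symmetric] ln_div)
    qed
    have "inv_phi 0 \<xi> = 1" by (simp add: inv_phi_def Phi_norm_def \<Psi>_0)
    then show "\<forall>n. \<bar>ln (cmod (inv_phi n \<xi>))\<bar> \<le> W \<xi>"
      using S abs_ge_zero order_trans[OF abs_ge_zero S] by (metis abs_zero ln_one norm_one not0_implies_Suc)
  qed
  with W(1) show ?thesis by (rule that)
qed

lemma inv_phi_convergent:
  assumes "qNCC_II" "in_l2 g"
  shows "AE \<xi> in circle_measure. convergent (Omega_prod g \<xi>) \<and> convergent (\<lambda>n. inv_phi n \<xi>) \<and> lim (\<lambda>n. inv_phi n \<xi>) \<noteq> 0"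
  using AE_tail_small[OF assms(1) disc_g assms(2)] AE_circle_norm
proof eventually_elim
  fix \<xi> assume "\<forall>\<delta>>0. \<exists>N. maximal_O (tail N g) \<xi> < ennreal \<delta>" and \<xi>: "cmod \<xi> = 1"
  then have c: "convergent (Omega_prod g \<xi>)" by (intro Omega_prod_convergent)
  then obtain A where A: "Omega_prod g \<xi> \<longlonglongrightarrow> A" by (auto simp: convergent_def)
  have lim: "(\<lambda>n. Omega_prod g \<xi> n $ 2 $ 2 - Omega_prod g \<xi> n $ 2 $ 1 * \<xi>) \<longlonglongrightarrow> A $ 2 $ 2 - A $ 2 $ 1 * \<xi>"
    by (intro tendsto_intros tendsto_vec_nth A)
  obtain B where B: "\<And>n. norm (Omega_prod g \<xi> n) \<le> B" "B > 0"
    using convergent_imp_Bseq[OF c] unfolding Bseq_def by blast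
  have "1 \<le> sqrt 2 * B * cmod (Omega_prod g \<xi> n $ 2 $ 2 - Omega_prod g \<xi> n $ 2 $ 1 * \<xi>)" for n
  proof -
    define w where "w = Omega_prod g \<xi> n $ 2 $ 2 - Omega_prod g \<xi> n $ 2 $ 1 * \<xi>"
    have "inv_phi (Suc n) \<xi> \<noteq> 0" using inv_phi_nonzero[of \<xi>] \<xi> by simp
    then have "w \<noteq> 0" using inv_phi_Suc_eq[OF \<xi>, of n] by (auto simp: w_def)
    moreover have "1 / cmod w \<le> sqrt 2 * B"
    proof -
      have "1 / cmod w = cmod (inv_phi (Suc n) \<xi>)" using inv_phi_Suc_eq[OF \<xi>, of n] by (simp add: w_def norm_inverse inverse_eq_divide norm_divide)
      also have "\<dots> \<le> sqrt 2 * norm (Omega_prod g \<xi> n)" by (rule inv_phi_bounds(1)[OF \<xi>])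
      also have "\<dots> \<le> sqrt 2 * B" by (intro mult_left_mono B) simp
      finally show ?thesis .
    qed
    ultimately show ?thesis unfolding w_def[symmetric] by (simp add: field_simps)
  qed
  moreover have "(\<lambda>n. sqrt 2 * B * cmod (Omega_prod g \<xi> n $ 2 $ 2 - Omega_prod g \<xi> n $ 2 $ 1 * \<xi>)) \<longlonglongrightarrow> sqrt 2 * B * cmod (A $ 2 $ 2 - A $ 2 $ 1 * \<xi>)"
    by (intro tendsto_mult tendsto_const tendsto_norm lim)
  ultimately have "1 \<le> sqrt 2 * B * cmod (A $ 2 $ 2 - A $ 2 $ 1 * \<xi>)" by (intro LIMSEQ_le_const) blast+
  then have nz: "A $ 2 $ 2 - A $ 2 $ 1 * \<xi> \<noteq> 0" by auto
  have "(\<lambda>n. inv_phi (Suc n) \<xi>) \<longlonglongrightarrow> inverse (A $ 2 $ 2 - A $ 2 $ 1 * \<xi>)"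
    unfolding inv_phi_Suc_eq[OF \<xi>] by (intro tendsto_inverse lim nz)
  then have "(\<lambda>n. inv_phi n \<xi>) \<longlonglongrightarrow> inverse (A $ 2 $ 2 - A $ 2 $ 1 * \<xi>)" by (rule LIMSEQ_imp_Suc)
  then show "convergent (Omega_prod g \<xi>) \<and> convergent (\<lambda>n. inv_phi n \<xi>) \<and> lim (\<lambda>n. inv_phi n \<xi>) \<noteq> 0"
    using c nz by (auto simp: convergent_def dest: limI)
qed

end

section \<open>Orthogonality and the Bernstein--Szego measures\<close>

context circle_finite_measure
begin

lemma integrable_continuous:
  fixes h :: "complex \<Rightarrow> 'a :: {banach, second_countable_topology}"
  assumes "continuous_on UNIV h" shows "integrable \<mu> h"
  by (intro integrable_continuous_circle borel_measurable_continuous_onI assms continuous_on_subset[OF assms]) simp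

lemma integral_cong_circle:
  fixes h :: "complex \<Rightarrow> 'a :: {banach, second_countable_topology}"
  assumes "continuous_on UNIV h" "continuous_on UNIV k" "\<And>\<xi>. cmod \<xi> = 1 \<Longrightarrow> h \<xi> = k \<xi>"
  shows "(LINT \<xi>|\<mu>. h \<xi>) = (LINT \<xi>|\<mu>. k \<xi>)"
proof (rule integral_cong_AE)
  show "h \<in> borel_measurable \<mu>" "k \<in> borel_measurable \<mu>"
    using borel_measurable_continuous_onI[OF assms(1)] borel_measurable_continuous_onI[OF assms(2)] by simp_all
  show "AE \<xi> in \<mu>. h \<xi> = k \<xi>" using AE_unit by eventually_elim (rule assms(3))
qed

definition ortho :: "nat \<Rightarrow> complex poly \<Rightarrow> bool" where
  "ortho n p \<longleftrightarrow> (\<forall>j<n. (LINT \<xi>|\<mu>. poly p \<xi> * cnj (\<xi> ^ j)) = 0)"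

lemma ortho_poly:
  assumes "ortho n p" "degree q < n"
  shows "(LINT \<xi>|\<mu>. poly p \<xi> * cnj (poly q \<xi>)) = 0"
proof -
  have "(LINT \<xi>|\<mu>. poly p \<xi> * cnj (poly q \<xi>))
     = (LINT \<xi>|\<mu>. (\<Sum>i\<le>degree q. cnj (coeff q i) * (poly p \<xi> * cnj (\<xi> ^ i))))"
    by (simp add: poly_altdef[of q] sum_distrib_left mult_ac)
  also have "\<dots> = (\<Sum>i\<le>degree q. (LINT \<xi>|\<mu>. cnj (coeff q i) * (poly p \<xi> * cnj (\<xi> ^ i))))"
    by (intro Bochner_Integration.integral_sum integrable_continuous continuous_intros)
  also have "\<dots> = 0"
    using assms by (intro sum.neutral ballI) (simp add: ortho_def integral_mult_right_zero)
  finally show ?thesis .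
qed

text \<open>
  Conjugation and multiplication by \<open>\<xi>\<^sup>n\<close> exchange the exponents \<open>j\<close> and \<open>n - j\<close>.
\<close>

lemma ortho_reversed:
  assumes p: "ortho n p" and q: "\<And>\<xi>. cmod \<xi> = 1 \<Longrightarrow> poly q \<xi> = \<xi> ^ n * cnj (poly p \<xi>)"
    and j: "1 \<le> j" "j \<le> n"
  shows "(LINT \<xi>|\<mu>. poly q \<xi> * cnj (\<xi> ^ j)) = 0"
proof -
  have "(LINT \<xi>|\<mu>. poly q \<xi> * cnj (\<xi> ^ j)) = (LINT \<xi>|\<mu>. cnj (poly p \<xi> * cnj (\<xi> ^ (n - j))))"
  proof (rule integral_cong_circle)
    fix \<xi> :: complex assume \<xi>: "cmod \<xi> = 1"
    note x = unit_mult_cnj[OF \<xi>]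
    have "\<xi> ^ n = \<xi> ^ (n - j) * \<xi> ^ j" using j by (simp flip: power_add)
    moreover have "\<xi> ^ j * cnj \<xi> ^ j = 1" using x by (simp flip: power_mult_distrib)
    ultimately show "poly q \<xi> * cnj (\<xi> ^ j) = cnj (poly p \<xi> * cnj (\<xi> ^ (n - j)))"
      unfolding q[OF \<xi>] by (simp add: mult_ac)
  qed (intro continuous_intros)+
  also have "\<dots> = cnj (LINT \<xi>|\<mu>. poly p \<xi> * cnj (\<xi> ^ (n - j)))"
    by (rule Bochner_Integration.integral_cnj)
  also have "\<dots> = 0" using p j by (simp add: ortho_def)
  finally show ?thesis .
qed

lemma ortho_shift:
  "(LINT \<xi>|\<mu>. poly ([:0, 1:] * p) \<xi> * cnj (\<xi> ^ Suc j)) = (LINT \<xi>|\<mu>. poly p \<xi> * cnj (\<xi> ^ j))"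
proof (rule integral_cong_circle)
  fix \<xi> :: complex assume \<xi>: "cmod \<xi> = 1"
  note x = unit_mult_cnj[OF \<xi>]
  have "poly ([:0, 1:] * p) \<xi> * cnj (\<xi> ^ Suc j) = (\<xi> * cnj \<xi>) * (poly p \<xi> * cnj (\<xi> ^ j))" by simp
  then show "poly ([:0, 1:] * p) \<xi> * cnj (\<xi> ^ Suc j) = poly p \<xi> * cnj (\<xi> ^ j)" unfolding x by simp
qed (intro continuous_intros)+

lemma integral_lin:
  "(LINT \<xi>|\<mu>. poly (smult a p + smult b q) \<xi> * cnj (\<xi> ^ j))
     = a * (LINT \<xi>|\<mu>. poly p \<xi> * cnj (\<xi> ^ j)) + b * (LINT \<xi>|\<mu>. poly q \<xi> * cnj (\<xi> ^ j))"
proof -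
  have "integrable \<mu> (\<lambda>\<xi>. poly r \<xi> * cnj (\<xi> ^ j))" for r
    by (intro integrable_continuous continuous_intros)
  moreover have "poly (smult a p + smult b q) \<xi> * cnj (\<xi> ^ j)
     = a * (poly p \<xi> * cnj (\<xi> ^ j)) + b * (poly q \<xi> * cnj (\<xi> ^ j))" for \<xi>
    by (simp add: algebra_simps)
  ultimately show ?thesis by simp
qed

end

locale szego_measure = szego_recursion g \<Phi> \<Psi> + circle_finite_measure \<mu>
  for g \<Phi> \<Psi> \<mu>
begin

text \<open>
  The inverse recursion
  \<open>(1 - \<bar>\<gamma>\<^sub>n\<bar>\<^sup>2) z \<Phi>\<^sub>n = \<Phi>\<^sub>n\<^sub>+\<^sub>1 + cnj \<gamma>\<^sub>n \<Psi>\<^sub>n\<^sub>+\<^sub>1\<close> passes orthogonality down. Hence for any measure the orthogonality of one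
  \<open>\<Phi>\<^sub>n\<close> gives that of all earlier ones.
\<close>

lemma ortho_descend:
  assumes "ortho (Suc n) (\<Phi> (Suc n))" shows "ortho n (\<Phi> n)"
  unfolding ortho_def
proof (intro allI impI)
  fix j assume j: "j < n"
  define c where "c = 1 - (g n) * cnj (g n)"
  have "c = of_real (1 - (cmod (g n))\<^sup>2)" by (simp add: c_def complex_norm_square del: of_real_power)
  then have c0: "c \<noteq> 0" using rho_sq[of n] rho_pos[of n] by (metis of_real_eq_0_iff power_not_zero less_irrefl)
  have e: "smult 1 (\<Phi> (Suc n)) + smult (cnj (g n)) (\<Psi> (Suc n)) = smult c ([:0, 1:] * \<Phi> n) + smult 0 0"
    by (simp add: \<Phi>_Suc \<Psi>_Suc c_def smult_diff_right smult_diff_left algebra_simps)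
  have "c * (LINT \<xi>|\<mu>. poly (\<Phi> n) \<xi> * cnj (\<xi> ^ j))
      = c * (LINT \<xi>|\<mu>. poly ([:0, 1:] * \<Phi> n) \<xi> * cnj (\<xi> ^ Suc j)) + 0 * (LINT \<xi>|\<mu>. poly 0 \<xi> * cnj (\<xi> ^ Suc j))"
    unfolding ortho_shift by simp
  also have "\<dots> = (LINT \<xi>|\<mu>. poly (smult 1 (\<Phi> (Suc n)) + smult (cnj (g n)) (\<Psi> (Suc n))) \<xi> * cnj (\<xi> ^ Suc j))"
    unfolding e by (rule integral_lin[symmetric])
  also have "\<dots> = 1 * (LINT \<xi>|\<mu>. poly (\<Phi> (Suc n)) \<xi> * cnj (\<xi> ^ Suc j)) + cnj (g n) * (LINT \<xi>|\<mu>. poly (\<Psi> (Suc n)) \<xi> * cnj (\<xi> ^ Suc j))"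
    by (rule integral_lin)
  also have "\<dots> = 0"
  proof -
    have "(LINT \<xi>|\<mu>. poly (\<Phi> (Suc n)) \<xi> * cnj (\<xi> ^ Suc j)) = 0"
      using assms j unfolding ortho_def by (meson Suc_mono)
    moreover have "(LINT \<xi>|\<mu>. poly (\<Psi> (Suc n)) \<xi> * cnj (\<xi> ^ Suc j)) = 0"
      by (rule ortho_reversed[OF assms \<Psi>_circle]) (use j in auto)
    ultimately show ?thesis by (simp only: mult_zero_right add_0)
  qed
  finally show "(LINT \<xi>|\<mu>. poly (\<Phi> n) \<xi> * cnj (\<xi> ^ j)) = 0" using c0 by simp
qed

text \<open>
  Pythagoras for \<open>z \<Phi>\<^sub>n = \<Phi>\<^sub>n\<^sub>+\<^sub>1 + cnj \<gamma>\<^sub>n \<Psi>\<^sub>n\<close>: the two summands are orthogonal because \<open>\<Psi>\<^sub>n\<close> has degree at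
  most \<open>n\<close>.
\<close>

lemma norm_descend:
  assumes "ortho (Suc n) (\<Phi> (Suc n))"
  shows "(LINT \<xi>|\<mu>. (cmod (poly (\<Phi> (Suc n)) \<xi>))\<^sup>2) = (rho g n)\<^sup>2 * (LINT \<xi>|\<mu>. (cmod (poly (\<Phi> n) \<xi>))\<^sup>2)"
proof -
  let ?p = "poly (\<Phi> (Suc n))" and ?q = "poly (\<Psi> n)"
  have e: "(cmod (poly (\<Phi> n) \<xi>))\<^sup>2 = (cmod (?p \<xi>))\<^sup>2 + (cmod (g n))\<^sup>2 * (cmod (poly (\<Phi> n) \<xi>))\<^sup>2
      + 2 * Re (g n * (?p \<xi> * cnj (?q \<xi>)))" if \<xi>: "cmod \<xi> = 1" for \<xi>
  proof -
    have sq: "(cmod (a + b))\<^sup>2 = (cmod a)\<^sup>2 + (cmod b)\<^sup>2 + 2 * Re (a * cnj b)" for a b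
      unfolding cmod_power2 by (simp add: power2_eq_square algebra_simps)
    have "cmod (poly (\<Phi> n) \<xi>) = cmod (\<xi> * poly (\<Phi> n) \<xi>)" using \<xi> by (simp add: norm_mult)
    also have "\<xi> * poly (\<Phi> n) \<xi> = ?p \<xi> + cnj (g n) * ?q \<xi>" by (simp add: poly_\<Phi>_Suc)
    finally show ?thesis
      using sq[of "?p \<xi>" "cnj (g n) * ?q \<xi>"] norm_\<Psi>_circle[OF \<xi>, of n]
      by (simp add: norm_mult power_mult_distrib mult_ac)
  qed
  have i: "integrable \<mu> (\<lambda>\<xi>. (cmod (poly r \<xi>))\<^sup>2)" for r
    by (intro integrable_continuous continuous_intros)
  have i2: "integrable \<mu> (\<lambda>\<xi>. ?p \<xi> * cnj (?q \<xi>))"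
    by (intro integrable_continuous continuous_intros)
  have z: "(LINT \<xi>|\<mu>. ?p \<xi> * cnj (?q \<xi>)) = 0"
    by (rule ortho_poly[OF assms]) (use degree_bounds[of n] in auto)
  have "(LINT \<xi>|\<mu>. (cmod (poly (\<Phi> n) \<xi>))\<^sup>2) = (LINT \<xi>|\<mu>. (cmod (?p \<xi>))\<^sup>2 + (cmod (g n))\<^sup>2 * (cmod (poly (\<Phi> n) \<xi>))\<^sup>2
      + 2 * Re (g n * (?p \<xi> * cnj (?q \<xi>))))"
    by (intro integral_cong_circle continuous_intros e)
  also have "\<dots> = (LINT \<xi>|\<mu>. (cmod (?p \<xi>))\<^sup>2) + (cmod (g n))\<^sup>2 * (LINT \<xi>|\<mu>. (cmod (poly (\<Phi> n) \<xi>))\<^sup>2)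
      + 2 * Re (LINT \<xi>|\<mu>. g n * (?p \<xi> * cnj (?q \<xi>)))"
  proof -
    have "(LINT \<xi>|\<mu>. A \<xi> + c * B \<xi> + 2 * Re (C \<xi>)) = (LINT \<xi>|\<mu>. A \<xi>) + c * (LINT \<xi>|\<mu>. B \<xi>) + 2 * Re (LINT \<xi>|\<mu>. C \<xi>)"
      if "integrable \<mu> A" "integrable \<mu> B" "integrable \<mu> C" for A B :: "complex \<Rightarrow> real" and C c
      using that by simp
    from this[OF i i integrable_mult_right[OF i2]] show ?thesis .
  qed
  also have "(LINT \<xi>|\<mu>. g n * (?p \<xi> * cnj (?q \<xi>))) = 0"
    using z i2 by simp
  finally show ?thesis by (simp add: rho_sq algebra_simps)
qed

lemma norm_eq:
  assumes "ortho n (\<Phi> n)"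
  shows "(LINT \<xi>|\<mu>. (cmod (poly (\<Phi> n) \<xi>))\<^sup>2) = (Phi_norm n)\<^sup>2 * measure \<mu> UNIV"
  using assms
proof (induction n)
  case 0
  show ?case by (simp add: \<Phi>_0 Phi_norm_def space_\<mu>)
next
  case (Suc n)
  then show ?case using ortho_descend norm_descend by (simp add: Phi_norm_Suc power_mult_distrib)
qed

lemma ortho_le: "ortho n (\<Phi> n) \<Longrightarrow> k \<le> n \<Longrightarrow> ortho k (\<Phi> k)"
  by (induction n) (auto simp: le_Suc_eq intro: ortho_descend)

lemma integral_\<Phi>: "ortho n (\<Phi> n) \<Longrightarrow> n > 0 \<Longrightarrow> (LINT \<xi>|\<mu>. poly (\<Phi> n) \<xi>) = 0"
  by (auto simp: ortho_def dest!: spec[of _ 0])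

end

context szego_recursion begin

text \<open>
  The Bernstein--Szego measure \<open>\<bar>\<phi>\<^sub>n\<bar>\<^bsup>-2\<^esup> dm\<close>.
\<close>

definition bs_measure :: "nat \<Rightarrow> complex measure" where
  "bs_measure n = density circle_measure (\<lambda>\<xi>. ennreal ((cmod (inv_phi n \<xi>))\<^sup>2))"

lemma bs_integrable: "integrable circle_measure (\<lambda>\<xi>. (cmod (inv_phi n \<xi>))\<^sup>2)"
  by (rule integrable_circle_continuous)
     (auto intro!: continuous_intros continuous_on_subset[OF continuous_inv_phi])

lemma bs_circle_finite_measure: "circle_finite_measure (bs_measure n)"
proof -
  have "finite_measure (bs_measure n)"
  proof
    have "emeasure (bs_measure n) (space (bs_measure n)) = (\<integral>\<^sup>+ \<xi>. ennreal ((cmod (inv_phi n \<xi>))\<^sup>2) \<partial>circle_measure)"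
      by (simp add: bs_measure_def emeasure_density)
    also have "\<dots> < \<infinity>" using bs_integrable[of n] by (simp add: integrable_iff_bounded)
    finally show "emeasure (bs_measure n) (space (bs_measure n)) \<noteq> \<infinity>" by simp
  qed
  moreover have "circle_finite_measure_axioms (bs_measure n)"
  proof
    show "AE \<xi> in bs_measure n. cmod \<xi> = 1"
      unfolding bs_measure_def by (subst AE_density) (use AE_circle_norm in \<open>auto elim!: eventually_mono\<close>)
  qed (simp add: bs_measure_def)
  ultimately show ?thesis by (rule circle_finite_measure.intro)
qed

lemma integral_bs:
  fixes h :: "complex \<Rightarrow> 'a :: {banach, second_countable_topology}"
  assumes [measurable]: "h \<in> borel_measurable borel"
  shows "(LINT \<xi>|bs_measure n. h \<xi>) = (LINT \<xi>|circle_measure. (cmod (inv_phi n \<xi>))\<^sup>2 *\<^sub>R h \<xi>)"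
  unfolding bs_measure_def by (rule integral_density) auto

lemma bs_szego_measure: "szego_measure g \<Phi> \<Psi> (bs_measure n)"
  by (intro szego_measure.intro bs_circle_finite_measure szego_recursion_axioms)

lemma inv_phi_sq_circle: assumes "cmod \<xi> = 1" shows "(cmod (inv_phi n \<xi>))\<^sup>2 * (cmod (poly (\<Phi> n) \<xi>))\<^sup>2 = (Phi_norm n)\<^sup>2"
  using \<Psi>_nonzero[of \<xi> n] assms norm_\<Psi>_circle[OF assms, of n] Phi_norm_pos[of n]
  by (auto simp: inv_phi_def norm_divide power_divide)

text \<open>
  On the circle \<open>\<bar>f\<bar>\<^sup>2 \<Phi>\<^sub>n cnj \<xi>\<^sup>j\<close> is, up to a constant, \<open>\<xi>\<^bsup>n-j\<^esup> f\<close> with \<open>f = 1 / \<phi>\<^sub>n\<^sup>*\<close>. This is holomorphic in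
  the disc and vanishes at \<open>0\<close> when \<open>j < n\<close>.
\<close>

lemma bs_ortho: "circle_finite_measure.ortho (bs_measure n) n (\<Phi> n)"
proof -
  interpret B: szego_measure g \<Phi> \<Psi> "bs_measure n" by (rule bs_szego_measure)
  show ?thesis
    unfolding B.ortho_def
  proof (intro allI impI)
    fix j assume j: "j < n"
    let ?h = "\<lambda>\<xi>. of_real (Phi_norm n) * (\<xi> ^ (n - j) * inv_phi n \<xi>)"
    have "(LINT \<xi>|bs_measure n. poly (\<Phi> n) \<xi> * cnj (\<xi> ^ j)) = (LINT \<xi>|circle_measure. (cmod (inv_phi n \<xi>))\<^sup>2 *\<^sub>R (poly (\<Phi> n) \<xi> * cnj (\<xi> ^ j)))"
      by (rule integral_bs) simp
    also have "\<dots> = (LINT \<xi>|circle_measure. ?h \<xi>)"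
    proof (rule integral_cong_AE)
      show "AE \<xi> in circle_measure. (cmod (inv_phi n \<xi>))\<^sup>2 *\<^sub>R (poly (\<Phi> n) \<xi> * cnj (\<xi> ^ j)) = ?h \<xi>"
        using AE_circle_norm
      proof eventually_elim
        fix \<xi> :: complex assume \<xi>: "cmod \<xi> = 1"
        note x = unit_mult_cnj[OF \<xi>]
        then have xj: "\<xi> ^ j * cnj \<xi> ^ j = 1" "\<xi> ^ n * cnj \<xi> ^ n = 1" by (simp_all flip: power_mult_distrib)
        have nj: "\<xi> ^ n = \<xi> ^ (n - j) * \<xi> ^ j" using j by (simp flip: power_add)
        have pc: "cnj (poly (\<Psi> n) \<xi>) = cnj \<xi> ^ n * poly (\<Phi> n) \<xi>" using \<Psi>_circle[OF \<xi>, of n] by simp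
        then have P: "poly (\<Phi> n) \<xi> = \<xi> ^ n * cnj (poly (\<Psi> n) \<xi>)"
          using xj(2) by (simp add: mult.assoc[symmetric])
        have nz: "cnj (poly (\<Psi> n) \<xi>) \<noteq> 0" "poly (\<Psi> n) \<xi> \<noteq> 0" using \<Psi>_nonzero[of \<xi> n] \<xi> by auto
        have "(cmod (inv_phi n \<xi>))\<^sup>2 *\<^sub>R (poly (\<Phi> n) \<xi> * cnj (\<xi> ^ j))
            = (inv_phi n \<xi> * cnj (inv_phi n \<xi>)) * (poly (\<Phi> n) \<xi> * cnj \<xi> ^ j)"
          unfolding scaleR_conv_of_real complex_norm_square by simp
        also have "\<dots> = (inv_phi n \<xi> * of_real (Phi_norm n) / cnj (poly (\<Psi> n) \<xi>)) * ((\<xi> ^ n * cnj (poly (\<Psi> n) \<xi>)) * cnj \<xi> ^ j)"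
          unfolding P by (simp add: inv_phi_def)
        also have "\<dots> = inv_phi n \<xi> * of_real (Phi_norm n) * (\<xi> ^ n * cnj \<xi> ^ j)" using nz by simp
        also have "\<xi> ^ n * cnj \<xi> ^ j = \<xi> ^ (n - j)" unfolding nj using xj(1) by (simp add: mult.assoc)
        finally show "(cmod (inv_phi n \<xi>))\<^sup>2 *\<^sub>R (poly (\<Phi> n) \<xi> * cnj (\<xi> ^ j)) = ?h \<xi>" by (simp add: mult_ac)
      qed
    qed auto
    also have "\<dots> = ?h 0"
      by (rule mean_value_circle)
         (auto intro!: continuous_intros continuous_inv_phi holomorphic_intros holomorphic_inv_phi)
    also have "\<dots> = 0" using j by simp
    finally show "(LINT \<xi>|bs_measure n. poly (\<Phi> n) \<xi> * cnj (\<xi> ^ j)) = 0" .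
  qed
qed

lemma bs_mass: "measure (bs_measure n) UNIV = 1"
proof -
  interpret B: szego_measure g \<Phi> \<Psi> "bs_measure n" by (rule bs_szego_measure)
  have "(Phi_norm n)\<^sup>2 * measure (bs_measure n) UNIV = (LINT \<xi>|bs_measure n. (cmod (poly (\<Phi> n) \<xi>))\<^sup>2)"
    by (rule B.norm_eq[OF bs_ortho, symmetric])
  also have "\<dots> = (LINT \<xi>|circle_measure. (cmod (inv_phi n \<xi>))\<^sup>2 *\<^sub>R (cmod (poly (\<Phi> n) \<xi>))\<^sup>2)"
    by (rule integral_bs) simp
  also have "\<dots> = (LINT \<xi>|circle_measure. (Phi_norm n)\<^sup>2)"
  proof (rule integral_cong_AE)
    show "AE \<xi> in circle_measure. (cmod (inv_phi n \<xi>))\<^sup>2 *\<^sub>R (cmod (poly (\<Phi> n) \<xi>))\<^sup>2 = (Phi_norm n)\<^sup>2"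
      using AE_circle_norm by eventually_elim (simp add: inv_phi_sq_circle)
  qed auto
  also have "\<dots> = (Phi_norm n)\<^sup>2" using circle.prob_space by simp
  finally show ?thesis using Phi_norm_pos[of n] by simp
qed

lemma bs_sq_integral: "(LINT \<xi>|circle_measure. (cmod (inv_phi n \<xi>))\<^sup>2) = 1"
proof -
  have "(LINT \<xi>|bs_measure n. (1::real)) = 1"
    using bs_mass[of n] by (simp add: bs_measure_def)
  moreover have "(LINT \<xi>|bs_measure n. (1::real)) = (LINT \<xi>|circle_measure. (cmod (inv_phi n \<xi>))\<^sup>2 *\<^sub>R 1)"
    by (rule integral_bs) simp
  ultimately show ?thesis by simp
qed

end

locale szego_prob = szego_measure g \<Phi> \<Psi> \<sigma> + prob_space \<sigma>
  for g \<Phi> \<Psi> \<sigma> +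
  assumes all_ortho: "\<And>n. ortho n (\<Phi> n)"
begin

text \<open>
  Both measures have total mass \<open>1\<close> and integrate \<open>\<Phi>\<^sub>1, \<dots>, \<Phi>\<^sub>n\<close> to \<open>0\<close>, and these polynomials together
  with the constants span the polynomials of degree at most \<open>n\<close>.
\<close>

lemma bernstein_szego:
  "degree p \<le> n \<Longrightarrow> (LINT \<xi>|bs_measure n. poly p \<xi>) = (LINT \<xi>|\<sigma>. poly p \<xi>)"
proof (induction "degree p" arbitrary: p rule: less_induct)
  case less
  interpret B: szego_measure g \<Phi> \<Psi> "bs_measure n" by (rule bs_szego_measure)
  note sp = space_\<mu> B.space_\<mu>
  show ?case
  proof (cases "degree p = 0")
    case True
    then obtain c where "p = [:c:]" using degree_eq_zeroE by blast
    then have p: "poly p = (\<lambda>_. c)" by auto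
    show ?thesis unfolding p using bs_mass[of n] prob_space sp by simp
  next
    case False
    define d where "d = degree p"
    define q where "q = p - smult (lead_coeff p) (\<Phi> d)"
    have dq: "degree q < d"
    proof -
      have "degree q \<le> d" unfolding q_def using degree_bounds[of d]
        by (intro degree_diff_le) (auto simp: d_def intro: order.trans[OF degree_smult_le])
      moreover have "coeff (\<Phi> d) d = 1" using degree_bounds[of d] by metis
      then have "coeff q d = 0" by (simp add: q_def d_def)
      ultimately show ?thesis using False by (metis d_def eq_zero_or_degree_less degree_0 gr0I)
    qed
    have pq: "poly p \<xi> = poly q \<xi> + lead_coeff p * poly (\<Phi> d) \<xi>" for \<xi> by (simp add: q_def)
    have i: "integrable \<sigma> (\<lambda>\<xi>. poly r \<xi>)" "integrable (bs_measure n) (\<lambda>\<xi>. poly r \<xi>)" for r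
      by (intro integrable_continuous B.integrable_continuous continuous_intros)+
    have "d > 0" "d \<le> n" using False less.prems by (auto simp: d_def)
    then have "(LINT \<xi>|bs_measure n. poly (\<Phi> d) \<xi>) = 0" "(LINT \<xi>|\<sigma>. poly (\<Phi> d) \<xi>) = 0"
      using integral_\<Phi>[OF all_ortho] B.integral_\<Phi>[OF B.ortho_le[OF bs_ortho]] by auto
    moreover have "(LINT \<xi>|bs_measure n. poly q \<xi>) = (LINT \<xi>|\<sigma>. poly q \<xi>)"
      by (rule less.hyps) (use dq \<open>d \<le> n\<close> in \<open>auto simp: d_def\<close>)
    ultimately show ?thesis unfolding pq using i by simp
  qed
qed

lemma norm_\<Phi>: "(LINT \<xi>|\<sigma>. (cmod (poly (\<Phi> n) \<xi>))\<^sup>2) = (Phi_norm n)\<^sup>2"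
  using norm_eq[OF all_ortho] prob_space by (simp add: space_\<mu>)

end

section \<open>The absolutely continuous part of the measure of orthogonality\<close>

text \<open>
  A real polynomial in \<open>Re \<xi>\<close> and \<open>Im \<xi>\<close> is a trigonometric polynomial on the circle, here written with
  all negative powers collected in one factor.
\<close>

lemma real_polynomial_on_circle:
  fixes h :: "complex \<Rightarrow> real"
  assumes "real_polynomial_function h"
  shows "\<exists>N p. \<forall>\<xi>. cmod \<xi> = 1 \<longrightarrow> of_real (h \<xi>) = cnj \<xi> ^ N * poly p \<xi>"
  using assms
proof induction
  case (linear h)
  show ?case
  proof (intro exI allI impI)
    fix \<xi> :: complex assume \<xi>: "cmod \<xi> = 1"
    note x = unit_mult_cnj[OF \<xi>]
    have "\<xi> = Re \<xi> *\<^sub>R 1 + Im \<xi> *\<^sub>R \<i>" by (simp add: complex_eq_iff)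
    then have "h \<xi> = h (Re \<xi> *\<^sub>R 1 + Im \<xi> *\<^sub>R \<i>)" by (rule arg_cong)
    also have "\<dots> = Re \<xi> * h 1 + Im \<xi> * h \<i>"
      using linear by (simp add: linear_add linear_scale bounded_linear.linear)
    finally have "of_real (h \<xi>) = of_real (Re \<xi>) * of_real (h 1) + of_real (Im \<xi>) * complex_of_real (h \<i>)" by simp
    also have "of_real (Re \<xi>) = (\<xi> + cnj \<xi>) / 2" by (simp add: complex_add_cnj)
    also have "of_real (Im \<xi>) = - \<i> * (\<xi> - cnj \<xi>) / 2" by (simp add: complex_eq_iff)
    \<comment> \<open>a factor \<open>\<xi> cnj \<xi> = 1\<close> is inserted so that \<open>cnj \<xi>\<close> can be taken out\<close>
    also have "(\<xi> + cnj \<xi>) / 2 * of_real (h 1) + - \<i> * (\<xi> - cnj \<xi>) / 2 * complex_of_real (h \<i>)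
       = (\<xi> * (\<xi> * cnj \<xi>) + cnj \<xi>) / 2 * of_real (h 1) + - \<i> * (\<xi> * (\<xi> * cnj \<xi>) - cnj \<xi>) / 2 * complex_of_real (h \<i>)"
      unfolding x by simp
    also have "\<dots> = cnj \<xi> ^ 1 * poly [:of_real (h 1) / 2 + \<i> * of_real (h \<i>) / 2, 0, of_real (h 1) / 2 - \<i> * of_real (h \<i>) / 2:] \<xi>"
      by (simp add: field_simps)
    finally show "of_real (h \<xi>) = cnj \<xi> ^ 1 * poly [:of_real (h 1) / 2 + \<i> * of_real (h \<i>) / 2, 0, of_real (h 1) / 2 - \<i> * of_real (h \<i>) / 2:] \<xi>" .
  qed
next
  case (const c)
  show ?case by (intro exI[of _ 0] exI[of _ "[:of_real c:]"]) simp
next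
  case (add h k)
  then obtain N p M q where
    h: "\<And>\<xi>. cmod \<xi> = 1 \<Longrightarrow> of_real (h \<xi>) = cnj \<xi> ^ N * poly p \<xi>" and
    k: "\<And>\<xi>. cmod \<xi> = 1 \<Longrightarrow> of_real (k \<xi>) = cnj \<xi> ^ M * poly q \<xi>" by metis
  show ?case
  proof (intro exI allI impI)
    fix \<xi> :: complex assume \<xi>: "cmod \<xi> = 1"
    note x = unit_mult_cnj[OF \<xi>]
    then have x1: "\<xi> ^ M * cnj \<xi> ^ M = 1" "\<xi> ^ N * cnj \<xi> ^ N = 1" by (simp_all flip: power_mult_distrib)
    have "of_real (h \<xi> + k \<xi>) = (\<xi> ^ M * cnj \<xi> ^ M) * (cnj \<xi> ^ N * poly p \<xi>) + (\<xi> ^ N * cnj \<xi> ^ N) * (cnj \<xi> ^ M * poly q \<xi>)"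
      unfolding x1 using h[OF \<xi>] k[OF \<xi>] by simp
    also have "\<dots> = cnj \<xi> ^ (N + M) * poly (monom 1 M * p + monom 1 N * q) \<xi>"
      by (simp add: poly_monom power_add algebra_simps)
    finally show "of_real (h \<xi> + k \<xi>) = cnj \<xi> ^ (N + M) * poly (monom 1 M * p + monom 1 N * q) \<xi>" .
  qed
next
  case (mult h k)
  then obtain N p M q where
    h: "\<And>\<xi>. cmod \<xi> = 1 \<Longrightarrow> of_real (h \<xi>) = cnj \<xi> ^ N * poly p \<xi>" and
    k: "\<And>\<xi>. cmod \<xi> = 1 \<Longrightarrow> of_real (k \<xi>) = cnj \<xi> ^ M * poly q \<xi>" by metis
  show ?case
    by (intro exI[of _ "N + M"] exI[of _ "p * q"]) (simp add: h k power_add)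
qed

lemma (in circle_finite_measure) monomial_integral:
  "(LINT \<xi>|\<mu>. cnj \<xi> ^ N * \<xi> ^ i) =
     (if N \<le> i then LINT \<xi>|\<mu>. \<xi> ^ (i - N) else cnj (LINT \<xi>|\<mu>. \<xi> ^ (N - i)))"
proof -
  have "(LINT \<xi>|\<mu>. cnj \<xi> ^ N * \<xi> ^ i) = (LINT \<xi>|\<mu>. (if N \<le> i then \<xi> ^ (i - N) else cnj (\<xi> ^ (N - i))))"
  proof (rule integral_cong_circle)
    fix \<xi> :: complex assume \<xi>: "cmod \<xi> = 1"
    note x = unit_mult_cnj[OF \<xi>]
    then have x1: "\<And>j. cnj \<xi> ^ j * \<xi> ^ j = 1" by (simp flip: power_mult_distrib add: mult.commute)
    show "cnj \<xi> ^ N * \<xi> ^ i = (if N \<le> i then \<xi> ^ (i - N) else cnj (\<xi> ^ (N - i)))"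
    proof (cases "N \<le> i")
      case True
      then have "\<xi> ^ i = \<xi> ^ N * \<xi> ^ (i - N)" by (simp flip: power_add)
      then show ?thesis using True x1[of N] by (simp flip: mult.assoc)
    next
      case False
      then have "cnj \<xi> ^ N = cnj \<xi> ^ (N - i) * cnj \<xi> ^ i" by (simp flip: power_add)
      then show ?thesis using False x1[of i] by (simp add: mult.assoc)
    qed
  qed (cases "N \<le> i"; auto intro!: continuous_intros)+
  also have "\<dots> = (if N \<le> i then LINT \<xi>|\<mu>. \<xi> ^ (i - N) else cnj (LINT \<xi>|\<mu>. \<xi> ^ (N - i)))"
    by (cases "N \<le> i") (simp_all del: complex_cnj_power)
  finally show ?thesis .
qed

context szego_prob begin

lemma bs_polynomial_eq:
  assumes "real_polynomial_function h"
  shows "\<forall>\<^sub>F n in sequentially. (LINT \<xi>|bs_measure n. h \<xi>) = (LINT \<xi>|\<sigma>. h \<xi>)"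
proof -
  obtain N p where p: "\<And>\<xi>. cmod \<xi> = 1 \<Longrightarrow> of_real (h \<xi>) = cnj \<xi> ^ N * poly p \<xi>"
    using real_polynomial_on_circle[OF assms] by blast
  have ch: "continuous_on UNIV h"
    by (rule continuous_on_polymonial_function) (use assms in \<open>simp add: real_polynomial_function_eq\<close>)
  have ch': "continuous_on UNIV (\<lambda>\<xi>. complex_of_real (h \<xi>))" by (intro continuous_intros ch)
  have "(LINT \<xi>|bs_measure n. h \<xi>) = (LINT \<xi>|\<sigma>. h \<xi>)" if n: "n \<ge> max N (degree p)" for n
  proof -
    interpret B: szego_measure g \<Phi> \<Psi> "bs_measure n" by (rule bs_szego_measure)
    have cc: "continuous_on UNIV (\<lambda>\<xi>. cnj \<xi> ^ N * poly p \<xi>)" by (intro continuous_intros)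
    have mono: "(LINT \<xi>|bs_measure n. \<xi> ^ k) = (LINT \<xi>|\<sigma>. \<xi> ^ k)" if "k \<le> n" for k
      using bernstein_szego[of "monom 1 k" n] that by (simp add: poly_monom degree_monom_eq)
    have exp: "(LINT \<xi>|\<nu>. cnj \<xi> ^ N * poly p \<xi>) = (\<Sum>i\<le>degree p. coeff p i * (LINT \<xi>|\<nu>. cnj \<xi> ^ N * \<xi> ^ i))"
      if "circle_finite_measure \<nu>" for \<nu>
    proof -
      interpret V: circle_finite_measure \<nu> by fact
      have "(LINT \<xi>|\<nu>. cnj \<xi> ^ N * poly p \<xi>) = (LINT \<xi>|\<nu>. (\<Sum>i\<le>degree p. coeff p i * (cnj \<xi> ^ N * \<xi> ^ i)))"
        by (simp add: poly_altdef sum_distrib_left mult_ac)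
      also have "\<dots> = (\<Sum>i\<le>degree p. LINT \<xi>|\<nu>. coeff p i * (cnj \<xi> ^ N * \<xi> ^ i))"
        by (intro Bochner_Integration.integral_sum V.integrable_continuous continuous_intros)
      finally show ?thesis by simp
    qed
    have "of_real (LINT \<xi>|bs_measure n. h \<xi>) = (LINT \<xi>|bs_measure n. complex_of_real (h \<xi>))"
      by (rule integral_of_real[symmetric]) (rule B.integrable_continuous[OF ch])
    also have "\<dots> = (LINT \<xi>|bs_measure n. cnj \<xi> ^ N * poly p \<xi>)"
      by (rule B.integral_cong_circle[OF ch' cc p])
    also have "\<dots> = (LINT \<xi>|\<sigma>. cnj \<xi> ^ N * poly p \<xi>)"
      unfolding exp[OF B.circle_finite_measure_axioms] exp[OF circle_finite_measure_axioms]
    proof (intro sum.cong refl arg_cong2[where f="(*)"])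
      fix i assume "i \<in> {..degree p}"
      then have "(LINT \<xi>|bs_measure n. \<xi> ^ (i - N)) = (LINT \<xi>|\<sigma>. \<xi> ^ (i - N))"
        "(LINT \<xi>|bs_measure n. \<xi> ^ (N - i)) = (LINT \<xi>|\<sigma>. \<xi> ^ (N - i))"
        using n by (auto intro!: mono)
      then show "(LINT \<xi>|bs_measure n. cnj \<xi> ^ N * \<xi> ^ i) = (LINT \<xi>|\<sigma>. cnj \<xi> ^ N * \<xi> ^ i)"
        unfolding B.monomial_integral monomial_integral by simp
    qed
    also have "\<dots> = (LINT \<xi>|\<sigma>. complex_of_real (h \<xi>))"
      by (rule integral_cong_circle[OF ch' cc p, symmetric])
    also have "\<dots> = of_real (LINT \<xi>|\<sigma>. h \<xi>)" by (rule integral_of_real) (rule integrable_continuous[OF ch])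
    finally show ?thesis using of_real_eq_iff by blast
  qed
  then show ?thesis unfolding eventually_sequentially by (intro exI allI impI)
qed

text \<open>
  Trigonometric polynomials, on which the integrals agree from some \<open>n\<close> on, are uniformly dense in the
  continuous functions on the circle, and all the measures have mass \<open>1\<close>.
\<close>

lemma bs_weak_convergence:
  fixes h :: "complex \<Rightarrow> real"
  assumes h: "continuous_on UNIV h"
  shows "(\<lambda>n. LINT \<xi>|bs_measure n. h \<xi>) \<longlonglongrightarrow> (LINT \<xi>|\<sigma>. h \<xi>)"
proof (rule tendstoI)
  fix e :: real assume e: "e > 0"
  obtain k where k: "real_polynomial_function k" "\<And>\<xi>. \<xi> \<in> sphere 0 1 \<Longrightarrow> \<bar>h \<xi> - k \<xi>\<bar> < e / 3"
    by (rule Stone_Weierstrass_real_polynomial_function[of "sphere 0 1" h "e/3"])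
       (use e in \<open>auto intro: continuous_on_subset[OF h]\<close>)
  have ck: "continuous_on UNIV k"
    by (rule continuous_on_polymonial_function) (use k(1) in \<open>simp add: real_polynomial_function_eq\<close>)
  have close: "\<bar>(LINT \<xi>|\<nu>. h \<xi>) - (LINT \<xi>|\<nu>. k \<xi>)\<bar> \<le> e / 3"
    if "circle_finite_measure \<nu>" "measure \<nu> UNIV = 1" for \<nu>
  proof -
    interpret V: circle_finite_measure \<nu> by fact
    have i: "integrable \<nu> h" "integrable \<nu> k" by (intro V.integrable_continuous h ck)+
    have "\<bar>(LINT \<xi>|\<nu>. h \<xi>) - (LINT \<xi>|\<nu>. k \<xi>)\<bar> = \<bar>LINT \<xi>|\<nu>. h \<xi> - k \<xi>\<bar>" using i by simp
    also have "\<dots> \<le> (LINT \<xi>|\<nu>. \<bar>h \<xi> - k \<xi>\<bar>)" using integral_norm_bound[of \<nu> "\<lambda>\<xi>. h \<xi> - k \<xi>"] by simp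
    also have "\<dots> \<le> (LINT \<xi>|\<nu>. e / 3)"
    proof (rule integral_mono_AE)
      show "AE \<xi> in \<nu>. \<bar>h \<xi> - k \<xi>\<bar> \<le> e / 3"
        using V.AE_unit by eventually_elim (use k(2) in \<open>auto intro: less_imp_le\<close>)
    qed (use i in auto)
    also have "\<dots> = e / 3" using that(2) V.space_\<mu> by simp
    finally show ?thesis .
  qed
  show "\<forall>\<^sub>F n in sequentially. dist (LINT \<xi>|bs_measure n. h \<xi>) (LINT \<xi>|\<sigma>. h \<xi>) < e"
    using bs_polynomial_eq[OF k(1)]
  proof eventually_elim
    fix n assume eq: "(LINT \<xi>|bs_measure n. k \<xi>) = (LINT \<xi>|\<sigma>. k \<xi>)"
    have a: "\<bar>(LINT \<xi>|bs_measure n. h \<xi>) - (LINT \<xi>|bs_measure n. k \<xi>)\<bar> \<le> e / 3"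
      by (rule close[OF bs_circle_finite_measure bs_mass])
    have b: "\<bar>(LINT \<xi>|\<sigma>. h \<xi>) - (LINT \<xi>|\<sigma>. k \<xi>)\<bar> \<le> e / 3"
      by (rule close[OF circle_finite_measure_axioms]) (use prob_space space_\<mu> in simp)
    show "dist (LINT \<xi>|bs_measure n. h \<xi>) (LINT \<xi>|\<sigma>. h \<xi>) < e"
      using a b e unfolding eq dist_real_def by linarith
  qed
qed

text \<open>
  Fatou's lemma for \<open>h \<bar>f\<^sub>n\<bar>\<^sup>2\<close> with \<open>f\<^sub>n = 1 / \<phi>\<^sub>n\<^sup>*\<close>, whose integrals tend to the integral of \<open>h\<close> against \<open>\<sigma>\<close>.
\<close>

lemma limit_density_le_continuous:
  fixes h :: "complex \<Rightarrow> real"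
  assumes [measurable]: "G \<in> borel_measurable borel" and lim: "AE \<xi> in circle_measure. (\<lambda>n. inv_phi n \<xi>) \<longlonglongrightarrow> G \<xi>"
    and h: "continuous_on UNIV h" "\<And>\<xi>. 0 \<le> h \<xi>"
  shows "(\<integral>\<^sup>+ \<xi>. ennreal (h \<xi> * (cmod (G \<xi>))\<^sup>2) \<partial>circle_measure) \<le> (\<integral>\<^sup>+ \<xi>. ennreal (h \<xi>) \<partial>\<sigma>)"
proof -
  have [measurable]: "h \<in> borel_measurable borel" by (rule borel_measurable_continuous_onI[OF h(1)])
  have "(\<integral>\<^sup>+ \<xi>. ennreal (h \<xi> * (cmod (G \<xi>))\<^sup>2) \<partial>circle_measure)
     = (\<integral>\<^sup>+ \<xi>. liminf (\<lambda>n. ennreal (h \<xi> * (cmod (inv_phi n \<xi>))\<^sup>2)) \<partial>circle_measure)"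
  proof (rule nn_integral_cong_AE)
    show "AE \<xi> in circle_measure. ennreal (h \<xi> * (cmod (G \<xi>))\<^sup>2) = liminf (\<lambda>n. ennreal (h \<xi> * (cmod (inv_phi n \<xi>))\<^sup>2))"
      using lim
      by eventually_elim (intro lim_imp_Liminf[symmetric] tendsto_ennrealI tendsto_intros, auto)
  qed
  also have "\<dots> \<le> liminf (\<lambda>n. \<integral>\<^sup>+ \<xi>. ennreal (h \<xi> * (cmod (inv_phi n \<xi>))\<^sup>2) \<partial>circle_measure)"
    by (rule nn_integral_liminf) simp
  also have "(\<lambda>n. \<integral>\<^sup>+ \<xi>. ennreal (h \<xi> * (cmod (inv_phi n \<xi>))\<^sup>2) \<partial>circle_measure) = (\<lambda>n. ennreal (LINT \<xi>|bs_measure n. h \<xi>))"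
  proof
    fix n
    have "(LINT \<xi>|bs_measure n. h \<xi>) = (LINT \<xi>|circle_measure. (cmod (inv_phi n \<xi>))\<^sup>2 *\<^sub>R h \<xi>)"
      by (rule integral_bs) simp
    also have "ennreal \<dots> = (\<integral>\<^sup>+ \<xi>. ennreal ((cmod (inv_phi n \<xi>))\<^sup>2 *\<^sub>R h \<xi>) \<partial>circle_measure)"
    proof (rule nn_integral_eq_integral[symmetric])
      show "integrable circle_measure (\<lambda>\<xi>. (cmod (inv_phi n \<xi>))\<^sup>2 *\<^sub>R h \<xi>)"
        by (rule integrable_circle_continuous)
           (auto intro!: continuous_intros continuous_on_subset[OF continuous_inv_phi] continuous_on_subset[OF h(1)])
    qed (simp add: h)
    finally show "(\<integral>\<^sup>+ \<xi>. ennreal (h \<xi> * (cmod (inv_phi n \<xi>))\<^sup>2) \<partial>circle_measure) = ennreal (LINT \<xi>|bs_measure n. h \<xi>)"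
      by (simp add: mult.commute)
  qed
  also have "liminf \<dots> = ennreal (LINT \<xi>|\<sigma>. h \<xi>)"
    by (rule lim_imp_Liminf) (auto intro!: tendsto_ennrealI bs_weak_convergence h)
  also have "\<dots> = (\<integral>\<^sup>+ \<xi>. ennreal (h \<xi>) \<partial>\<sigma>)"
    by (rule nn_integral_eq_integral[symmetric, OF integrable_continuous[OF h(1)]]) (simp add: h)
  finally show ?thesis .
qed

text \<open>
  The indicator of an open set is a limit of continuous functions below it, truncated multiples
  of the distance to the complement.
\<close>

lemma limit_density_le_open:
  assumes [measurable]: "G \<in> borel_measurable borel" and lim: "AE \<xi> in circle_measure. (\<lambda>n. inv_phi n \<xi>) \<longlonglongrightarrow> G \<xi>"
    and U: "open U"
  shows "(\<integral>\<^sup>+ \<xi>. ennreal ((cmod (G \<xi>))\<^sup>2) * indicator U \<xi> \<partial>circle_measure) \<le> emeasure \<sigma> U"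
proof -
  have [measurable]: "U \<in> sets borel" using U by simp
  \<comment> \<open>the distance to the empty set is \<open>0\<close> by convention, hence the separate case of the whole plane\<close>
  define h where "h = (\<lambda>k \<xi>. if U = UNIV then 1 else min 1 (real k * infdist \<xi> (- U)))"
  have hc: "continuous_on UNIV (h k)" for k
    unfolding h_def by (cases "U = UNIV") (auto intro!: continuous_intros)
  have h0: "0 \<le> h k \<xi>" for k \<xi> by (simp add: h_def infdist_nonneg)
  have h1: "h k \<xi> \<le> indicator U \<xi>" for k \<xi>
    using infdist_nonneg[of \<xi> "- U"] by (auto simp: h_def indicator_def)
  have [measurable]: "h k \<in> borel_measurable borel" for k by (rule borel_measurable_continuous_onI[OF hc])
  have hl: "(\<lambda>k. h k \<xi>) \<longlonglongrightarrow> indicator U \<xi>" for \<xi>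
  proof (cases "U = UNIV \<or> \<xi> \<notin> U")
    case True
    then show ?thesis
    proof
      assume "\<xi> \<notin> U"
      then have "h k \<xi> = 0" for k using h0[of k \<xi>] h1[of k \<xi>] by simp
      then show ?thesis using \<open>\<xi> \<notin> U\<close> by simp
    qed (simp add: h_def)
  next
    case False
    have "infdist \<xi> (- U) > 0"
      using False U in_closed_iff_infdist_zero[of "- U" \<xi>] infdist_nonneg[of \<xi> "- U"]
      by (auto simp: closed_def less_le)
    then obtain K where K: "real K * infdist \<xi> (- U) > 1" using reals_Archimedean3 by blast
    have "\<forall>\<^sub>F k in sequentially. h k \<xi> = 1"
      using eventually_ge_at_top[of K]
    proof eventually_elim
      fix k assume "K \<le> k"
      then have "real K * infdist \<xi> (- U) \<le> real k * infdist \<xi> (- U)"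
        by (intro mult_right_mono infdist_nonneg) simp
      then show "h k \<xi> = 1" using K by (simp add: h_def)
    qed
    then show ?thesis using False by (simp add: tendsto_eventually)
  qed
  have "(\<integral>\<^sup>+ \<xi>. ennreal ((cmod (G \<xi>))\<^sup>2) * indicator U \<xi> \<partial>circle_measure)
     = (\<integral>\<^sup>+ \<xi>. liminf (\<lambda>k. ennreal (h k \<xi> * (cmod (G \<xi>))\<^sup>2)) \<partial>circle_measure)"
  proof (rule nn_integral_cong)
    fix \<xi>
    have "(\<lambda>k. ennreal (h k \<xi> * (cmod (G \<xi>))\<^sup>2)) \<longlonglongrightarrow> ennreal (indicator U \<xi> * (cmod (G \<xi>))\<^sup>2)"
      by (intro tendsto_ennrealI tendsto_intros hl)
    then have "liminf (\<lambda>k. ennreal (h k \<xi> * (cmod (G \<xi>))\<^sup>2)) = ennreal (indicator U \<xi> * (cmod (G \<xi>))\<^sup>2)"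
      by (intro lim_imp_Liminf) auto
    then show "ennreal ((cmod (G \<xi>))\<^sup>2) * indicator U \<xi> = liminf (\<lambda>k. ennreal (h k \<xi> * (cmod (G \<xi>))\<^sup>2))"
      by (simp add: indicator_def)
  qed
  also have "\<dots> \<le> liminf (\<lambda>k. \<integral>\<^sup>+ \<xi>. ennreal (h k \<xi> * (cmod (G \<xi>))\<^sup>2) \<partial>circle_measure)"
    by (rule nn_integral_liminf) simp
  also have "\<dots> \<le> liminf (\<lambda>k. emeasure \<sigma> U)"
  proof (intro Liminf_mono always_eventually allI)
    fix k
    have "(\<integral>\<^sup>+ \<xi>. ennreal (h k \<xi> * (cmod (G \<xi>))\<^sup>2) \<partial>circle_measure) \<le> (\<integral>\<^sup>+ \<xi>. ennreal (h k \<xi>) \<partial>\<sigma>)"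
      by (rule limit_density_le_continuous[OF assms(1) lim hc h0])
    also have "\<dots> \<le> (\<integral>\<^sup>+ \<xi>. indicator U \<xi> \<partial>\<sigma>)"
    proof (rule nn_integral_mono)
      fix \<xi>
      have "ennreal (h k \<xi>) \<le> ennreal (indicator U \<xi>)" by (rule ennreal_leI[OF h1])
      also have "ennreal (indicator U \<xi>) = indicator U \<xi>" by (cases "\<xi> \<in> U") auto
      finally show "ennreal (h k \<xi>) \<le> indicator U \<xi>" .
    qed
    also have "\<dots> = emeasure \<sigma> U" by simp
    finally show "(\<integral>\<^sup>+ \<xi>. ennreal (h k \<xi> * (cmod (G \<xi>))\<^sup>2) \<partial>circle_measure) \<le> emeasure \<sigma> U" .
  qed
  also have "\<dots> = emeasure \<sigma> U" by (simp add: Liminf_const)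
  finally show ?thesis .
qed

text \<open>
  Open sets suffice by outer regularity of \<open>\<sigma>\<close>.
\<close>

lemma limit_density_le:
  assumes [measurable]: "G \<in> borel_measurable borel" and lim: "AE \<xi> in circle_measure. (\<lambda>n. inv_phi n \<xi>) \<longlonglongrightarrow> G \<xi>"
    and A: "A \<in> sets borel"
  shows "(\<integral>\<^sup>+ \<xi>. ennreal ((cmod (G \<xi>))\<^sup>2) * indicator A \<xi> \<partial>circle_measure) \<le> emeasure \<sigma> A"
proof -
  let ?IG = "\<lambda>A. \<integral>\<^sup>+ \<xi>. ennreal ((cmod (G \<xi>))\<^sup>2) * indicator A \<xi> \<partial>circle_measure"
  have "emeasure \<sigma> A = (INF U \<in> {U. A \<subseteq> U \<and> open U}. emeasure \<sigma> U)"
    by (rule outer_regular) (use A emeasure_space_1 in auto)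
  moreover have "?IG A \<le> \<dots>"
  proof (rule INF_greatest)
    fix U assume U: "U \<in> {U. A \<subseteq> U \<and> open U}"
    have "?IG A
       \<le> ?IG U"
      using U by (intro nn_integral_mono mult_left_mono) (auto simp: indicator_def)
    also have "\<dots> \<le> emeasure \<sigma> U" using U by (intro limit_density_le_open lim) auto
    finally show "?IG A \<le> emeasure \<sigma> U" .
  qed
  ultimately show ?thesis by simp
qed

lemma limit_sq_integral_le_1:
  assumes [measurable]: "G \<in> borel_measurable borel" and lim: "AE \<xi> in circle_measure. (\<lambda>n. inv_phi n \<xi>) \<longlonglongrightarrow> G \<xi>"
  shows "(\<integral>\<^sup>+ \<xi>. ennreal ((cmod (G \<xi>))\<^sup>2) \<partial>circle_measure) \<le> 1"
  using limit_density_le[OF assms, of UNIV] emeasure_space_1 space_\<mu> by simp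

text \<open>
  The absolutely continuous part is dominated by \<open>\<sigma>\<close>, and \<open>\<bar>\<phi>\<^sub>n\<^sup>*\<bar> = \<bar>\<phi>\<^sub>n\<bar>\<close> has norm \<open>1\<close> in \<open>L\<^sup>2(\<sigma>)\<close>.
\<close>

lemma reversed_density_integral_le:
  assumes w: "is_ac_density \<sigma> w"
  shows "(\<integral>\<^sup>+ \<xi>. ennreal (w \<xi> / (cmod (inv_phi n \<xi>))\<^sup>2) \<partial>circle_measure) \<le> 1"
proof -
  have wm[measurable]: "w \<in> borel_measurable borel" and w0: "\<And>\<xi>. 0 \<le> w \<xi>"
    using w by (auto simp: is_ac_density_def)
  let ?D = "density circle_measure (\<lambda>\<xi>. ennreal (w \<xi>))"
  have le: "?D \<le> \<sigma>"
    unfolding le_measure[of ?D \<sigma>, simplified] le_fun_def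
  proof
    fix A show "emeasure ?D A \<le> emeasure \<sigma> A"
      using w by (cases "A \<in> sets borel") (auto simp: is_ac_density_def emeasure_notin_sets)
  qed
  have "(\<integral>\<^sup>+ \<xi>. ennreal (w \<xi> / (cmod (inv_phi n \<xi>))\<^sup>2) \<partial>circle_measure)
     = (\<integral>\<^sup>+ \<xi>. ennreal (w \<xi>) * ennreal (1 / (cmod (inv_phi n \<xi>))\<^sup>2) \<partial>circle_measure)"
    using w0 by (simp add: ennreal_mult[symmetric])
  also have "\<dots> = (\<integral>\<^sup>+ \<xi>. ennreal (1 / (cmod (inv_phi n \<xi>))\<^sup>2) \<partial>?D)"
    by (rule nn_integral_density[symmetric]) auto
  also have "\<dots> \<le> (\<integral>\<^sup>+ \<xi>. ennreal (1 / (cmod (inv_phi n \<xi>))\<^sup>2) \<partial>\<sigma>)"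
    by (rule nn_integral_mono_measure[OF _ le]) simp
  also have "\<dots> = (\<integral>\<^sup>+ \<xi>. ennreal ((cmod (poly (\<Phi> n) \<xi>))\<^sup>2 / (Phi_norm n)\<^sup>2) \<partial>\<sigma>)"
  proof (rule nn_integral_cong_AE)
    show "AE \<xi> in \<sigma>. ennreal (1 / (cmod (inv_phi n \<xi>))\<^sup>2) = ennreal ((cmod (poly (\<Phi> n) \<xi>))\<^sup>2 / (Phi_norm n)\<^sup>2)"
      using AE_unit
    proof eventually_elim
      fix \<xi> assume \<xi>: "cmod \<xi> = 1"
      have "cmod (inv_phi n \<xi>) \<noteq> 0" "Phi_norm n \<noteq> 0" using inv_phi_nonzero[of \<xi> n] \<xi> Phi_norm_pos[of n] by auto
      then show "ennreal (1 / (cmod (inv_phi n \<xi>))\<^sup>2) = ennreal ((cmod (poly (\<Phi> n) \<xi>))\<^sup>2 / (Phi_norm n)\<^sup>2)"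
        using inv_phi_sq_circle[OF \<xi>, of n] by (simp add: field_simps)
    qed
  qed
  also have "\<dots> = ennreal (LINT \<xi>|\<sigma>. (cmod (poly (\<Phi> n) \<xi>))\<^sup>2 / (Phi_norm n)\<^sup>2)"
    by (intro nn_integral_eq_integral integrable_continuous continuous_intros) (use Phi_norm_pos[of n] in auto)
  also have "\<dots> = 1" using norm_\<Phi>[of n] Phi_norm_pos[of n] by simp
  finally show ?thesis .
qed

text \<open>
  Off the null set that carries the singular part, \<open>\<bar>G\<bar>\<^sup>2 dm \<le> \<sigma>\<close> reads \<open>\<bar>G\<bar>\<^sup>2 \<le> w\<close>. The function
  \<open>w / \<bar>G\<bar>\<^sup>2 \<ge> 1\<close> then has integral at most \<open>1\<close>, which leaves only equality.
\<close>

theorem ac_density_eq_limit: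
  assumes [measurable]: "G \<in> borel_measurable borel" and lim: "AE \<xi> in circle_measure. (\<lambda>n. inv_phi n \<xi>) \<longlonglongrightarrow> G \<xi>"
    and nz: "AE \<xi> in circle_measure. G \<xi> \<noteq> 0" and w: "is_ac_density \<sigma> w"
  shows "AE \<xi> in circle_measure. w \<xi> = (cmod (G \<xi>))\<^sup>2"
proof -
  let ?Iw = "\<lambda>A. \<integral>\<^sup>+ \<xi>. ennreal (w \<xi>) * indicator A \<xi> \<partial>circle_measure"
  let ?IG = "\<lambda>A. \<integral>\<^sup>+ \<xi>. ennreal ((cmod (G \<xi>))\<^sup>2) * indicator A \<xi> \<partial>circle_measure"
  have wm[measurable]: "w \<in> borel_measurable borel" and w0: "\<And>\<xi>. 0 \<le> w \<xi>"
    using w by (auto simp: is_ac_density_def)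
  obtain \<sigma>s N where \<sigma>s: "sets \<sigma>s = sets borel" "N \<in> sets borel" "emeasure circle_measure N = 0" "emeasure \<sigma>s (- N) = 0"
    "\<And>A. A \<in> sets borel \<Longrightarrow> emeasure \<sigma> A = emeasure (density circle_measure (\<lambda>\<xi>. ennreal (w \<xi>))) A + emeasure \<sigma>s A"
    using w unfolding is_ac_density_def singular_to_circle_measure_def by blast
  have NN: "AE \<xi> in circle_measure. \<xi> \<notin> N"
    using \<sigma>s by (intro AE_not_in) (auto simp: null_sets_def)
  have le: "?IG A \<le> ?Iw A"
    if [measurable]: "A \<in> sets borel" for A
  proof -
    have [measurable]: "N \<in> sets borel" by (rule \<sigma>s)
    have "?IG A
       = ?IG (A - N)"
      by (rule nn_integral_cong_AE) (use NN in \<open>auto simp: indicator_def elim!: eventually_mono\<close>)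
    also have "\<dots> \<le> emeasure \<sigma> (A - N)" by (rule limit_density_le[OF _ lim]) auto
    also have "\<dots> = emeasure (density circle_measure (\<lambda>\<xi>. ennreal (w \<xi>))) (A - N) + emeasure \<sigma>s (A - N)"
      by (rule \<sigma>s) simp
    also have "emeasure \<sigma>s (A - N) \<le> emeasure \<sigma>s (- N)"
      using \<sigma>s by (intro emeasure_mono) auto
    then have "emeasure \<sigma>s (A - N) = 0" using \<sigma>s by simp
    also have "emeasure (density circle_measure (\<lambda>\<xi>. ennreal (w \<xi>))) (A - N) + 0
       = ?Iw (A - N)"
      by (simp add: emeasure_density)
    also have "\<dots> \<le> ?Iw A"
      by (intro nn_integral_mono mult_left_mono) (auto simp: indicator_def)
    finally show ?thesis .
  qed
  define A where "A = {\<xi>. (cmod (G \<xi>))\<^sup>2 > w \<xi>}"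
  have [measurable]: "A \<in> sets borel" unfolding A_def by measurable
  have finG: "?IG A \<noteq> \<infinity>"
    using limit_density_le[OF assms(1) lim \<open>A \<in> sets borel\<close>] emeasure_finite[of A] by (auto simp: top_unique)
  have ge: "AE \<xi> in circle_measure. (cmod (G \<xi>))\<^sup>2 \<le> w \<xi>"
  proof -
    have pt: "ennreal (w \<xi>) * indicator A \<xi> \<le> ennreal ((cmod (G \<xi>))\<^sup>2) * indicator A \<xi>" for \<xi>
      by (auto simp: indicator_def A_def intro!: ennreal_leI)
    have finw: "?Iw A \<noteq> \<infinity>"
    proof -
      have "?Iw A
        \<le> ?IG A"
        by (rule nn_integral_mono) (rule pt)
      then show ?thesis using finG by (auto simp: top_unique)
    qed
    have "(\<integral>\<^sup>+ \<xi>. ennreal ((cmod (G \<xi>))\<^sup>2) * indicator A \<xi> - ennreal (w \<xi>) * indicator A \<xi> \<partial>circle_measure)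
      = ?IG A - ?Iw A"
      by (rule nn_integral_diff) (use finw pt in auto)
    also have "\<dots> = 0" by (rule diff_eq_0_ennreal[OF _ le]) (use finG in \<open>auto simp: less_top\<close>)
    finally have "AE \<xi> in circle_measure. ennreal ((cmod (G \<xi>))\<^sup>2) * indicator A \<xi> - ennreal (w \<xi>) * indicator A \<xi> = 0"
      by (subst (asm) nn_integral_0_iff_AE) auto
    then show ?thesis
    proof eventually_elim
      fix \<xi> assume z: "ennreal ((cmod (G \<xi>))\<^sup>2) * indicator A \<xi> - ennreal (w \<xi>) * indicator A \<xi> = 0"
      show "(cmod (G \<xi>))\<^sup>2 \<le> w \<xi>"
      proof (rule ccontr)
        assume c: "\<not> (cmod (G \<xi>))\<^sup>2 \<le> w \<xi>"
        then have "\<xi> \<in> A" by (simp add: A_def)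
        then have "ennreal ((cmod (G \<xi>))\<^sup>2 - w \<xi>) = 0" using z w0 by (simp add: ennreal_minus)
        then show False using c by (simp add: ennreal_eq_0_iff)
      qed
    qed
  qed
  have "(\<integral>\<^sup>+ \<xi>. ennreal (w \<xi> / (cmod (G \<xi>))\<^sup>2) \<partial>circle_measure)
      = (\<integral>\<^sup>+ \<xi>. liminf (\<lambda>n. ennreal (w \<xi> / (cmod (inv_phi n \<xi>))\<^sup>2)) \<partial>circle_measure)"
  proof (rule nn_integral_cong_AE)
    show "AE \<xi> in circle_measure. ennreal (w \<xi> / (cmod (G \<xi>))\<^sup>2) = liminf (\<lambda>n. ennreal (w \<xi> / (cmod (inv_phi n \<xi>))\<^sup>2))"
      using lim nz
      by eventually_elim (intro lim_imp_Liminf[symmetric] tendsto_ennrealI tendsto_intros, auto)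
  qed
  also have "\<dots> \<le> liminf (\<lambda>n. \<integral>\<^sup>+ \<xi>. ennreal (w \<xi> / (cmod (inv_phi n \<xi>))\<^sup>2) \<partial>circle_measure)"
    by (rule nn_integral_liminf) simp
  also have "\<dots> \<le> liminf (\<lambda>n. 1)"
    by (intro Liminf_mono always_eventually allI reversed_density_integral_le w)
  also have "\<dots> = 1" by (simp add: Liminf_const)
  finally have b: "(\<integral>\<^sup>+ \<xi>. ennreal (w \<xi> / (cmod (G \<xi>))\<^sup>2) \<partial>circle_measure) \<le> 1" .
  have one: "(\<integral>\<^sup>+ \<xi>. 1 \<partial>circle_measure) = 1" using circle.emeasure_space_1 by simp
  have ge1: "AE \<xi> in circle_measure. 1 \<le> ennreal (w \<xi> / (cmod (G \<xi>))\<^sup>2)"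
    using ge nz
  proof eventually_elim
    fix \<xi> assume "(cmod (G \<xi>))\<^sup>2 \<le> w \<xi>" "G \<xi> \<noteq> 0"
    then have "1 \<le> w \<xi> / (cmod (G \<xi>))\<^sup>2" by (simp add: field_simps)
    then show "1 \<le> ennreal (w \<xi> / (cmod (G \<xi>))\<^sup>2)" by (simp add: ennreal_1[symmetric] del: ennreal_1)
  qed
  have "(\<integral>\<^sup>+ \<xi>. ennreal (w \<xi> / (cmod (G \<xi>))\<^sup>2) - 1 \<partial>circle_measure)
     = (\<integral>\<^sup>+ \<xi>. ennreal (w \<xi> / (cmod (G \<xi>))\<^sup>2) \<partial>circle_measure) - (\<integral>\<^sup>+ \<xi>. 1 \<partial>circle_measure)"
    by (rule nn_integral_diff) (use ge1 one in auto)
  also have "\<dots> = 0" unfolding one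
    by (rule diff_eq_0_ennreal[OF le_less_trans[OF b] b]) simp
  finally have "AE \<xi> in circle_measure. ennreal (w \<xi> / (cmod (G \<xi>))\<^sup>2) - 1 = 0"
    by (subst (asm) nn_integral_0_iff_AE) auto
  then show ?thesis
    using ge nz
  proof eventually_elim
    fix \<xi> assume z: "ennreal (w \<xi> / (cmod (G \<xi>))\<^sup>2) - 1 = 0" and a: "(cmod (G \<xi>))\<^sup>2 \<le> w \<xi>" "G \<xi> \<noteq> 0"
    have "ennreal (w \<xi> / (cmod (G \<xi>))\<^sup>2 - 1) = 0" using z by (simp add: ennreal_minus ennreal_1[symmetric] del: ennreal_1)
    then have "w \<xi> / (cmod (G \<xi>))\<^sup>2 \<le> 1" by (simp add: ennreal_eq_0_iff)
    then show "w \<xi> = (cmod (G \<xi>))\<^sup>2" using a by (simp add: field_simps)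
  qed
qed

end

section \<open>Lebesgue decomposition on the circle\<close>

text \<open>
  A union of null sets whose \<open>\<sigma>\<close>-measures approach the supremum over all null sets. It carries the part
  of \<open>\<sigma>\<close> that is singular to \<open>M\<close>.
\<close>

lemma finite_measure_maximal_null_set:
  assumes "finite_measure \<sigma>" and s: "sets \<sigma> = sets M"
  shows "\<exists>N\<in>null_sets M. \<forall>A\<in>null_sets M. emeasure \<sigma> (A - N) = 0"
proof -
  interpret finite_measure \<sigma> by fact
  have [simp]: "A \<in> sets \<sigma>" if "A \<in> null_sets M" for A using that s by auto
  define S where "S = (SUP A\<in>null_sets M. measure \<sigma> A)"
  have bdd: "bdd_above (measure \<sigma> ` null_sets M)"
    by (intro bdd_aboveI[of _ "measure \<sigma> (space \<sigma>)"]) (auto intro: bounded_measure)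
  have up: "measure \<sigma> A \<le> S" if "A \<in> null_sets M" for A
    unfolding S_def by (rule cSUP_upper[OF that bdd])
  have "\<exists>A\<in>null_sets M. measure \<sigma> A > S - 1 / Suc k" for k
  proof -
    have "\<exists>A\<in>null_sets M. S - 1 / Suc k < measure \<sigma> A"
      unfolding S_def by (rule less_cSupE[of _ "measure \<sigma> ` null_sets M"]) (auto simp flip: S_def)
    then show ?thesis by auto
  qed
  then obtain A where A: "\<And>k. A k \<in> null_sets M" "\<And>k. measure \<sigma> (A k) > S - 1 / Suc k" by metis
  define N where "N = (\<Union>k. A k)"
  have N: "N \<in> null_sets M" unfolding N_def by (rule null_sets_UN) (rule A)
  have SN: "S \<le> measure \<sigma> N"
  proof (rule LIMSEQ_le_const2)
    show "(\<lambda>k. S - 1 / Suc k) \<longlonglongrightarrow> S"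
      using tendsto_diff[OF tendsto_const LIMSEQ_inverse_real_of_nat, of S] by (simp add: inverse_eq_divide)
    have "S - 1 / Suc k \<le> measure \<sigma> N" for k
    proof -
      have "A k \<subseteq> N" by (auto simp: N_def)
      then have "measure \<sigma> (A k) \<le> measure \<sigma> N" by (rule finite_measure_mono) (use N in simp)
      then show ?thesis using A(2)[of k] by linarith
    qed
    then show "\<exists>n. \<forall>k\<ge>n. S - 1 / Suc k \<le> measure \<sigma> N" by blast
  qed
  show ?thesis
  proof (intro bexI[OF _ N] ballI)
    fix B assume B: "B \<in> null_sets M"
    have "measure \<sigma> (N \<union> (B - N)) = measure \<sigma> N + measure \<sigma> (B - N)"
      using N B by (intro finite_measure_Union) auto
    moreover have "N \<union> (B - N) \<in> null_sets M" using N B by auto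
    ultimately have "measure \<sigma> (B - N) \<le> 0" using up[of "N \<union> (B - N)"] SN by linarith
    then have "measure \<sigma> (B - N) = 0" using measure_nonneg[of \<sigma> "B - N"] by linarith
    then show "emeasure \<sigma> (B - N) = 0" by (simp add: emeasure_eq_measure)
  qed
qed

text \<open>
  Off a maximal null set \<open>\<sigma>\<close> is absolutely continuous, so the Radon--Nikodym theorem applies to
  that part.
\<close>

lemma ac_density_exists:
  assumes fin: "finite_measure \<sigma>" and s[measurable_cong]: "sets \<sigma> = sets borel"
  shows "is_ac_density \<sigma> (ac_density \<sigma>)"
proof -
  interpret finite_measure \<sigma> by fact
  obtain N where N: "N \<in> null_sets circle_measure" "\<And>A. A \<in> null_sets circle_measure \<Longrightarrow> emeasure \<sigma> (A - N) = 0"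
    using finite_measure_maximal_null_set[OF fin, of circle_measure] s by auto
  have NB[measurable]: "N \<in> sets borel" using N(1) by auto
  define \<sigma>a where "\<sigma>a = density \<sigma> (indicator (- N))"
  define \<sigma>s where "\<sigma>s = density \<sigma> (indicator N)"
  have ea: "emeasure \<sigma>a A = emeasure \<sigma> (A - N)" and es: "emeasure \<sigma>s A = emeasure \<sigma> (A \<inter> N)" if [measurable]: "A \<in> sets borel" for A
  proof -
    show "emeasure \<sigma>a A = emeasure \<sigma> (A - N)"
      unfolding \<sigma>a_def by (subst emeasure_restricted) (auto simp: s intro!: arg_cong[where f="emeasure \<sigma>"])
    show "emeasure \<sigma>s A = emeasure \<sigma> (A \<inter> N)"
      unfolding \<sigma>s_def by (subst emeasure_restricted) (auto simp: s Int_commute)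
  qed
  have "absolutely_continuous circle_measure \<sigma>a"
    unfolding absolutely_continuous_def
  proof
    fix A assume A: "A \<in> null_sets circle_measure"
    then have "A \<in> sets borel" by auto
    then show "A \<in> null_sets \<sigma>a" using N(2)[OF A] by (simp add: null_sets_def ea) (simp add: \<sigma>a_def s)
  qed
  then obtain h where h[measurable]: "h \<in> borel_measurable circle_measure" and hd: "density circle_measure h = \<sigma>a"
    using circle.Radon_Nikodym[of \<sigma>a] by (auto simp: \<sigma>a_def s)
  have "(\<integral>\<^sup>+ x. h x \<partial>circle_measure) = emeasure \<sigma>a UNIV"
    unfolding hd[symmetric] by (subst emeasure_density) auto
  also have "\<dots> < \<infinity>" using ea[of UNIV] by (simp add: emeasure_eq_measure)
  finally have "AE x in circle_measure. h x \<noteq> \<infinity>"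
    by (intro nn_integral_PInf_AE h) auto
  then have eq: "density circle_measure (\<lambda>x. ennreal (enn2real (h x))) = \<sigma>a"
    unfolding hd[symmetric] by (intro density_cong) (auto elim!: eventually_mono simp: less_top)
  have "is_ac_density \<sigma> (\<lambda>x. enn2real (h x))"
    unfolding is_ac_density_def
  proof (intro conjI exI[of _ \<sigma>s] allI ballI)
    show "(\<lambda>x. enn2real (h x)) \<in> borel_measurable borel" using h by simp
    show "sets \<sigma>s = sets borel" by (simp add: \<sigma>s_def s)
    show "singular_to_circle_measure \<sigma>s"
      unfolding singular_to_circle_measure_def
      by (intro bexI[of _ N] conjI) (use N(1) es[of "- N"] in auto)
    fix A :: "complex set" assume A: "A \<in> sets borel"
    have "emeasure \<sigma> A = emeasure \<sigma> ((A - N) \<union> (A \<inter> N))" by (rule arg_cong[where f="emeasure \<sigma>"]) auto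
    also have "\<dots> = emeasure \<sigma> (A - N) + emeasure \<sigma> (A \<inter> N)"
      using A by (intro plus_emeasure[symmetric]) (auto simp: s)
    finally show "emeasure \<sigma> A = emeasure (density circle_measure (\<lambda>\<xi>. ennreal (enn2real (h \<xi>)))) A + emeasure \<sigma>s A"
      unfolding eq by (simp add: ea es A)
  qed simp
  then show ?thesis unfolding ac_density_def by (rule someI[of "is_ac_density \<sigma>"])
qed

section \<open>Existence of the orthogonal polynomials\<close>

lemma circle_prob_measuresD:
  assumes "\<sigma> \<in> circle_prob_measures"
  shows "prob_space \<sigma>" "circle_finite_measure \<sigma>"
proof -
  show p: "prob_space \<sigma>" using assms by (simp add: circle_prob_measures_def)
  interpret prob_space \<sigma> by fact
  have s: "sets \<sigma> = sets borel" and z: "emeasure \<sigma> (- sphere 0 1) = 0"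
    using assms by (auto simp: circle_prob_measures_def)
  have "AE \<xi> in \<sigma>. \<xi> \<notin> - sphere 0 1"
    using s z by (intro AE_not_in) (auto simp: null_sets_def)
  then have "AE \<xi> in \<sigma>. cmod \<xi> = 1" by eventually_elim auto
  then show "circle_finite_measure \<sigma>" using s by unfold_locales
qed

lemma poly_star_circle:
  assumes "cmod \<xi> = 1" shows "poly (star p) \<xi> = \<xi> ^ degree p * cnj (poly p \<xi>)"
proof -
  from unit_mult_cnj[OF assms] have "inverse (cnj \<xi>) = \<xi>" using assms by (metis inverse_unique mult.commute)
  moreover have "\<xi> \<noteq> 0" using assms by auto
  ultimately show ?thesis using poly_star[of \<xi> p] by simp
qed

lemma degree_star: "degree (star p) \<le> degree p"
  by (rule degree_le) (simp add: star_def coeff_map_poly coeff_reflect_poly)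

lemma coeff_0_star: "coeff (star p) 0 = cnj (lead_coeff p)"
  by (simp add: star_def coeff_map_poly)

lemma star_smult: "star (smult c p) = smult (cnj c) (star p)"
  by (simp add: star_def reflect_poly_smult map_poly_smult)

locale nondegenerate_circle_measure = circle_finite_measure \<sigma> for \<sigma> +
  assumes infinite_support: "infinite (measure_support \<sigma>)"
begin

text \<open>
  A polynomial of norm zero vanishes almost everywhere, so the support lies in its finite zero set.
\<close>

lemma norm_pos: assumes "p \<noteq> 0" shows "(LINT \<xi>|\<sigma>. (cmod (poly p \<xi>))\<^sup>2) \<noteq> 0"
proof
  assume z: "(LINT \<xi>|\<sigma>. (cmod (poly p \<xi>))\<^sup>2) = 0"
  have "integrable \<sigma> (\<lambda>\<xi>. (cmod (poly p \<xi>))\<^sup>2)" by (intro integrable_continuous continuous_intros)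
  then have ae: "AE \<xi> in \<sigma>. (cmod (poly p \<xi>))\<^sup>2 = 0"
    using z by (subst (asm) integral_nonneg_eq_0_iff_AE) auto
  define Z where "Z = {z. poly p z = 0}"
  have fZ: "finite Z" unfolding Z_def by (rule poly_roots_finite[OF assms])
  then have oZ: "open (- Z)" by (simp add: finite_imp_closed open_Compl)
  have "AE x in \<sigma>. \<not> poly p x \<noteq> 0" using ae by eventually_elim simp
  from emeasure_eq_0_AE[OF this] have "emeasure \<sigma> (- Z) = 0"
    by (simp add: Z_def Compl_eq space_\<mu>)
  then have "measure_support \<sigma> \<subseteq> Z" using oZ by (fastforce simp: measure_support_def)
  then show False using fZ infinite_support finite_subset by blast
qed

lemma is_monic_OP_iff: "is_monic_OP \<sigma> n p \<longleftrightarrow> degree p = n \<and> lead_coeff p = 1 \<and> ortho n p"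
  by (simp add: is_monic_OP_def ortho_def)

lemma monic_OP_unique:
  assumes "is_monic_OP \<sigma> n p" "is_monic_OP \<sigma> n q" shows "p = q"
proof (rule ccontr)
  assume "p \<noteq> q"
  define d where "d = p - q"
  have d0: "d \<noteq> 0" using \<open>p \<noteq> q\<close> by (simp add: d_def)
  have p: "degree p = n" "coeff p n = 1" "ortho n p" and q: "degree q = n" "coeff q n = 1" "ortho n q"
    using assms by (auto simp: is_monic_OP_iff)
  have "degree d \<le> n" unfolding d_def using p q by (intro degree_diff_le) auto
  moreover have "coeff d n = 0" using p q by (simp add: d_def)
  ultimately have dd: "degree d < n" using d0 by (metis le_neq_implies_less leading_coeff_0_iff)
  have sq: "complex_of_real ((cmod (poly d \<xi>))\<^sup>2) = poly p \<xi> * cnj (poly d \<xi>) - poly q \<xi> * cnj (poly d \<xi>)" for \<xi>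
    unfolding complex_norm_square by (simp add: d_def algebra_simps)
  have i: "integrable \<sigma> (\<lambda>\<xi>. poly r \<xi> * cnj (poly d \<xi>))" for r by (intro integrable_continuous continuous_intros)
  have "complex_of_real (LINT \<xi>|\<sigma>. (cmod (poly d \<xi>))\<^sup>2) = (LINT \<xi>|\<sigma>. complex_of_real ((cmod (poly d \<xi>))\<^sup>2))"
    by (rule integral_of_real[symmetric]) (intro integrable_continuous continuous_intros)
  also have "\<dots> = (LINT \<xi>|\<sigma>. poly p \<xi> * cnj (poly d \<xi>)) - (LINT \<xi>|\<sigma>. poly q \<xi> * cnj (poly d \<xi>))"
    unfolding sq by (rule Bochner_Integration.integral_diff[OF i i])
  also have "\<dots> = 0" using ortho_poly[OF p(3) dd] ortho_poly[OF q(3) dd] by simp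
  finally show False using norm_pos[OF d0] by simp
qed

text \<open>
  The next orthogonal polynomial is \<open>z p - c p\<^sup>*\<close>. This is orthogonal to \<open>\<xi>, \<dots>, \<xi>\<^sup>n\<close> for every \<open>c\<close>, and \<open>c\<close> is chosen
  to give orthogonality to \<open>1\<close>. The choice is possible because the integral of \<open>p\<^sup>*\<close> is the squared norm
  of \<open>p\<close>.
\<close>

lemma monic_OP_Suc_exists:
  assumes "is_monic_OP \<sigma> n p" shows "\<exists>q. is_monic_OP \<sigma> (Suc n) q"
proof -
  have p: "degree p = n" "lead_coeff p = 1" "ortho n p" using assms by (auto simp: is_monic_OP_iff)
  have p0: "p \<noteq> 0" using p(2) by auto
  define s where "s = star p"
  have sc: "poly s \<xi> = \<xi> ^ n * cnj (poly p \<xi>)" if "cmod \<xi> = 1" for \<xi>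
    using poly_star_circle[OF that, of p] p(1) by (simp add: s_def)
  have sd: "degree s \<le> n" using degree_star[of p] p(1) by (simp add: s_def)
  have s0: "coeff s 0 = 1" using coeff_0_star[of p] p(2) by (simp add: s_def)
  have rev: "(LINT \<xi>|\<sigma>. poly s \<xi> * cnj (\<xi> ^ j)) = 0" if "1 \<le> j" "j \<le> n" for j
    by (rule ortho_reversed[OF p(3) sc that])
  define I where "I = (LINT \<xi>|\<sigma>. poly s \<xi> * cnj (\<xi> ^ 0))"
  have "complex_of_real (LINT \<xi>|\<sigma>. (cmod (poly p \<xi>))\<^sup>2) = (LINT \<xi>|\<sigma>. complex_of_real ((cmod (poly p \<xi>))\<^sup>2))"
    by (rule integral_of_real[symmetric]) (intro integrable_continuous continuous_intros)
  also have "\<dots> = (LINT \<xi>|\<sigma>. poly s \<xi> * cnj (poly s \<xi>))"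
  proof (rule integral_cong_circle)
    fix \<xi> :: complex assume \<xi>: "cmod \<xi> = 1"
    have "cmod (poly s \<xi>) = cmod (poly p \<xi>)" using \<xi> by (simp add: sc norm_mult norm_power)
    then show "complex_of_real ((cmod (poly p \<xi>))\<^sup>2) = poly s \<xi> * cnj (poly s \<xi>)"
      by (simp add: complex_norm_square[symmetric])
  qed (intro continuous_intros)+
  also have "\<dots> = (LINT \<xi>|\<sigma>. (\<Sum>i\<le>degree s. cnj (coeff s i) * (poly s \<xi> * cnj (\<xi> ^ i))))"
    by (simp add: poly_altdef[of s] sum_distrib_left sum_distrib_right mult_ac)
  also have "\<dots> = (\<Sum>i\<le>degree s. (LINT \<xi>|\<sigma>. cnj (coeff s i) * (poly s \<xi> * cnj (\<xi> ^ i))))"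
    by (intro Bochner_Integration.integral_sum integrable_continuous continuous_intros)
  also have "\<dots> = (\<Sum>i\<le>degree s. if i = 0 then I else 0)"
  proof (intro sum.cong refl)
    fix i assume "i \<in> {..degree s}"
    then have "i \<le> n" using sd by simp
    then show "(LINT \<xi>|\<sigma>. cnj (coeff s i) * (poly s \<xi> * cnj (\<xi> ^ i))) = (if i = 0 then I else 0)"
      using rev[of i] s0 by (cases "i = 0") (simp_all add: I_def del: complex_cnj_power)
  qed
  also have "\<dots> = I" by simp
  finally have I0: "I \<noteq> 0" using norm_pos[OF p0] by (metis of_real_eq_0_iff)
  define c where "c = (LINT \<xi>|\<sigma>. poly ([:0, 1:] * p) \<xi> * cnj (\<xi> ^ 0)) / I"
  define q where "q = smult 1 ([:0, 1:] * p) + smult (- c) s"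
  have dp: "degree ([:0, 1:] * p) = Suc n" using p p0 by (simp add: degree_mult_eq)
  have lp: "lead_coeff ([:0, 1:] * p) = 1" unfolding lead_coeff_mult p(2) by simp
  have ds: "degree (smult (- c) s) < degree ([:0, 1:] * p)"
    using sd dp by (metis degree_smult_le le_trans less_Suc_eq_le)
  have "q = smult (- c) s + [:0, 1:] * p" by (simp add: q_def)
  then have "degree q = Suc n" "lead_coeff q = 1"
    using degree_add_eq_right[OF ds] lead_coeff_add_le[OF ds] dp lp by (simp_all only:)
  moreover have "ortho (Suc n) q"
    unfolding ortho_def
  proof (intro allI impI)
    fix j assume j: "j < Suc n"
    have "(LINT \<xi>|\<sigma>. poly q \<xi> * cnj (\<xi> ^ j)) = 1 * (LINT \<xi>|\<sigma>. poly ([:0, 1:] * p) \<xi> * cnj (\<xi> ^ j)) + (- c) * (LINT \<xi>|\<sigma>. poly s \<xi> * cnj (\<xi> ^ j))"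
      unfolding q_def by (rule integral_lin)
    also have "\<dots> = 0"
    proof (cases j)
      case 0
      have "(LINT \<xi>|\<sigma>. poly ([:0, 1:] * p) \<xi> * cnj (\<xi> ^ 0)) = c * I" using I0 by (simp add: c_def)
      then show ?thesis unfolding 0 I_def[symmetric] by simp
    next
      case (Suc i)
      have "(LINT \<xi>|\<sigma>. poly ([:0, 1:] * p) \<xi> * cnj (\<xi> ^ j)) = (LINT \<xi>|\<sigma>. poly p \<xi> * cnj (\<xi> ^ i))"
        unfolding Suc by (rule ortho_shift)
      also have "\<dots> = 0" using p(3) j Suc unfolding ortho_def by auto
      finally show ?thesis using rev[of j] j Suc by (simp only:) simp
    qed
    finally show "(LINT \<xi>|\<sigma>. poly q \<xi> * cnj (\<xi> ^ j)) = 0" .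
  qed
  ultimately show ?thesis by (auto simp: is_monic_OP_iff)
qed

lemma monic_OP_is_monic_OP: "is_monic_OP \<sigma> n (monic_OP \<sigma> n)"
proof -
  have "\<exists>p. is_monic_OP \<sigma> n p"
  proof (induction n)
    case 0
    show ?case by (intro exI[of _ 1]) (simp add: is_monic_OP_def)
  next
    case (Suc n)
    then show ?case using monic_OP_Suc_exists by blast
  qed
  then have "\<exists>!p. is_monic_OP \<sigma> n p" using monic_OP_unique by blast
  then show ?thesis unfolding monic_OP_def by (rule theI')
qed

end

section \<open>Boundary values of the Szego function\<close>

text \<open>
  Bounded second moments give uniform integrability, through \<open>t \<le> min t T + t\<^sup>2 / T\<close>. The truncated
  part is handled by dominated convergence.
\<close>

lemma L1_convergence_of_L2_bounded:
  fixes f :: "nat \<Rightarrow> 'a \<Rightarrow> complex"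
  assumes "finite_measure M" and [measurable]: "\<And>n. f n \<in> borel_measurable M" "G \<in> borel_measurable M"
    and lim: "AE x in M. (\<lambda>n. f n x) \<longlonglongrightarrow> G x"
    and f2: "\<And>n. (\<integral>\<^sup>+ x. ennreal ((cmod (f n x))\<^sup>2) \<partial>M) \<le> 1" and G2: "(\<integral>\<^sup>+ x. ennreal ((cmod (G x))\<^sup>2) \<partial>M) \<le> 1"
  shows "integrable M G" "(\<lambda>n. LINT x|M. cmod (f n x - G x)) \<longlonglongrightarrow> 0"
proof -
  interpret finite_measure M by fact
  have sqi: "integrable M (\<lambda>x. (cmod (h x))\<^sup>2) \<and> (LINT x|M. (cmod (h x))\<^sup>2) \<le> 1"
    if [measurable]: "h \<in> borel_measurable M" and "(\<integral>\<^sup>+ x. ennreal ((cmod (h x))\<^sup>2) \<partial>M) \<le> 1" for h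
  proof
    show i: "integrable M (\<lambda>x. (cmod (h x))\<^sup>2)"
      using that(2) by (intro integrableI_nonneg) (auto intro: le_less_trans)
    show "(LINT x|M. (cmod (h x))\<^sup>2) \<le> 1"
      using that(2) nn_integral_eq_integral[OF i] by (simp add: ennreal_le_1)
  qed
  have L1: "integrable M h" if [measurable]: "h \<in> borel_measurable M" and "integrable M (\<lambda>x. (cmod (h x))\<^sup>2)" for h
  proof (rule Bochner_Integration.integrable_bound)
    show "integrable M (\<lambda>x. 1 + (cmod (h x))\<^sup>2)" using that by simp
    have "t \<le> 1 + t\<^sup>2" for t :: real using zero_le_power2[of "t - 1/2"] by (simp add: power2_eq_square algebra_simps)
    then show "AE x in M. norm (h x) \<le> norm (1 + (cmod (h x))\<^sup>2)" by simp
  qed measurable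
  note fi = sqi[OF assms(2) f2] and Gi = sqi[OF assms(3) G2]
  show GI: "integrable M G" using L1[of G] Gi by simp
  have di: "integrable M (\<lambda>x. (cmod (f n x - G x))\<^sup>2)" "(LINT x|M. (cmod (f n x - G x))\<^sup>2) \<le> 4" for n
  proof -
    have le: "(cmod (f n x - G x))\<^sup>2 \<le> 2 * (cmod (f n x))\<^sup>2 + 2 * (cmod (G x))\<^sup>2" for x
    proof -
      have "(cmod (f n x - G x))\<^sup>2 \<le> (cmod (f n x) + cmod (G x))\<^sup>2"
        by (intro power_mono norm_triangle_ineq4) simp
      also have "\<dots> \<le> 2 * (cmod (f n x))\<^sup>2 + 2 * (cmod (G x))\<^sup>2"
        using zero_le_power2[of "cmod (f n x) - cmod (G x)"] by (simp add: power2_eq_square algebra_simps)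
      finally show ?thesis .
    qed
    have bi: "integrable M (\<lambda>x. 2 * (cmod (f n x))\<^sup>2 + 2 * (cmod (G x))\<^sup>2)"
      using fi[of n] Gi by simp
    show i: "integrable M (\<lambda>x. (cmod (f n x - G x))\<^sup>2)"
      by (rule Bochner_Integration.integrable_bound[OF bi]) (use le in \<open>auto intro!: AE_I2\<close>)
    have "(LINT x|M. (cmod (f n x - G x))\<^sup>2) \<le> (LINT x|M. 2 * (cmod (f n x))\<^sup>2 + 2 * (cmod (G x))\<^sup>2)"
      by (rule integral_mono[OF i bi le])
    also have "\<dots> = 2 * (LINT x|M. (cmod (f n x))\<^sup>2) + 2 * (LINT x|M. (cmod (G x))\<^sup>2)"
      using fi[of n] Gi by simp
    finally show "(LINT x|M. (cmod (f n x - G x))\<^sup>2) \<le> 4" using fi[of n] Gi by linarith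
  qed
  have ai: "integrable M (\<lambda>x. cmod (f n x - G x))" for n
    using L1[of "\<lambda>x. f n x - G x"] di by simp
  show "(\<lambda>n. LINT x|M. cmod (f n x - G x)) \<longlonglongrightarrow> 0"
  proof (rule tendstoI)
    fix e :: real assume e: "e > 0"
    \<comment> \<open>the squared \<open>L\<^sup>2\<close> distance is at most \<open>4\<close>, so the part above level \<open>T\<close> costs at most \<open>4 / T = e / 2\<close>\<close>
    define T where "T = 8 / e"
    have T: "T > 0" using e by (simp add: T_def)
    have "(\<lambda>n. LINT x|M. min (cmod (f n x - G x)) T) \<longlonglongrightarrow> (LINT x|M. 0)"
    proof (rule integral_dominated_convergence[where w="\<lambda>_. T"])
      show "AE x in M. (\<lambda>n. min (cmod (f n x - G x)) T) \<longlonglongrightarrow> 0"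
        using lim
      proof eventually_elim
        fix x assume "(\<lambda>n. f n x) \<longlonglongrightarrow> G x"
        then have "(\<lambda>n. min (cmod (f n x - G x)) T) \<longlonglongrightarrow> min (cmod (G x - G x)) T"
          by (intro tendsto_intros)
        then show "(\<lambda>n. min (cmod (f n x - G x)) T) \<longlonglongrightarrow> 0" using T by simp
      qed
    qed (use T in auto)
    then have "\<forall>\<^sub>F n in sequentially. (LINT x|M. min (cmod (f n x - G x)) T) < e / 2"
      using e by (intro order_tendstoD) auto
    then show "\<forall>\<^sub>F n in sequentially. dist (LINT x|M. cmod (f n x - G x)) 0 < e"
    proof eventually_elim
      fix n assume a: "(LINT x|M. min (cmod (f n x - G x)) T) < e / 2"
      have mi: "integrable M (\<lambda>x. min (cmod (f n x - G x)) T)"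
        by (rule Bochner_Integration.integrable_bound[OF ai[of n]]) (use T in auto)
      have pt: "t \<le> min t T + t\<^sup>2 / T" if "t \<ge> 0" for t
      proof (cases "t \<le> T")
        case False
        then have "t * T \<le> t\<^sup>2" unfolding power2_eq_square using that by (intro mult_left_mono) auto
        then have "t \<le> t\<^sup>2 / T" using T by (simp add: pos_le_divide_eq)
        then show ?thesis using False T by simp
      qed (use T in simp)
      have "(LINT x|M. cmod (f n x - G x)) \<le> (LINT x|M. min (cmod (f n x - G x)) T + (cmod (f n x - G x))\<^sup>2 / T)"
        by (rule integral_mono) (use ai[of n] mi di(1)[of n] pt in auto)
      also have "\<dots> = (LINT x|M. min (cmod (f n x - G x)) T) + (LINT x|M. (cmod (f n x - G x))\<^sup>2) / T"
        using mi di(1)[of n] by simp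
      also have "(LINT x|M. (cmod (f n x - G x))\<^sup>2) / T \<le> 4 / T"
        using di(2)[of n] T by (intro divide_right_mono) auto
      also have "4 / T = e / 2" by (simp add: T_def)
      finally have "(LINT x|M. cmod (f n x - G x)) < e" using a by linarith
      moreover have "0 \<le> (LINT x|M. cmod (f n x - G x))" by simp
      ultimately show "dist (LINT x|M. cmod (f n x - G x)) 0 < e" by simp
    qed
  qed
qed

lemma szego_kernel_bound:
  assumes "cmod z < 1" "cmod \<xi> = 1" shows "cmod ((\<xi> + z) / (\<xi> - z)) \<le> 2 / (1 - cmod z)"
proof -
  have "cmod (\<xi> + z) \<le> 2" using norm_triangle_ineq[of \<xi> z] assms by simp
  moreover have "1 - cmod z \<le> cmod (\<xi> - z)" using norm_triangle_ineq2[of \<xi> z] assms by simp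
  ultimately show ?thesis using assms by (auto simp: norm_divide intro!: frac_le)
qed

context szego_prob begin

text \<open>
  Dominated convergence in the Schwarz formula for \<open>1 / \<phi>\<^sub>n\<^sup>*\<close>; this identifies the limit inside the disc
  and shows that no inner factor appears.
\<close>

lemma inv_phi_tendsto_szego_function:
  assumes G[measurable]: "G \<in> borel_measurable borel"
    and lim: "AE \<xi> in circle_measure. (\<lambda>n. inv_phi n \<xi>) \<longlonglongrightarrow> G \<xi>" and nz: "AE \<xi> in circle_measure. G \<xi> \<noteq> 0"
    and W: "integrable circle_measure W" "AE \<xi> in circle_measure. \<forall>n. \<bar>ln (cmod (inv_phi n \<xi>))\<bar> \<le> W \<xi>"
    and z: "cmod z < 1"
  shows "(\<lambda>n. inv_phi n z) \<longlonglongrightarrow> szego_function \<sigma> z"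
proof -
  let ?S = "\<lambda>\<xi>. (\<xi> + z) / (\<xi> - z)"
  have w: "is_ac_density \<sigma> (ac_density \<sigma>)"
    by (rule ac_density_exists) (auto intro: finite_measure_axioms)
  have wm[measurable]: "ac_density \<sigma> \<in> borel_measurable borel" using w by (simp add: is_ac_density_def)
  have wG: "AE \<xi> in circle_measure. ac_density \<sigma> \<xi> = (cmod (G \<xi>))\<^sup>2"
    by (rule ac_density_eq_limit[OF G lim nz w])
  have "(LINT \<xi>|circle_measure. ?S \<xi> * of_real (ln (ac_density \<sigma> \<xi>))) = (LINT \<xi>|circle_measure. 2 * (?S \<xi> * of_real (ln (cmod (G \<xi>)))))"
  proof (rule integral_cong_AE)
    show "AE \<xi> in circle_measure. ?S \<xi> * of_real (ln (ac_density \<sigma> \<xi>)) = 2 * (?S \<xi> * of_real (ln (cmod (G \<xi>))))"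
      using wG nz by eventually_elim (simp add: ln_realpow)
  qed auto
  also have "\<dots> = 2 * (LINT \<xi>|circle_measure. ?S \<xi> * of_real (ln (cmod (G \<xi>))))"
    by (rule integral_mult_right_zero)
  finally have sz: "szego_function \<sigma> z = exp (LINT \<xi>|circle_measure. ?S \<xi> * of_real (ln (cmod (G \<xi>))))"
    unfolding szego_function_def by (simp only: mult.assoc[symmetric]) simp
  have "(\<lambda>n. LINT \<xi>|circle_measure. ?S \<xi> * of_real (ln (cmod (inv_phi n \<xi>)))) \<longlonglongrightarrow> (LINT \<xi>|circle_measure. ?S \<xi> * of_real (ln (cmod (G \<xi>))))"
  proof (rule integral_dominated_convergence[where w="\<lambda>\<xi>. 2 / (1 - cmod z) * W \<xi>"])
    show "integrable circle_measure (\<lambda>\<xi>. 2 / (1 - cmod z) * W \<xi>)" using W(1) by simp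
    show "AE \<xi> in circle_measure. (\<lambda>n. ?S \<xi> * of_real (ln (cmod (inv_phi n \<xi>)))) \<longlonglongrightarrow> ?S \<xi> * of_real (ln (cmod (G \<xi>)))"
      using lim nz by eventually_elim (intro tendsto_mult tendsto_const tendsto_of_real tendsto_ln tendsto_norm, auto)
    show "AE \<xi> in circle_measure. norm (?S \<xi> * of_real (ln (cmod (inv_phi n \<xi>)))) \<le> 2 / (1 - cmod z) * W \<xi>" for n
      using W(2) AE_circle_norm
    proof eventually_elim
      fix \<xi> :: complex assume "\<forall>n. \<bar>ln (cmod (inv_phi n \<xi>))\<bar> \<le> W \<xi>" "cmod \<xi> = 1"
      then show "norm (?S \<xi> * of_real (ln (cmod (inv_phi n \<xi>)))) \<le> 2 / (1 - cmod z) * W \<xi>"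
        unfolding norm_mult norm_of_real using z
        by (intro mult_mono szego_kernel_bound) auto
    qed
  qed auto
  then have "(\<lambda>n. exp (LINT \<xi>|circle_measure. ?S \<xi> * of_real (ln (cmod (inv_phi n \<xi>))))) \<longlonglongrightarrow> szego_function \<sigma> z"
    unfolding sz by (rule tendsto_exp)
  then show ?thesis unfolding inv_phi_schwarz[OF z] .
qed

lemma inv_phi_sq_nn_integral: "(\<integral>\<^sup>+ \<xi>. ennreal ((cmod (inv_phi n \<xi>))\<^sup>2) \<partial>circle_measure) \<le> 1"
  by (subst nn_integral_eq_integral[OF bs_integrable]) (auto simp: bs_sq_integral)

text \<open>
  Inside the disc \<open>1 / \<phi>\<^sub>n\<^sup>*\<close> tends both to the Szego function and to the Poisson integral of the boundary
  limit \<open>G\<close>, so the two agree and the result on nontangential limits applies.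
\<close>

theorem boundary_values:
  assumes q: "qNCC_II" and l2: "in_l2 g"
  shows "AE \<xi> in circle_measure. convergent (Omega_prod g \<xi>)"
    and "AE \<xi> in circle_measure. \<exists>d. has_nontangential_limit (szego_function \<sigma>) \<xi> d \<and> d \<noteq> 0 \<and> (\<lambda>n. inv_phi n \<xi>) \<longlonglongrightarrow> d"
proof -
  note conv = inv_phi_convergent[OF q l2]
  show "AE \<xi> in circle_measure. convergent (Omega_prod g \<xi>)" using conv by eventually_elim simp
  define G where "G = (\<lambda>\<xi>. lim (\<lambda>n. inv_phi n \<xi>))"
  have G[measurable]: "G \<in> borel_measurable borel" unfolding G_def by (rule borel_measurable_lim_metric) simp
  have lim: "AE \<xi> in circle_measure. (\<lambda>n. inv_phi n \<xi>) \<longlonglongrightarrow> G \<xi>"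
    using conv by eventually_elim (simp add: G_def convergent_LIMSEQ_iff)
  have nz: "AE \<xi> in circle_measure. G \<xi> \<noteq> 0" using conv by eventually_elim (simp add: G_def)
  obtain W where W: "integrable circle_measure W" "AE \<xi> in circle_measure. \<forall>n. \<bar>ln (cmod (inv_phi n \<xi>))\<bar> \<le> W \<xi>"
    using inv_phi_dominated[OF q l2] by blast
  have GI: "integrable circle_measure G" and L1: "(\<lambda>n. LINT \<xi>|circle_measure. cmod (inv_phi n \<xi> - G \<xi>)) \<longlonglongrightarrow> 0"
    using L1_convergence_of_L2_bounded[OF circle.finite_measure_axioms _ _ lim inv_phi_sq_nn_integral limit_sq_integral_le_1[OF G lim]]
    by auto
  have H: "szego_function \<sigma> z = (LINT \<zeta>|circle_measure. of_real (poisson_kernel z \<zeta>) * G \<zeta>)" if z: "cmod z < 1" for z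
  proof (rule LIMSEQ_unique)
    show "(\<lambda>n. inv_phi n z) \<longlonglongrightarrow> szego_function \<sigma> z" by (rule inv_phi_tendsto_szego_function[OF G lim nz W z])
    show "(\<lambda>n. inv_phi n z) \<longlonglongrightarrow> (LINT \<zeta>|circle_measure. of_real (poisson_kernel z \<zeta>) * G \<zeta>)"
    proof (rule LIM_zero_cancel, rule Lim_null_comparison)
      show "(\<lambda>n. 1 / (1 - cmod z)\<^sup>2 * (LINT \<xi>|circle_measure. cmod (inv_phi n \<xi> - G \<xi>))) \<longlonglongrightarrow> 0"
        by (rule tendsto_mult_right_zero[OF L1])
      show "\<forall>\<^sub>F n in sequentially. norm (inv_phi n z - (LINT \<zeta>|circle_measure. of_real (poisson_kernel z \<zeta>) * G \<zeta>))
          \<le> 1 / (1 - cmod z)\<^sup>2 * (LINT \<xi>|circle_measure. cmod (inv_phi n \<xi> - G \<xi>))"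
      proof (intro always_eventually allI)
        fix n
        \<comment> \<open>the Poisson kernel at \<open>z\<close> is bounded, so convergence in \<open>L\<^sup>1\<close> is enough\<close>
        have fi: "integrable circle_measure (inv_phi n)"
          by (rule integrable_circle_continuous) (auto intro: continuous_on_subset[OF continuous_inv_phi])
        have Pd: "integrable circle_measure (\<lambda>\<zeta>. of_real (poisson_kernel z \<zeta>) * (inv_phi n \<zeta> - G \<zeta>))"
          by (rule integrable_poisson_kernel_mult[OF z Bochner_Integration.integrable_diff[OF fi GI]])
        have "inv_phi n z - (LINT \<zeta>|circle_measure. of_real (poisson_kernel z \<zeta>) * G \<zeta>)
           = (LINT \<zeta>|circle_measure. of_real (poisson_kernel z \<zeta>) * (inv_phi n \<zeta> - G \<zeta>))"
          by (rule poisson_formula_diff[OF borel_measurable_inv_phi continuous_inv_phi holomorphic_inv_phi GI z])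
        then have "norm (inv_phi n z - (LINT \<zeta>|circle_measure. of_real (poisson_kernel z \<zeta>) * G \<zeta>))
           \<le> (LINT \<zeta>|circle_measure. norm (of_real (poisson_kernel z \<zeta>) * (inv_phi n \<zeta> - G \<zeta>)))"
          by (simp only: integral_norm_bound)
        also have "\<dots> \<le> (LINT \<xi>|circle_measure. 1 / (1 - cmod z)\<^sup>2 * cmod (inv_phi n \<xi> - G \<xi>))"
        proof (rule integral_mono_AE)
          show "AE \<zeta> in circle_measure. norm (of_real (poisson_kernel z \<zeta>) * (inv_phi n \<zeta> - G \<zeta>)) \<le> 1 / (1 - cmod z)\<^sup>2 * cmod (inv_phi n \<zeta> - G \<zeta>)"
            using AE_circle_norm
          proof eventually_elim
            fix \<zeta> :: complex assume "cmod \<zeta> = 1"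
            then have "\<bar>poisson_kernel z \<zeta>\<bar> \<le> 1 / (1 - cmod z)\<^sup>2" using poisson_kernel_bounds[OF z, of \<zeta>] by simp
            then show "norm (of_real (poisson_kernel z \<zeta>) * (inv_phi n \<zeta> - G \<zeta>)) \<le> 1 / (1 - cmod z)\<^sup>2 * cmod (inv_phi n \<zeta> - G \<zeta>)"
              unfolding norm_mult norm_of_real by (rule mult_right_mono) simp
          qed
        qed (use Pd fi GI in auto)
        also have "\<dots> = 1 / (1 - cmod z)\<^sup>2 * (LINT \<xi>|circle_measure. cmod (inv_phi n \<xi> - G \<xi>))"
          by (rule integral_mult_right_zero)
        finally show "norm (inv_phi n z - (LINT \<zeta>|circle_measure. of_real (poisson_kernel z \<zeta>) * G \<zeta>))
          \<le> 1 / (1 - cmod z)\<^sup>2 * (LINT \<xi>|circle_measure. cmod (inv_phi n \<xi> - G \<xi>))" .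
      qed
    qed
  qed
  have "AE \<xi> in circle_measure. has_nontangential_limit (szego_function \<sigma>) \<xi> (G \<xi>)"
    by (rule nontangential_limit_of_L1_limit[OF borel_measurable_inv_phi continuous_inv_phi holomorphic_inv_phi GI lim L1 H])
  with lim nz show "AE \<xi> in circle_measure. \<exists>d. has_nontangential_limit (szego_function \<sigma>) \<xi> d \<and> d \<noteq> 0 \<and> (\<lambda>n. inv_phi n \<xi>) \<longlonglongrightarrow> d"
    by eventually_elim blast
qed

end

text \<open>
  The orthogonal polynomials exist and are unique, so the description operator in \<open>monic_OP\<close> denotes them
  and their norms are the products of the numbers \<open>\<rho>\<^sub>k\<close>. Therefore \<open>\<phi>\<^sub>n\<^sup>*\<close> is the reciprocal of the function
  whose boundary limit was found.
\<close>

theorem theorem3p1: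
  fixes \<gamma> :: "nat \<Rightarrow> complex" and \<sigma> :: "complex measure"
  assumes "qNCC_II"
    and "disc_sequence \<gamma>"
    and "in_l2 \<gamma>"
    and "\<sigma> \<in> circle_prob_measures"
    and "has_schur_parameters \<sigma> \<gamma>"
  shows "(AE \<xi> in circle_measure. convergent (\<lambda>n. Omega_prod \<gamma> \<xi> n)) \<and>
    (AE \<xi> in circle_measure. \<exists>d. has_nontangential_limit (szego_function \<sigma>) \<xi> d \<and> d \<noteq> 0 \<and>
       (\<lambda>n. poly (star (orthonormal_OP \<sigma> n)) \<xi>) \<longlonglongrightarrow> inverse d)"
proof -
  interpret nondegenerate_circle_measure \<sigma>
  proof (rule nondegenerate_circle_measure.intro)
    show "circle_finite_measure \<sigma>" by (rule circle_prob_measuresD[OF assms(4)])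
    show "nondegenerate_circle_measure_axioms \<sigma>"
      using assms(4) by unfold_locales (simp add: circle_prob_measures_def)
  qed
  interpret P: prob_space \<sigma> by (rule circle_prob_measuresD[OF assms(4)])
  have rec: "\<And>n. cmod (\<gamma> n) < 1" "monic_OP \<sigma> 0 = 1" "star (monic_OP \<sigma> 0) = 1"
    "\<And>n. monic_OP \<sigma> (Suc n) = [:0, 1:] * monic_OP \<sigma> n - smult (cnj (\<gamma> n)) (star (monic_OP \<sigma> n))"
    "\<And>n. star (monic_OP \<sigma> (Suc n)) = star (monic_OP \<sigma> n) - smult (\<gamma> n) ([:0, 1:] * monic_OP \<sigma> n)"
    using assms(5) unfolding has_schur_parameters_def disc_sequence_def by blast+
  have ort: "ortho n (monic_OP \<sigma> n)" for n
    using monic_OP_is_monic_OP[of n] unfolding is_monic_OP_iff by blast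
  interpret S: szego_prob \<gamma> "monic_OP \<sigma>" "\<lambda>n. star (monic_OP \<sigma> n)" \<sigma>
    by unfold_locales (fact rec ort)+
  have e: "poly (star (orthonormal_OP \<sigma> n)) \<xi> = inverse (S.inv_phi n \<xi>)" for n \<xi>
  proof -
    have s: "sqrt ((S.Phi_norm n)\<^sup>2) = S.Phi_norm n" by (rule real_sqrt_unique[OF refl less_imp_le[OF S.Phi_norm_pos]])
    have "poly (star (orthonormal_OP \<sigma> n)) \<xi> = of_real (inverse (S.Phi_norm n)) * poly (star (monic_OP \<sigma> n)) \<xi>"
      unfolding orthonormal_OP_def S.norm_\<Phi> s star_smult complex_cnj_complex_of_real poly_smult ..
    then show ?thesis
      unfolding S.inv_phi_def inverse_divide of_real_inverse by (simp only: divide_inverse mult.commute)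
  qed
  have "AE \<xi> in circle_measure. \<exists>d. has_nontangential_limit (szego_function \<sigma>) \<xi> d \<and> d \<noteq> 0 \<and>
       (\<lambda>n. poly (star (orthonormal_OP \<sigma> n)) \<xi>) \<longlonglongrightarrow> inverse d"
    using S.boundary_values(2)[OF assms(1,3)]
  proof eventually_elim
    fix \<xi> assume "\<exists>d. has_nontangential_limit (szego_function \<sigma>) \<xi> d \<and> d \<noteq> 0 \<and> (\<lambda>n. S.inv_phi n \<xi>) \<longlonglongrightarrow> d"
    then obtain d where d: "has_nontangential_limit (szego_function \<sigma>) \<xi> d" "d \<noteq> 0" "(\<lambda>n. S.inv_phi n \<xi>) \<longlonglongrightarrow> d" by (elim exE conjE)
    have "(\<lambda>n. poly (star (orthonormal_OP \<sigma> n)) \<xi>) \<longlonglongrightarrow> inverse d"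
      unfolding e by (rule tendsto_inverse[OF d(3,2)])
    with d(1,2) show "\<exists>d. has_nontangential_limit (szego_function \<sigma>) \<xi> d \<and> d \<noteq> 0 \<and>
       (\<lambda>n. poly (star (orthonormal_OP \<sigma> n)) \<xi>) \<longlonglongrightarrow> inverse d" by (intro exI[of _ d] conjI)
  qed
  with S.boundary_values(1)[OF assms(1,3)] show ?thesis by (rule conjI)
qed

end
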